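(* If $\Theta=(\theta_{jk})$ is a real symmetric positive definite $n\times n$ matrix, then $\lambda=1$ is not in the spectrum of the operator $\widehat K:L^2(I)\to L^2(I)$.
   Context: Let $n\in\mathbb N$, $I_j=[\alpha_j,\beta_j]$ with $-\infty<\alpha_1<\beta_1<\alpha_2<\dots<\alpha_n<\beta_n<\infty$, $I=\bigcup_{j=1}^n I_j$, and let $\chi_j$ be the characteristic function of $I_j$. $R_j(z)=\sqrt{(z-\alpha_j)(z-\beta_j)}$ is analytic in $\mathbb C\setminus I_j$ with $R_j(z)\sim z$ as $z\to\infty$; $R_{j+}$ denotes its boundary value on $I_j$ from the upper half-plane. $\widehat K$ is the Hilbert–Schmidt integral operator $(\widehat K\varphi)(z)=\int_IK(z,x)\varphi(x)\,dx$ on $L^2(I)$ with kernel $$K(z,x)=\frac{2}{2\pi i(x-z)}\sum_{\substack{j,k=1\\k\ne j}}^n\frac{\theta_{jk}R_{j+}(z)}{\theta_{jj}R_j(x)}\,\chi_j(z)\chi_k(x).$$ *)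

theory Defs
  imports "HOL-Analysis.Analysis"
begin

section \<open>The space $L^2(M)$ of complex-valued functions\<close>

definition L2_fun :: "'a measure \<Rightarrow> ('a \<Rightarrow> complex) set" where
  "L2_fun M = {f \<in> borel_measurable M. integrable M (\<lambda>x. (norm (f x))\<^sup>2)}"

definition L2_rel :: "'a measure \<Rightarrow> (('a \<Rightarrow> complex) \<times> ('a \<Rightarrow> complex)) set" where
  "L2_rel M = {(f, g). f \<in> L2_fun M \<and> g \<in> L2_fun M \<and> (AE x in M. f x = g x)}"

definition L2 :: "'a measure \<Rightarrow> ('a \<Rightarrow> complex) set set" where
  "L2 M = L2_fun M // L2_rel M"

abbreviation L2_class :: "'a measure \<Rightarrow> ('a \<Rightarrow> complex) \<Rightarrow> ('a \<Rightarrow> complex) set" where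
  "L2_class M f \<equiv> L2_rel M `` {f}"

text \<open>Operations on classes are unions over representatives; the lemmas further down show that
  they do not depend on the choice of representatives.  The same applies to \<open>integral_operator\<close> below.\<close>

definition L2_add ::
    "'a measure \<Rightarrow> ('a \<Rightarrow> complex) set \<Rightarrow> ('a \<Rightarrow> complex) set \<Rightarrow> ('a \<Rightarrow> complex) set" where
  "L2_add M F G = (\<Union>f\<in>F. \<Union>g\<in>G. L2_class M (\<lambda>x. f x + g x))"

definition L2_scale ::
    "'a measure \<Rightarrow> complex \<Rightarrow> ('a \<Rightarrow> complex) set \<Rightarrow> ('a \<Rightarrow> complex) set" where
  "L2_scale M c F = (\<Union>f\<in>F. L2_class M (\<lambda>x. c * f x))"

definition L2_norm :: "'a measure \<Rightarrow> ('a \<Rightarrow> complex) set \<Rightarrow> real" where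
  "L2_norm M F = sqrt (\<integral>x. (norm ((SOME f. f \<in> F) x))\<^sup>2 \<partial>M)"

section \<open>Bounded operators on $L^2(M)$ and their spectrum\<close>

definition L2_bounded_operator ::
    "'a measure \<Rightarrow> (('a \<Rightarrow> complex) set \<Rightarrow> ('a \<Rightarrow> complex) set) \<Rightarrow> bool" where
  "L2_bounded_operator M T \<longleftrightarrow>
     (\<forall>F\<in>L2 M. T F \<in> L2 M) \<and>
     (\<forall>F\<in>L2 M. \<forall>G\<in>L2 M. T (L2_add M F G) = L2_add M (T F) (T G)) \<and>
     (\<forall>c. \<forall>F\<in>L2 M. T (L2_scale M c F) = L2_scale M c (T F)) \<and>
     (\<exists>C. \<forall>F\<in>L2 M. L2_norm M (T F) \<le> C * L2_norm M F)"

definition L2_shift :: "'a measure \<Rightarrow> (('a \<Rightarrow> complex) set \<Rightarrow> ('a \<Rightarrow> complex) set) \<Rightarrow> complex \<Rightarrow>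
    ('a \<Rightarrow> complex) set \<Rightarrow> ('a \<Rightarrow> complex) set" where
  "L2_shift M T \<mu> F = L2_add M (T F) (L2_scale M (- \<mu>) F)"

definition L2_resolvent_set ::
    "'a measure \<Rightarrow> (('a \<Rightarrow> complex) set \<Rightarrow> ('a \<Rightarrow> complex) set) \<Rightarrow> complex set" where
  "L2_resolvent_set M T = {\<mu>. \<exists>S. L2_bounded_operator M S \<and>
     (\<forall>F\<in>L2 M. S (L2_shift M T \<mu> F) = F) \<and> (\<forall>F\<in>L2 M. L2_shift M T \<mu> (S F) = F)}"

definition L2_spectrum ::
    "'a measure \<Rightarrow> (('a \<Rightarrow> complex) set \<Rightarrow> ('a \<Rightarrow> complex) set) \<Rightarrow> complex set" where
  "L2_spectrum M T = - L2_resolvent_set M T"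

definition integral_operator ::
    "'a measure \<Rightarrow> ('a \<Rightarrow> 'a \<Rightarrow> complex) \<Rightarrow> ('a \<Rightarrow> complex) set \<Rightarrow> ('a \<Rightarrow> complex) set" where
  "integral_operator M k F = (\<Union>f\<in>F. L2_class M (\<lambda>z. \<integral>x. k z x * f x \<partial>M))"

subsection \<open>Independence of representatives\<close>

lemma equiv_L2_rel: "equiv (L2_fun M) (L2_rel M)"
proof (rule equivI)
  show "refl_on (L2_fun M) (L2_rel M)" by (auto simp: refl_on_def L2_rel_def)
  show "sym (L2_rel M)" by (auto simp: sym_def L2_rel_def)
  show "trans (L2_rel M)"
  proof (rule transI)
    fix f g h assume "(f, g) \<in> L2_rel M" "(g, h) \<in> L2_rel M"
    then show "(f, h) \<in> L2_rel M" by (auto simp: L2_rel_def elim: AE_mp)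
  qed
qed (auto simp: L2_rel_def)

lemma L2_fun_scale: "f \<in> L2_fun M \<Longrightarrow> (\<lambda>x. c * f x) \<in> L2_fun M"
  by (auto simp: L2_fun_def norm_mult power_mult_distrib)

lemma L2_fun_add:
  assumes "f \<in> L2_fun M" "g \<in> L2_fun M"
  shows "(\<lambda>x. f x + g x) \<in> L2_fun M"
proof -
  have m [measurable]: "f \<in> borel_measurable M" "g \<in> borel_measurable M"
    using assms by (auto simp: L2_fun_def)
  have "integrable M (\<lambda>x. (norm (f x + g x))\<^sup>2)"
  proof (rule Bochner_Integration.integrable_bound)
    show "integrable M (\<lambda>x. 2 * (norm (f x))\<^sup>2 + 2 * (norm (g x))\<^sup>2)"
      using assms by (auto simp: L2_fun_def)
    have "(norm (f x + g x))\<^sup>2 \<le> 2 * (norm (f x))\<^sup>2 + 2 * (norm (g x))\<^sup>2" for x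
    proof -
      have "(norm (f x + g x))\<^sup>2 \<le> (norm (f x) + norm (g x))\<^sup>2"
        by (intro power_mono norm_triangle_ineq) auto
      also have "\<dots> \<le> 2 * (norm (f x))\<^sup>2 + 2 * (norm (g x))\<^sup>2"
        using zero_le_power2[of "norm (f x) - norm (g x)"] by (simp add: power2_eq_square algebra_simps)
      finally show ?thesis .
    qed
    then show "AE x in M. norm ((norm (f x + g x))\<^sup>2)
        \<le> norm (2 * (norm (f x))\<^sup>2 + 2 * (norm (g x))\<^sup>2)" by auto
  qed measurable
  then show ?thesis by (auto simp: L2_fun_def)
qed

lemma L2_class_mem:
  assumes "f \<in> L2_fun M" shows "f \<in> L2_class M f" "L2_class M f \<in> L2 M"
  using assms by (auto simp: L2_rel_def L2_def quotient_def)

lemma L2_class_eqI: "f \<in> L2_fun M \<Longrightarrow> g \<in> L2_fun M \<Longrightarrow> AE x in M. f x = g x \<Longrightarrow>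
    L2_class M f = L2_class M g"
  by (rule equiv_class_eq[OF equiv_L2_rel]) (simp add: L2_rel_def)

lemma L2_norm_class:
  assumes "f \<in> L2_fun M"
  shows "L2_norm M (L2_class M f) = sqrt (\<integral>x. (norm (f x))\<^sup>2 \<partial>M)"
proof -
  define g where "g = (SOME g. g \<in> L2_class M f)"
  have g: "g \<in> L2_class M f"
    unfolding g_def by (rule someI[of "\<lambda>g. g \<in> L2_class M f"]) (rule L2_class_mem(1)[OF assms])
  then have [measurable]: "g \<in> borel_measurable M" "f \<in> borel_measurable M"
    by (auto simp: L2_rel_def L2_fun_def)
  have "(\<integral>x. (norm (g x))\<^sup>2 \<partial>M) = (\<integral>x. (norm (f x))\<^sup>2 \<partial>M)"
  proof (rule integral_cong_AE)
    have "AE x in M. f x = g x" using g by (auto simp: L2_rel_def)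
    then show "AE x in M. (norm (g x))\<^sup>2 = (norm (f x))\<^sup>2" by eventually_elim simp
  qed measurable
  then show ?thesis unfolding L2_norm_def g_def[symmetric] by simp
qed

lemma L2_scale_class:
  assumes "f \<in> L2_fun M"
  shows "L2_scale M c (L2_class M f) = L2_class M (\<lambda>x. c * f x)"
proof -
  have "L2_class M (\<lambda>x. c * g x) = L2_class M (\<lambda>x. c * f x)" if "g \<in> L2_class M f" for g
  proof (intro L2_class_eqI L2_fun_scale)
    have "AE x in M. f x = g x" using that by (auto simp: L2_rel_def)
    then show "AE x in M. c * g x = c * f x" by eventually_elim simp
  qed (use that assms in \<open>auto simp: L2_rel_def\<close>)
  then show ?thesis using L2_class_mem[OF assms] unfolding L2_scale_def by blast
qed

lemma L2_add_class:
  assumes "f \<in> L2_fun M" "g \<in> L2_fun M"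
  shows "L2_add M (L2_class M f) (L2_class M g) = L2_class M (\<lambda>x. f x + g x)"
proof -
  have "L2_class M (\<lambda>x. f' x + g' x) = L2_class M (\<lambda>x. f x + g x)"
    if "f' \<in> L2_class M f" "g' \<in> L2_class M g" for f' g'
  proof (intro L2_class_eqI L2_fun_add)
    have "AE x in M. f x = f' x" "AE x in M. g x = g' x" using that by (auto simp: L2_rel_def)
    then show "AE x in M. f' x + g' x = f x + g x" by eventually_elim simp
  qed (use that assms in \<open>auto simp: L2_rel_def\<close>)
  then show ?thesis
    using L2_class_mem[OF assms(1)] L2_class_mem[OF assms(2)] unfolding L2_add_def by blast
qed

lemma integral_operator_class:
  assumes f: "f \<in> L2_fun M" and k: "\<And>z. z \<in> space M \<Longrightarrow> k z \<in> borel_measurable M"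
    and Kf: "(\<lambda>z. \<integral>x. k z x * f x \<partial>M) \<in> L2_fun M"
  shows "integral_operator M k (L2_class M f) = L2_class M (\<lambda>z. \<integral>x. k z x * f x \<partial>M)"
proof -
  have "L2_class M (\<lambda>z. \<integral>x. k z x * g x \<partial>M) = L2_class M (\<lambda>z. \<integral>x. k z x * f x \<partial>M)"
    if g: "g \<in> L2_class M f" for g
  proof -
    have eq: "(\<integral>x. k z x * g x \<partial>M) = (\<integral>x. k z x * f x \<partial>M)" if z: "z \<in> space M" for z
    proof (rule integral_cong_AE)
      have [measurable]: "g \<in> borel_measurable M" "f \<in> borel_measurable M" "k z \<in> borel_measurable M"
        using g k[OF z] by (auto simp: L2_rel_def L2_fun_def)
      show "(\<lambda>x. k z x * g x) \<in> borel_measurable M" "(\<lambda>x. k z x * f x) \<in> borel_measurable M"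
        by measurable
      have "AE x in M. f x = g x" using g by (auto simp: L2_rel_def)
      then show "AE x in M. k z x * g x = k z x * f x" by eventually_elim simp
    qed
    have "(\<lambda>z. \<integral>x. k z x * g x \<partial>M) \<in> L2_fun M"
      using Kf eq unfolding L2_fun_def
      by (auto cong: measurable_cong Bochner_Integration.integrable_cong)
    then show ?thesis using Kf eq by (intro L2_class_eqI) auto
  qed
  then show ?thesis using L2_class_mem[OF f] unfolding integral_operator_def by blast
qed

section \<open>The branch of $\sqrt{(z-a)(z-b)}$ with cut $[a,b]$\<close>

definition is_sqrt_branch :: "real \<Rightarrow> real \<Rightarrow> (complex \<Rightarrow> complex) \<Rightarrow> bool" where
  "is_sqrt_branch a b R \<longleftrightarrow>
     R holomorphic_on - complex_of_real ` {a..b} \<and>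
     (\<forall>z \<in> - complex_of_real ` {a..b}. (R z)\<^sup>2 = (z - of_real a) * (z - of_real b)) \<and>
     ((\<lambda>z. R z / z) \<longlongrightarrow> 1) at_infinity"

text \<open>Off the cut the branch exists and is unique (lemmas below); its values on the cut are
  unspecified and play no role.\<close>

definition sqrt_branch :: "real \<Rightarrow> real \<Rightarrow> complex \<Rightarrow> complex" where
  "sqrt_branch a b = (SOME R. is_sqrt_branch a b R)"

definition sqrt_branch_plus :: "real \<Rightarrow> real \<Rightarrow> real \<Rightarrow> complex" where
  "sqrt_branch_plus a b x = Lim (at (of_real x) within {w. 0 < Im w}) (sqrt_branch a b)"

lemma sqrt_branch_unique:
  assumes "is_sqrt_branch a b R" "is_sqrt_branch a b S"
    and ab: "a \<le> b" and z: "z \<notin> complex_of_real ` {a..b}"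
  shows "R z = S z"
proof -
  let ?U = "- complex_of_real ` {a..b}"
  have seg: "complex_of_real ` {a..b} = closed_segment (of_real a) (of_real b)"
    using ab by (simp add: closed_segment_of_real closed_segment_eq_real_ivl)
  have conn: "connected ?U"
    by (rule connected_complement_bounded_convex) (auto simp: seg bounded_closed_segment)
  have sq: "(R w)\<^sup>2 = (w - of_real a) * (w - of_real b)" "(S w)\<^sup>2 = (w - of_real a) * (w - of_real b)"
    if "w \<in> ?U" for w
    using assms(1,2) that unfolding is_sqrt_branch_def by blast+
  have nz: "R w \<noteq> 0 \<and> S w \<noteq> 0" if "w \<in> ?U" for w
  proof -
    have "w \<noteq> of_real a" "w \<noteq> of_real b" using that ab by auto
    then have "(R w)\<^sup>2 \<noteq> 0" "(S w)\<^sup>2 \<noteq> 0" using sq[OF that] by simp_all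
    then show ?thesis by simp
  qed
  have cont: "continuous_on ?U (\<lambda>w. R w / S w)"
    using assms(1,2) nz unfolding is_sqrt_branch_def
    by (intro continuous_on_divide holomorphic_on_imp_continuous_on) auto
  have vals: "R w / S w \<in> {1, - 1}" if "w \<in> ?U" for w
  proof -
    have "R w = S w \<or> R w = - S w" using sq[OF that] by (simp add: power2_eq_iff[symmetric])
    then show ?thesis using nz[OF that] by auto
  qed
  have "finite ((\<lambda>w. R w / S w) ` ?U)"
  proof (rule finite_subset)
    show "(\<lambda>w. R w / S w) ` ?U \<subseteq> {1, - 1}" using vals by blast
  qed simp
  then have "(\<lambda>w. R w / S w) constant_on ?U"
    by (rule continuous_finite_range_constant[OF conn cont])
  then obtain c where c: "\<And>w. w \<in> ?U \<Longrightarrow> R w / S w = c" unfolding constant_on_def by blast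
  have ev: "\<forall>\<^sub>F w in at_infinity. w \<in> ?U \<and> w \<noteq> 0"
  proof -
    have "bounded (complex_of_real ` {a..b})" by (simp add: seg bounded_closed_segment)
    then obtain B where B: "\<And>w. w \<in> complex_of_real ` {a..b} \<Longrightarrow> norm w \<le> B"
      unfolding bounded_iff by blast
    have "w \<in> ?U \<and> w \<noteq> 0" if "max B 0 + 1 \<le> norm w" for w
    proof
      show "w \<in> ?U" using B[of w] that by (auto simp del: image_iff)
      show "w \<noteq> 0" using that by (intro notI) simp
    qed
    then show ?thesis unfolding eventually_at_infinity by blast
  qed
  have "((\<lambda>w. (R w / w) / (S w / w)) \<longlongrightarrow> 1 / 1) at_infinity"
    using assms(1,2) unfolding is_sqrt_branch_def by (intro tendsto_divide) simp_all
  moreover have "\<forall>\<^sub>F w in at_infinity. (R w / w) / (S w / w) = c"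
    using ev
  proof eventually_elim
    case (elim w)
    then show ?case using c[of w] by simp
  qed
  ultimately have "((\<lambda>w. c) \<longlongrightarrow> 1 / 1) (at_infinity :: complex filter)"
    by (rule Lim_transform_eventually)
  then have "c = 1 / 1" by (rule tendsto_unique[OF trivial_limit_at_infinity tendsto_const])
  then show ?thesis using c[of z] z nz[of z] by simp
qed

lemma is_sqrt_branch_explicit:
  assumes "a < b"
  shows "is_sqrt_branch a b (\<lambda>z. (z - of_real b) * csqrt ((z - of_real a) / (z - of_real b)))"
  unfolding is_sqrt_branch_def
proof (intro conjI ballI)
  let ?U = "- complex_of_real ` {a..b}"
  have nb: "z \<noteq> of_real b" if "z \<in> ?U" for z using that assms by auto
  have np: "(z - of_real a) / (z - of_real b) \<notin> \<real>\<^sub>\<le>\<^sub>0" if "z \<in> ?U" for z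
  proof
    assume "(z - of_real a) / (z - of_real b) \<in> \<real>\<^sub>\<le>\<^sub>0"
    then obtain t where t: "(z - of_real a) / (z - of_real b) = of_real t" "t \<le> 0"
      by (auto elim!: nonpos_Reals_cases)
    have "z - of_real a = of_real t * (z - of_real b)"
      using t(1) nb[OF that] by (simp add: field_simps)
    then have "z * of_real (1 - t) = of_real (a - t * b)" by (simp add: algebra_simps)
    then have z: "z = of_real ((a - t * b) / (1 - t))"
      using t(2) by (simp add: eq_divide_eq flip: of_real_mult of_real_diff)
    have "t * b \<le> t * a" using t(2) assms by (intro mult_left_mono_neg) auto
    then have "(a - t * b) / (1 - t) \<in> {a..b}"
      using t(2) assms by (simp add: divide_le_eq le_divide_eq algebra_simps)
    then show False using that z by blast
  qed
  show "(\<lambda>z. (z - of_real b) * csqrt ((z - of_real a) / (z - of_real b))) holomorphic_on ?U"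
    using nb np by (auto intro!: holomorphic_intros)
  show "((z - of_real b) * csqrt ((z - of_real a) / (z - of_real b)))\<^sup>2
      = (z - of_real a) * (z - of_real b)" if "z \<in> ?U" for z
    using nb[OF that] by (simp add: power_mult_distrib power2_eq_square[of "z - of_real b"])
  have inv: "((\<lambda>z::complex. c / z) \<longlongrightarrow> 0) at_infinity" for c
    using tendsto_mult_right_zero[OF tendsto_inverse_0, of c] by (simp add: divide_inverse)
  have sub: "((\<lambda>z::complex. 1 - c / z) \<longlongrightarrow> 1) at_infinity" for c
    using tendsto_diff[OF tendsto_const[of 1] inv[of c]] by simp
  have "((\<lambda>z. (1 - of_real b / z) * csqrt ((1 - of_real a / z) / (1 - of_real b / z)))
      \<longlongrightarrow> 1 * csqrt (1 / 1)) at_infinity"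
  proof (intro tendsto_mult sub)
    have "isCont csqrt (1 / 1)" by (rule continuous_at_csqrt) simp
    moreover have "((\<lambda>z::complex. (1 - of_real a / z) / (1 - of_real b / z)) \<longlongrightarrow> 1 / 1) at_infinity"
      by (intro tendsto_divide sub) auto
    ultimately show "((\<lambda>z. csqrt ((1 - of_real a / z) / (1 - of_real b / z)))
      \<longlongrightarrow> csqrt (1 / 1)) at_infinity"
      by (rule isCont_tendsto_compose)
  qed
  moreover have "\<forall>\<^sub>F z in at_infinity.
      (1 - of_real b / z) * csqrt ((1 - of_real a / z) / (1 - of_real b / z))
      = (z - of_real b) * csqrt ((z - of_real a) / (z - of_real b)) / z"
    unfolding eventually_at_infinity
  proof (intro exI[of _ 1] allI impI)
    fix z :: complex assume "1 \<le> norm z"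
    then have z: "z \<noteq> 0" by auto
    then have "1 - of_real c / z = (z - of_real c) / z" for c by (simp add: field_simps)
    then show "(1 - of_real b / z) * csqrt ((1 - of_real a / z) / (1 - of_real b / z))
      = (z - of_real b) * csqrt ((z - of_real a) / (z - of_real b)) / z" using z by simp
  qed
  ultimately show "((\<lambda>z. (z - of_real b) * csqrt ((z - of_real a) / (z - of_real b)) / z) \<longlongrightarrow> 1)
      at_infinity"
    by (subst (asm) tendsto_cong) auto
qed

lemma is_sqrt_branch_sqrt_branch: "a < b \<Longrightarrow> is_sqrt_branch a b (sqrt_branch a b)"
  unfolding sqrt_branch_def by (rule someI[of "is_sqrt_branch a b"]) (rule is_sqrt_branch_explicit)

lemma sqrt_branch_explicit:
  assumes "a < b" "z \<notin> complex_of_real ` {a..b}"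
  shows "sqrt_branch a b z = (z - of_real b) * csqrt ((z - of_real a) / (z - of_real b))"
  using assms
  by (intro sqrt_branch_unique[OF is_sqrt_branch_sqrt_branch is_sqrt_branch_explicit]) auto

lemma sqrt_branch_plus_tendsto:
  assumes "a < b" "x \<in> {a..b}"
  shows "(sqrt_branch a b \<longlongrightarrow> \<i> * of_real (sqrt ((x - a) * (b - x))))
           (at (of_real x) within {w. 0 < Im w})"
proof -
  note csqrt.simps [simp del]
  have quad: "Re (csqrt w) > 0 \<and> Im (csqrt w) > 0" if "Im w > 0" for w
  proof -
    have "Im w = 2 * (Re (csqrt w) * Im (csqrt w))"
      using arg_cong[OF power2_csqrt[of w], of Im] by (simp add: power2_eq_square mult.commute
          del: power2_csqrt)
    then have "Re (csqrt w) * Im (csqrt w) > 0" using that by linarith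
    then show ?thesis using Re_csqrt[of w] by (simp add: zero_less_mult_iff)
  qed
  have upper: "sqrt_branch a b z = \<i> * csqrt (z - of_real a) * csqrt (of_real b - z)"
    if z: "Im z > 0" for z
  proof -
    let ?p = "csqrt (z - of_real a)" and ?q = "csqrt (z - of_real b)"
    have pq: "Re ?p > 0" "Im ?p > 0" "Re ?q > 0" "Im ?q > 0"
      using quad[of "z - of_real a"] quad[of "z - of_real b"] z by auto
    then have q0: "?q \<noteq> 0" by (metis less_irrefl zero_complex.sel(1))
    have mult_div: "c * (w / q) = w * q" if "c = q * q" "q \<noteq> 0" for c w q :: complex
      using that by simp
    have "Re (?p / ?q) > 0"
      using pq by (auto simp: Re_divide zero_less_divide_iff add_pos_pos)
    moreover have "(?p / ?q)\<^sup>2 = (z - of_real a) / (z - of_real b)" by (simp add: power_divide)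
    ultimately have root: "csqrt ((z - of_real a) / (z - of_real b)) = ?p / ?q"
      by (intro csqrt_unique) auto
    have q: "z - of_real b = ?q * ?q"
      using power2_csqrt[of "z - of_real b"] unfolding power2_eq_square by (rule sym)
    have "z \<notin> complex_of_real ` {a..b}" using z by auto
    then have "sqrt_branch a b z = (z - of_real b) * (?p / ?q)"
      unfolding root[symmetric] by (rule sqrt_branch_explicit[OF assms(1)])
    also have "\<dots> = ?p * ?q" by (rule mult_div[OF q q0])
    finally have "sqrt_branch a b z = ?p * ?q" .
    moreover have "?q = \<i> * csqrt (of_real b - z)"
      using csqrt_minus[of "of_real b - z"] z by auto
    ultimately show ?thesis by simp
  qed
  have pos: "(csqrt \<longlongrightarrow> csqrt (of_real t)) (at (of_real t))" if "t \<ge> 0" for t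
  proof (cases "t = 0")
    case False
    then show ?thesis using that continuous_at_csqrt[of "of_real t"] by (auto simp: continuous_at)
  next
    case True
    have "((\<lambda>w::complex. sqrt (norm w)) \<longlongrightarrow> sqrt (norm (0::complex))) (at 0)"
      by (rule tendsto_real_sqrt[OF tendsto_norm[OF tendsto_ident_at]])
    then have "((\<lambda>w. norm (csqrt w)) \<longlongrightarrow> 0) (at 0)"
      by simp
    then have "(csqrt \<longlongrightarrow> 0) (at 0)" by (rule tendsto_norm_zero_cancel)
    then show ?thesis using True by simp
  qed
  have cont: "isCont csqrt (of_real t)" if "t \<ge> 0" for t
    using pos[OF that] by (simp add: continuous_at)
  have "((\<lambda>z. \<i> * csqrt (z - of_real a) * csqrt (of_real b - z)) \<longlongrightarrow>
      \<i> * csqrt (of_real (x - a)) * csqrt (of_real (b - x))) (at (of_real x) within {w. 0 < Im w})"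
    using assms
    by (intro tendsto_mult tendsto_const isCont_tendsto_compose[OF cont])
      (auto intro!: tendsto_eq_intros)
  moreover have "\<i> * csqrt (of_real (x - a)) * csqrt (of_real (b - x))
      = \<i> * of_real (sqrt ((x - a) * (b - x)))"
    using assms by (simp add: real_sqrt_mult del: of_real_diff)
  ultimately have lim: "((\<lambda>z. \<i> * csqrt (z - of_real a) * csqrt (of_real b - z)) \<longlongrightarrow>
      \<i> * of_real (sqrt ((x - a) * (b - x)))) (at (of_real x) within {w. 0 < Im w})"
    by (simp only:)
  have "\<forall>\<^sub>F z in at (of_real x) within {w. 0 < Im w}.
      \<i> * csqrt (z - of_real a) * csqrt (of_real b - z) = sqrt_branch a b z"
    using upper by (auto simp: eventually_at intro!: exI[of _ 1])
  with lim show ?thesis by (rule Lim_transform_eventually)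
qed

lemma sqrt_branch_plus_explicit:
  assumes "a < b" "x \<in> {a..b}"
  shows "sqrt_branch_plus a b x = \<i> * of_real (sqrt ((x - a) * (b - x)))"
  unfolding sqrt_branch_plus_def
proof (rule tendsto_Lim[OF _ sqrt_branch_plus_tendsto[OF assms]])
  show "\<not> trivial_limit (at (complex_of_real x) within {w. 0 < Im w})"
    unfolding trivial_limit_within islimpt_approachable not_not
  proof (intro allI impI)
    fix e :: real assume "0 < e"
    then show "\<exists>y\<in>{w. 0 < Im w}. y \<noteq> of_real x \<and> dist y (of_real x) < e"
      by (intro bexI[of _ "of_real x + \<i> * of_real (e / 2)"])
        (auto simp: dist_norm norm_mult complex_eq_iff)
  qed
qed

section \<open>The kernel and its operator\<close>

text \<open>The index type \<open>'n\<close> plays the role of $\{1,\dots,n\}$; a linear order on it is only needed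
  to order the intervals.  The diagonal $x=z$ is harmless: every summand vanishes there because
  the intervals are disjoint.\<close>

definition kernel_K :: "('n::finite \<Rightarrow> real) \<Rightarrow> ('n \<Rightarrow> real) \<Rightarrow> real^'n^'n \<Rightarrow> real \<Rightarrow> real \<Rightarrow> complex"
where
  "kernel_K \<alpha> \<beta> \<Theta> z x =
     2 / (2 * of_real pi * \<i> * of_real (x - z)) *
     (\<Sum>j\<in>UNIV. \<Sum>k\<in>UNIV - {j}.
        of_real (\<Theta> $ j $ k) * sqrt_branch_plus (\<alpha> j) (\<beta> j) z /
        (of_real (\<Theta> $ j $ j) * sqrt_branch (\<alpha> j) (\<beta> j) (of_real x)) *
        indicator {\<alpha> j..\<beta> j} z * indicator {\<alpha> k..\<beta> k} x)"

abbreviation union_I :: "('n \<Rightarrow> real) \<Rightarrow> ('n \<Rightarrow> real) \<Rightarrow> real set" where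
  "union_I \<alpha> \<beta> \<equiv> (\<Union>j. {\<alpha> j..\<beta> j})"

definition operator_K :: "('n::finite \<Rightarrow> real) \<Rightarrow> ('n \<Rightarrow> real) \<Rightarrow> real^'n^'n \<Rightarrow>
    (real \<Rightarrow> complex) set \<Rightarrow> (real \<Rightarrow> complex) set" where
  "operator_K \<alpha> \<beta> \<Theta> = integral_operator (lebesgue_on (union_I \<alpha> \<beta>)) (kernel_K \<alpha> \<beta> \<Theta>)"

definition positive_definite :: "real^'n^'n \<Rightarrow> bool" where
  "positive_definite A \<longleftrightarrow> (\<forall>v. v \<noteq> 0 \<longrightarrow> 0 < v \<bullet> (A *v v))"

end

theory Submission
  imports Defs
begin

text \<open>
  For \<open>z \<in> I\<^sub>j\<close>, \<open>x \<in> I\<^sub>k\<close>, \<open>j \<noteq> k\<close> the kernel is \<open>K(z,x) = (\<theta>\<^sub>j\<^sub>k / \<theta>\<^sub>j\<^sub>j) P\<^sub>j(z,x)\<close>, where \<open>P\<^sub>j\<close>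
  is the Poisson kernel of the half-Laplacian on \<open>I\<^sub>j\<close>.  Let \<open>D\<close> be the Gagliardo form
  \<open>D(v,w) = \<integral>\<integral> (v x - v y) (w x - w y) / (x - y)\<^sup>2 dx dy\<close>, so that
  \<open>D(v,w) = -2 \<integral>\<integral> v x w y / (x - y)\<^sup>2 dx dy\<close> for disjoint supports.  If \<open>u = t K \<phi>\<close>,
  \<open>g = \<phi> - u\<close> and \<open>u\<^sub>j\<close> is the restriction of \<open>u\<close> to \<open>I\<^sub>j\<close>, the defining property of the Poisson kernel
  turns the equation \<open>u = t K (u + g)\<close> into
  \<open>\<Sum>\<^sub>j \<theta>\<^sub>j\<^sub>j D(u\<^sub>j,u\<^sub>j) + t \<Sum>\<^sub>j\<^sub>\<noteq>\<^sub>k \<theta>\<^sub>j\<^sub>k D(u\<^sub>j,u\<^sub>k) = 2 t \<Sum>\<^sub>j\<^sub>\<noteq>\<^sub>k \<theta>\<^sub>j\<^sub>k \<integral>\<integral> u\<^sub>j y g x 1\<^sub>k x / (x - y)\<^sup>2\<close>.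
  For \<open>0 \<le> t \<le> 1\<close> the left-hand side is uniformly coercive, because \<open>\<Theta>\<close> with its off-diagonal entries
  multiplied by \<open>t\<close> is uniformly positive definite.  This bounds \<open>u\<close> by \<open>g\<close> uniformly in \<open>t\<close>, and the method
  of continuity in \<open>t\<close>, applied on the space of bounded continuous functions into which the smoothing operator
  \<open>K\<close> maps, makes \<open>I - K\<close> surjective; no Fredholm theory is needed.  The identity for \<open>D(u\<^sub>j,u\<^sub>j)\<close> is proved
  with the substitution \<open>y = c - l cos t\<close>, which diagonalises \<open>D\<close> on \<open>I\<^sub>j\<close> by sine series.
\<close>

text \<open>Why sine series diagonalise both kernels: in the angle t, the Poisson kernel and the
  weighted kernel \<open>l sin t / (x - z)^2\<close> expand in sin(m t) with the same powers q^m of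
  one number q attached to x, the second with an additional factor pi m. The half-Laplacian of a
  Poisson extension is thus read off termwise, and the energy is a sum of m times squared
  coefficients. That sum is found on the circle (Douglas's formula for the Dirichlet energy, with
  Fejer kernels supplying the factor m); folding the circle onto the half-circle leaves reflected
  terms, which are exactly the interaction of an interval with its complement. Exterior data at a
  positive distance make the coefficients decay geometrically, so finiteness of the energies needs
  no separate regularity argument. Positive definiteness is used pointwise: for each pair (x, y) the
  difference quotients of the u_j form a vector, the quadratic form of \<open>\<Theta>\<close> is
  applied to it, and only then is the result integrated. The division by
  \<open>\<Theta> $ j $ j\<close> in the kernel is undone by weighting the j-th equation.\<close>

section \<open>Integration over a compact interval\<close>

abbreviation ivl :: "real \<Rightarrow> real \<Rightarrow> real measure" where
  "ivl a b \<equiv> density lborel (indicator {a..b})"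

lemma finite_measure_ivl: "finite_measure (ivl a b)"
  by (intro finite_measureI) (simp add: emeasure_density emeasure_lborel_Icc_eq)

lemma sigma_finite_ivl: "sigma_finite_measure (ivl a b)"
  using finite_measure_ivl by (simp add: finite_measure_def)

lemma pair_sigma_finite_ivl: "pair_sigma_finite (ivl a b) (ivl c d)"
  by (simp add: pair_sigma_finite_def sigma_finite_ivl)

lemma integrable_ivl_bounded:
  fixes f :: "real \<Rightarrow> real"
  assumes "f \<in> borel_measurable borel" "\<And>x. \<bar>f x\<bar> \<le> B"
  shows "integrable (ivl a b) f"
  using assms by (intro finite_measure.integrable_const_bound[OF finite_measure_ivl, of _ B]) auto

lemma integral_ivl_eq:
  fixes f :: "real \<Rightarrow> real"
  assumes "f \<in> borel_measurable borel"
  shows "(\<integral>x. f x \<partial>ivl a b) = (\<integral>x. f x * indicator {a..b} x \<partial>lborel)"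
proof -
  have "(\<integral>x. f x \<partial>density lborel (\<lambda>x. ennreal (indicator {a..b} x))) = (\<integral>x. indicator {a..b} x *\<^sub>R f x \<partial>lborel)"
    using assms by (intro integral_density) auto
  then show ?thesis by (simp add: mult.commute ennreal_indicator)
qed

lemma integral_ivl_FTC:
  fixes f F :: "real \<Rightarrow> real"
  assumes "a \<le> b" "\<And>x. (F has_real_derivative f x) (at x)" "\<And>x. isCont f x"
  shows "(\<integral>x. f x \<partial>ivl a b) = F b - F a"
proof -
  have "f \<in> borel_measurable borel"
    using assms(3) by (intro borel_measurable_continuous_onI continuous_at_imp_continuous_on) auto
  then show ?thesis
    using assms integral_FTC_Icc_real[of a b F f] by (simp add: integral_ivl_eq)
qed

lemma nn_integral_ivl:
  assumes [measurable]: "f \<in> borel_measurable borel"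
  shows "(\<integral>\<^sup>+x. f x \<partial>ivl a b) = (\<integral>\<^sup>+x. f x * indicator {a..b} x \<partial>lborel)"
  by (simp add: nn_integral_density mult.commute)

section \<open>The Gagliardo form of a sine series\<close>

lemma integral_ivl_cos:
  "(\<integral>x. cos (of_int k * x) \<partial>ivl (- pi) pi) = (if k = 0 then 2 * pi else 0)"
proof (cases "k = 0")
  case True
  have "(\<integral>x. 1 \<partial>ivl (- pi) pi) = pi - (- pi)"
    by (rule integral_ivl_FTC) (auto intro!: derivative_eq_intros)
  then show ?thesis using True by simp
next
  case False
  have "(\<integral>x. cos (of_int k * x) \<partial>ivl (- pi) pi) = sin (of_int k * pi) / k - sin (of_int k * (- pi)) / k"
    using False by (intro integral_ivl_FTC) (auto intro!: derivative_eq_intros simp: field_simps)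
  moreover have "sin (of_int k * pi) = 0" by (subst sin_zero_iff_int2) blast
  ultimately show ?thesis using False by simp
qed

lemma integral_ivl_sin: "(\<integral>x. sin (of_int k * x) \<partial>ivl (- pi) pi) = 0"
proof (cases "k = 0")
  case False
  have "(\<integral>x. sin (of_int k * x) \<partial>ivl (- pi) pi) = - cos (of_int k * pi) / k - (- cos (of_int k * (- pi)) / k)"
    using False by (intro integral_ivl_FTC) (auto intro!: derivative_eq_intros simp: field_simps)
  then show ?thesis using False by simp
qed simp

lemma integral_ivl_sin_sin:
  fixes m n :: nat
  shows "(\<integral>x. sin (m * x) * sin (n * x) \<partial>ivl (- pi) pi) = (if m = n \<and> m \<noteq> 0 then pi else 0)"
proof -
  have "sin (m * x) * sin (n * x) =
      1/2 * cos (of_int (int m - int n) * x) - 1/2 * cos (of_int (int m + int n) * x)" for x :: real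
    by (simp add: cos_add cos_diff algebra_simps)
  moreover have "integrable (ivl (- pi) pi) (\<lambda>x. cos (of_int k * x))" for k
    by (rule integrable_ivl_bounded[where B=1]) auto
  ultimately show ?thesis by (simp add: integral_ivl_cos del: of_int_add of_int_diff)
qed

lemma integral_ivl_sin_cos:
  fixes m n :: nat
  shows "(\<integral>x. sin (m * x) * cos (n * x) \<partial>ivl (- pi) pi) = 0"
proof -
  have "sin (m * x) * cos (n * x) =
      1/2 * sin (of_int (int m - int n) * x) + 1/2 * sin (of_int (int m + int n) * x)" for x :: real
    by (simp add: sin_add sin_diff algebra_simps)
  moreover have "integrable (ivl (- pi) pi) (\<lambda>x. sin (of_int k * x))" for k
    by (rule integrable_ivl_bounded[where B=1]) auto
  ultimately show ?thesis by (simp add: integral_ivl_sin del: of_int_add of_int_diff)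
qed

lemma integral_ivl_cos_cos:
  fixes m n :: nat
  assumes "m \<noteq> 0"
  shows "(\<integral>x. cos (m * x) * cos (n * x) \<partial>ivl (- pi) pi) = (if m = n then pi else 0)"
proof -
  have "cos (m * x) * cos (n * x) =
      1/2 * cos (of_int (int m - int n) * x) + 1/2 * cos (of_int (int m + int n) * x)" for x :: real
    by (simp add: cos_add cos_diff algebra_simps)
  moreover have "integrable (ivl (- pi) pi) (\<lambda>x. cos (of_int k * x))" for k
    by (rule integrable_ivl_bounded[where B=1]) auto
  ultimately show ?thesis using assms by (simp add: integral_ivl_cos del: of_int_add of_int_diff)
qed

section \<open>Termwise integration and Parseval's identity for absolutely summable series\<close>

lemma integral_ivl_sums:
  fixes g :: "real \<Rightarrow> real"
  assumes a: "summable (\<lambda>m. \<bar>a m\<bar>)"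
    and h: "\<And>m. h m \<in> borel_measurable borel" "\<And>m x. \<bar>h m x\<bar> \<le> B"
    and g: "g \<in> borel_measurable borel" "\<And>x. \<bar>g x\<bar> \<le> G"
  shows "(\<lambda>m. a m * (\<integral>x. g x * h m x \<partial>ivl c d)) sums (\<integral>x. g x * (\<Sum>m. a m * h m x) \<partial>ivl c d)"
proof -
  note [measurable] = h(1) g(1)
  have G: "0 \<le> G" using g(2)[of 0] by linarith
  have B: "\<bar>g x * (a m * h m x)\<bar> \<le> \<bar>a m\<bar> * (G * B)" for m x
  proof -
    have "\<bar>g x * (a m * h m x)\<bar> = \<bar>a m\<bar> * (\<bar>g x\<bar> * \<bar>h m x\<bar>)" by (simp add: abs_mult)
    also have "\<dots> \<le> \<bar>a m\<bar> * (G * B)" using g(2) h(2) G by (intro mult_left_mono mult_mono) auto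
    finally show ?thesis .
  qed
  have int: "integrable (ivl c d) (\<lambda>x. g x * (a m * h m x))" for m
    by (rule integrable_ivl_bounded[OF _ B]) measurable
  have "(\<lambda>m. \<integral>x. g x * (a m * h m x) \<partial>ivl c d) sums (\<integral>x. (\<Sum>m. g x * (a m * h m x)) \<partial>ivl c d)"
  proof (rule sums_integral[OF int])
    have "summable (\<lambda>m. norm (g x * (a m * h m x)))" for x
      using B by (intro summable_comparison_test'[OF summable_mult2[OF a, of "G * B"], of 0]) auto
    then show "AE x in ivl c d. summable (\<lambda>m. norm (g x * (a m * h m x)))" by simp
    have "(\<integral>x. norm (g x * (a m * h m x)) \<partial>ivl c d) \<le> \<bar>a m\<bar> * (G * B) * measure (ivl c d) UNIV" for m
    proof -
      have "(\<integral>x. norm (g x * (a m * h m x)) \<partial>ivl c d) \<le> (\<integral>x. \<bar>a m\<bar> * (G * B) \<partial>ivl c d)"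
        using B by (intro integral_mono integrable_norm[OF int]
            finite_measure.integrable_const[OF finite_measure_ivl]) auto
      then show ?thesis by (simp add: mult_ac)
    qed
    then show "summable (\<lambda>m. \<integral>x. norm (g x * (a m * h m x)) \<partial>ivl c d)"
      by (intro summable_comparison_test'[OF summable_mult2[OF a, of "G * B * measure (ivl c d) UNIV"], of 0])
        (auto simp: mult.assoc)
  qed
  moreover have "(\<Sum>m. g x * (a m * h m x)) = g x * (\<Sum>m. a m * h m x)" for x
  proof (rule suminf_mult)
    show "summable (\<lambda>m. a m * h m x)"
      using h(2) by (intro summable_comparison_test'[OF summable_mult2[OF a, of B], of 0])
        (auto simp: abs_mult intro!: mult_left_mono)
  qed
  moreover have "(\<integral>x. g x * (a m * h m x) \<partial>ivl c d) = a m * (\<integral>x. g x * h m x \<partial>ivl c d)" for m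
    by (subst integral_mult_right_zero[symmetric]) (simp add: mult.left_commute)
  ultimately show ?thesis by simp
qed

lemma abs_suminf_le:
  fixes a :: "nat \<Rightarrow> real"
  assumes a: "summable (\<lambda>m. \<bar>a m\<bar>)" and h: "\<And>m. \<bar>h m\<bar> \<le> B"
  shows "\<bar>\<Sum>m. a m * h m\<bar> \<le> (\<Sum>m. \<bar>a m\<bar>) * B"
proof -
  have le: "\<bar>a m * h m\<bar> \<le> \<bar>a m\<bar> * B" for m
    using h by (auto simp: abs_mult intro: mult_left_mono)
  have s: "summable (\<lambda>m. \<bar>a m * h m\<bar>)"
    using le by (intro summable_comparison_test'[OF summable_mult2[OF a, of B], of 0]) auto
  have "\<bar>\<Sum>m. a m * h m\<bar> \<le> (\<Sum>m. \<bar>a m * h m\<bar>)" by (rule summable_rabs[OF s])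
  also have "\<dots> \<le> (\<Sum>m. \<bar>a m\<bar> * B)" using le s summable_mult2[OF a, of B] by (intro suminf_le) auto
  finally show ?thesis by (simp add: suminf_mult2[OF a, symmetric])
qed

text \<open>Parseval's identity: one factor is integrated termwise, then the other. Two coefficient
  sequences are allowed because the energy later pairs the series with coefficients A_m with the one
  with coefficients m A_m.\<close>

lemma integral_sum_sq_orthogonal:
  fixes a :: "nat \<Rightarrow> real"
  assumes a: "summable (\<lambda>m. \<bar>a m\<bar>)" and b: "summable (\<lambda>m. \<bar>b m\<bar>)"
    and h[measurable]: "\<And>m. h m \<in> borel_measurable borel" and hB: "\<And>m x. \<bar>h m x\<bar> \<le> B"
    and orth: "\<And>m n. (\<integral>x. h m x * h n x \<partial>ivl c d) = (if m = n then w m else 0)"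
  shows "(\<lambda>m. a m * b m * w m) sums (\<integral>x. (\<Sum>m. a m * h m x) * (\<Sum>m. b m * h m x) \<partial>ivl c d)"
proof -
  let ?f = "\<lambda>x. \<Sum>m. a m * h m x"
  have "(\<lambda>m. b m * (\<integral>x. ?f x * h m x \<partial>ivl c d)) sums (\<integral>x. ?f x * (\<Sum>m. b m * h m x) \<partial>ivl c d)"
    using hB abs_suminf_le[OF a hB] by (intro integral_ivl_sums[OF b]) auto
  moreover have "(\<integral>x. ?f x * h m x \<partial>ivl c d) = a m * w m" for m
  proof -
    have "(\<lambda>n. a n * (\<integral>x. h m x * h n x \<partial>ivl c d)) sums (\<integral>x. h m x * ?f x \<partial>ivl c d)"
      using hB by (intro integral_ivl_sums[OF a]) auto
    moreover have "(\<lambda>n. a n * (\<integral>x. h m x * h n x \<partial>ivl c d)) = (\<lambda>n. if n = m then a m * w m else 0)"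
      by (auto simp: orth)
    ultimately show ?thesis
      using sums_single[of m "\<lambda>_. a m * w m"] by (auto simp: mult.commute dest: sums_unique2)
  qed
  ultimately show ?thesis by (simp add: mult_ac)
qed

text \<open>Increments of sines stay orthogonal because each is a combination of sin(m x) and cos(m
  x). The diagonal value is pi ((1 - cos(m t))^2 + sin(m t)^2), which collapses to 2 pi (1 - cos(m
  t)).\<close>

lemma integral_ivl_sin_diff:
  "(\<integral>x. (sin (real m * x) - sin (real m * (x + t))) * (sin (real n * x) - sin (real n * (x + t))) \<partial>ivl (- pi) pi)
     = (if m = n then 2 * pi * (1 - cos (real m * t)) else 0)"
proof (cases "m = 0")
  \<comment> \<open>The constant mode is split off: cos(0 x) has square integral 2 pi instead of pi,
    so \<open>integral_ivl_cos_cos\<close> excludes it.\<close>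
  case True
  then show ?thesis by simp
next
  case False
  let ?c = "\<lambda>m::nat. 1 - cos (m * t)" and ?s = "\<lambda>m::nat. sin (m * t)"
  have "(sin (m * x) - sin (m * (x + t))) * (sin (n * x) - sin (n * (x + t)))
      = (?c m * ?c n * (sin (m * x) * sin (n * x)) - ?c m * ?s n * (sin (m * x) * cos (n * x)))
        - (?s m * ?c n * (sin (n * x) * cos (m * x)) - ?s m * ?s n * (cos (m * x) * cos (n * x)))"
    for x :: real
    by (simp add: distrib_left sin_add algebra_simps)
  moreover have "integrable (ivl (- pi) pi) (\<lambda>x. sin (i * x) * sin (j * x))"
    "integrable (ivl (- pi) pi) (\<lambda>x. sin (i * x) * cos (j * x))"
    "integrable (ivl (- pi) pi) (\<lambda>x. cos (i * x) * cos (j * x))" for i j :: nat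
    by (rule integrable_ivl_bounded[where B=1]; simp add: abs_mult mult_le_one)+
  ultimately have "(\<integral>x. (sin (m * x) - sin (m * (x + t))) * (sin (n * x) - sin (n * (x + t))) \<partial>ivl (- pi) pi)
      = ?c m * ?c n * (if m = n then pi else 0) + ?s m * ?s n * (if m = n then pi else 0)"
    using False by (simp add: integral_ivl_sin_sin integral_ivl_cos_cos integral_ivl_sin_cos)
  also have "\<dots> = (?c m * ?c n + ?s m * ?s n) * (if m = n then pi else 0)"
    by (rule distrib_right[symmetric])
  finally have "(\<integral>x. (sin (m * x) - sin (m * (x + t))) * (sin (n * x) - sin (n * (x + t))) \<partial>ivl (- pi) pi)
      = (?c m * ?c n + ?s m * ?s n) * (if m = n then pi else 0)" .
  moreover have "?c m * ?c m + ?s m * ?s m = 2 * ?c m"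
  proof -
    have "?s m * ?s m = 1 - cos (m * t) * cos (m * t)"
      using sin_cos_squared_add[of "m * t"] by (simp add: power2_eq_square)
    then show ?thesis by (simp add: algebra_simps)
  qed
  ultimately show ?thesis by (cases "m = n") simp_all
qed

lemma integral_sine_series_diff_sq:
  fixes a :: "nat \<Rightarrow> real"
  assumes a: "summable (\<lambda>m. \<bar>a m\<bar>)"
  defines "f \<equiv> \<lambda>x. \<Sum>m. a m * sin (real m * x)"
  shows "(\<lambda>m. (a m)\<^sup>2 * (2 * pi * (1 - cos (real m * t)))) sums (\<integral>x. (f x - f (x + t))\<^sup>2 \<partial>ivl (- pi) pi)"
proof -
  have s: "summable (\<lambda>m. a m * sin (real m * x))" for x
    by (intro summable_comparison_test'[OF a, of 0]) (auto simp: abs_mult mult_left_le)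
  have "(\<Sum>m. a m * (sin (real m * x) - sin (real m * (x + t)))) = f x - f (x + t)" for x
    unfolding f_def right_diff_distrib by (rule suminf_diff[OF s s, symmetric])
  moreover have "\<bar>sin (real m * x) - sin (real m * (x + t))\<bar> \<le> 2" for m x
  proof -
    have "\<bar>sin (real m * x) - sin (real m * (x + t))\<bar> \<le> \<bar>sin (real m * x)\<bar> + \<bar>sin (real m * (x + t))\<bar>"
      by (rule abs_triangle_ineq4)
    also have "\<dots> \<le> 1 + 1" by (intro add_mono abs_sin_le_one)
    finally show ?thesis by simp
  qed
  ultimately show ?thesis
    using integral_sum_sq_orthogonal[OF a a, of "\<lambda>m x. sin (real m * x) - sin (real m * (x + t))" 2
        "- pi" pi "\<lambda>m. 2 * pi * (1 - cos (real m * t))"]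
    by (simp add: integral_ivl_sin_diff power2_eq_square)
qed

text \<open>The recursion avoids the removable singularity of \<open>(1 - cos (m t)) / (1 - cos t)\<close> at \<open>t = 0\<close>.\<close>

fun fejer :: "nat \<Rightarrow> real \<Rightarrow> real" where
  "fejer 0 t = 0"
| "fejer (Suc 0) t = 1"
| "fejer (Suc (Suc m)) t = 2 * fejer (Suc m) t - fejer m t + 2 * cos (real (Suc m) * t)"

text \<open>The recursion is the product formula cos((m + 2) t) + cos(m t) = 2 cos((m + 1) t) cos t
  in disguise.\<close>

lemma fejer_eq: "fejer m t * (1 - cos t) = 1 - cos (real m * t)"
proof (induction m t rule: fejer.induct)
  case (3 m t)
  have "cos (real (Suc (Suc m)) * t) + cos (real m * t) = 2 * cos (real (Suc m) * t) * cos t"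
    using cos_add[of "real (Suc m) * t" t] cos_diff[of "real (Suc m) * t" t]
    by (simp add: algebra_simps)
  then show ?case using 3 by (simp add: algebra_simps)
qed auto

text \<open>The cosine in the recursion integrates to zero, so the integrals have vanishing second
  differences, and the first two values 0 and 2 pi fix them. This m becomes the weight of the m-th
  mode in the energy.\<close>

lemma integral_fejer:
  "integrable (ivl (- pi) pi) (fejer m) \<and> (\<integral>t. fejer m t \<partial>ivl (- pi) pi) = 2 * pi * m"
proof (induction m rule: induct_nat_012)
  case 0
  then show ?case by simp
next
  case 1
  have "integrable (ivl (- pi) pi) (\<lambda>t. 1 :: real)" by (rule integrable_ivl_bounded[where B=1]) auto
  moreover have "fejer (Suc 0) = (\<lambda>t. 1)" by auto
  ultimately show ?case using integral_ivl_cos[of 0] by simp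
next
  case (ge2 n)
  have c: "integrable (ivl (- pi) pi) (\<lambda>x. cos (real (Suc n) * x))"
    by (rule integrable_ivl_bounded[where B=1]) auto
  have ci: "(\<integral>x. cos (real (Suc n) * x) \<partial>ivl (- pi) pi) = 0"
    using integral_ivl_cos[of "int (Suc n)"] by simp
  have e: "fejer (Suc (Suc n)) = (\<lambda>t. 2 * fejer (Suc n) t - fejer n t + 2 * cos (real (Suc n) * t))"
    by auto
  show ?case unfolding e using ge2 c ci by (simp del: of_nat_Suc) (simp add: algebra_simps)
qed

lemma one_minus_cos_half: "1 - cos t = 2 * (sin (t / 2 :: real))\<^sup>2"
  using cos_double_sin[of "t / 2"] by simp

lemma AE_ivl_cos_neq_1: "AE t in ivl (- pi) pi. cos t \<noteq> 1"
proof -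
  have "t = 0" if "- pi \<le> t" "t \<le> pi" "cos t = 1" for t
    using cos_monotone_0_pi[of 0 "\<bar>t\<bar>"] that abs_le_iff[of t pi] by auto
  moreover have "AE t in lborel. t \<noteq> (0 :: real)" by (rule AE_lborel_singleton)
  ultimately show ?thesis by (subst AE_density) (auto split: split_indicator elim: eventually_mono)
qed

lemma nn_integral_fejer:
  "(\<integral>\<^sup>+t. ennreal ((1 - cos (real m * t)) / (4 * (sin (t / 2))\<^sup>2)) \<partial>ivl (- pi) pi) = ennreal (pi * m)"
proof -
  have ae: "AE t in ivl (- pi) pi. (1 - cos (real m * t)) / (4 * (sin (t / 2))\<^sup>2) = fejer m t / 2 \<and> 0 \<le> fejer m t / 2"
    using AE_ivl_cos_neq_1
  proof eventually_elim
    case (elim t)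
    have e: "(1 - cos (real m * t)) / (2 * (1 - cos t)) = fejer m t / 2"
      using elim fejer_eq[of m t] by (simp add: field_simps)
    moreover have "0 \<le> fejer m t / 2" unfolding e[symmetric] by simp
    moreover have "4 * (sin (t / 2))\<^sup>2 = 2 * (1 - cos t)" by (simp add: one_minus_cos_half)
    ultimately show ?case by simp
  qed
  have "(\<integral>\<^sup>+t. ennreal ((1 - cos (real m * t)) / (4 * (sin (t / 2))\<^sup>2)) \<partial>ivl (- pi) pi)
      = (\<integral>\<^sup>+t. ennreal (fejer m t / 2) \<partial>ivl (- pi) pi)"
    using ae by (intro nn_integral_cong_AE) (auto elim: eventually_mono)
  also have "\<dots> = ennreal (\<integral>t. fejer m t / 2 \<partial>ivl (- pi) pi)"
    using integral_fejer[of m] ae by (intro nn_integral_eq_integral) (auto elim: eventually_mono)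
  finally show ?thesis using integral_fejer[of m] by simp
qed

text \<open>The denominator is the squared chord between two points of the unit circle at angle t.
  For fixed t, Parseval in x gives a series of nonnegative terms, which may be integrated over t
  term by term; the m-th term contributes 2 pi a_m^2 times pi m.\<close>

lemma nn_integral_sine_series_diff:
  fixes a :: "nat \<Rightarrow> real"
  assumes a: "summable (\<lambda>m. \<bar>a m\<bar>)" and S: "(\<lambda>m. real m * (a m)\<^sup>2) sums S"
  defines "f \<equiv> \<lambda>x. \<Sum>m. a m * sin (real m * x)"
  shows "(\<integral>\<^sup>+t. \<integral>\<^sup>+x. ennreal ((f x - f (x + t))\<^sup>2 / (4 * (sin (t / 2))\<^sup>2)) \<partial>ivl (- pi) pi \<partial>ivl (- pi) pi)
     = ennreal (2 * pi\<^sup>2 * S)"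
proof -
  have [measurable]: "f \<in> borel_measurable borel" unfolding f_def by measurable
  have fB: "\<bar>f x\<bar> \<le> (\<Sum>m. \<bar>a m\<bar>) * 1" for x
    unfolding f_def by (rule abs_suminf_le[OF a]) simp
  have int: "integrable (ivl (- pi) pi) (\<lambda>x. (f x - f (x + t))\<^sup>2)" for t
  proof (rule integrable_ivl_bounded)
    fix x
    have "\<bar>f x - f (x + t)\<bar> \<le> 2 * (\<Sum>m. \<bar>a m\<bar>)" using fB[of x] fB[of "x + t"] by linarith
    then have "\<bar>f x - f (x + t)\<bar>\<^sup>2 \<le> (2 * (\<Sum>m. \<bar>a m\<bar>))\<^sup>2" by (intro power_mono) auto
    then show "\<bar>(f x - f (x + t))\<^sup>2\<bar> \<le> (2 * (\<Sum>m. \<bar>a m\<bar>))\<^sup>2" by simp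
  qed measurable
  let ?k = "\<lambda>t::real. 1 / (4 * (sin (t / 2))\<^sup>2)"
  have in1: "(\<integral>\<^sup>+x. ennreal ((f x - f (x + t))\<^sup>2 / (4 * (sin (t / 2))\<^sup>2)) \<partial>ivl (- pi) pi)
     = (\<Sum>m. ennreal ((a m)\<^sup>2 * (2 * pi)) * ennreal ((1 - cos (real m * t)) / (4 * (sin (t / 2))\<^sup>2)))" for t
  proof -
    have sums: "(\<lambda>m. (a m)\<^sup>2 * (2 * pi * (1 - cos (real m * t))) * ?k t)
        sums ((\<integral>x. (f x - f (x + t))\<^sup>2 \<partial>ivl (- pi) pi) * ?k t)"
      unfolding f_def by (rule sums_mult2[OF integral_sine_series_diff_sq[OF a]])
    have "(\<integral>\<^sup>+x. ennreal ((f x - f (x + t))\<^sup>2 / (4 * (sin (t / 2))\<^sup>2)) \<partial>ivl (- pi) pi)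
        = ennreal (\<integral>x. (f x - f (x + t))\<^sup>2 / (4 * (sin (t / 2))\<^sup>2) \<partial>ivl (- pi) pi)"
      using int by (intro nn_integral_eq_integral) auto
    also have "(\<integral>x. (f x - f (x + t))\<^sup>2 / (4 * (sin (t / 2))\<^sup>2) \<partial>ivl (- pi) pi)
        = (\<Sum>m. (a m)\<^sup>2 * (2 * pi * (1 - cos (real m * t))) * ?k t)"
      using sums by (simp add: sums_iff)
    also have "ennreal \<dots> = (\<Sum>m. ennreal ((a m)\<^sup>2 * (2 * pi * (1 - cos (real m * t))) * ?k t))"
      using sums by (intro suminf_ennreal2[symmetric]) (auto simp: sums_iff)
    also have "\<dots> = (\<Sum>m. ennreal ((a m)\<^sup>2 * (2 * pi)) * ennreal ((1 - cos (real m * t)) / (4 * (sin (t / 2))\<^sup>2)))"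
      by (simp only: ennreal_mult'[symmetric] zero_le_mult_iff zero_le_power2 pi_ge_zero
          mult.assoc times_divide_eq_right mult_1_right)
        (simp add: ennreal_mult'[symmetric])
    finally show ?thesis .
  qed
  have "(\<integral>\<^sup>+t. \<integral>\<^sup>+x. ennreal ((f x - f (x + t))\<^sup>2 / (4 * (sin (t / 2))\<^sup>2)) \<partial>ivl (- pi) pi \<partial>ivl (- pi) pi)
     = (\<Sum>m. ennreal ((a m)\<^sup>2 * (2 * pi)) * ennreal (pi * m))"
    unfolding in1 by (subst nn_integral_suminf) (auto simp: nn_integral_cmult nn_integral_fejer)
  also have "\<dots> = (\<Sum>m. ennreal (2 * pi\<^sup>2 * (real m * (a m)\<^sup>2)))"
    by (simp add: ennreal_mult''[symmetric] power2_eq_square mult_ac)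
  also have "\<dots> = ennreal (\<Sum>m. 2 * pi\<^sup>2 * (real m * (a m)\<^sup>2))"
    using sums_mult[OF S, of "2 * pi\<^sup>2"] by (intro suminf_ennreal2) (auto simp: sums_iff)
  finally show ?thesis using sums_mult[OF S, of "2 * pi\<^sup>2"] by (simp add: sums_iff)
qed

section \<open>From the circle to the half-circle by periodicity and oddness\<close>

lemma nn_integral_ivl_shift:
  fixes h :: "real \<Rightarrow> ennreal"
  assumes [measurable]: "h \<in> borel_measurable borel"
  shows "(\<integral>\<^sup>+x. h (x + t) \<partial>ivl c d) = (\<integral>\<^sup>+x. h x \<partial>ivl (c + t) (d + t))"
proof -
  have "(\<integral>\<^sup>+x. h x * indicator {c + t..d + t} x \<partial>lborel)
      = (\<integral>\<^sup>+x. h (t + 1 * x) * indicator {c + t..d + t} (t + 1 * x) \<partial>lborel)"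
    by (subst nn_integral_real_affine[where c=1 and t=t]) auto
  also have "\<dots> = (\<integral>\<^sup>+x. h (x + t) * indicator {c..d} x \<partial>lborel)"
    by (intro nn_integral_cong) (auto split: split_indicator simp: add.commute)
  finally show ?thesis by (simp add: nn_integral_ivl)
qed

lemma nn_integral_ivl_split:
  fixes h :: "real \<Rightarrow> ennreal"
  assumes [measurable]: "h \<in> borel_measurable borel" and "a \<le> b" "b \<le> c"
  shows "(\<integral>\<^sup>+x. h x \<partial>ivl a c) = (\<integral>\<^sup>+x. h x \<partial>ivl a b) + (\<integral>\<^sup>+x. h x \<partial>ivl b c)"
proof -
  have "(\<integral>\<^sup>+x. h x * indicator {a..c} x \<partial>lborel)
      = (\<integral>\<^sup>+x. h x * indicator {a..b} x + h x * indicator {b..c} x \<partial>lborel)"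
    using AE_lborel_singleton[of b] assms
    by (intro nn_integral_cong_AE) (auto split: split_indicator elim: eventually_mono)
  then show ?thesis by (simp add: nn_integral_ivl nn_integral_add)
qed

text \<open>The shifted window is cut at an end of the original one, and the overhang is moved back
  by a full period; the sign of t decides which end.\<close>

lemma nn_integral_periodic_shift:
  fixes h :: "real \<Rightarrow> ennreal"
  assumes [measurable]: "h \<in> borel_measurable borel" and per: "\<And>x. h (x + 2 * pi) = h x"
    and t: "- pi \<le> t" "t \<le> pi"
  shows "(\<integral>\<^sup>+x. h (x + t) \<partial>ivl (- pi) pi) = (\<integral>\<^sup>+x. h x \<partial>ivl (- pi) pi)"
proof -
  have P: "(\<integral>\<^sup>+x. h x \<partial>ivl (c + 2 * pi) (d + 2 * pi)) = (\<integral>\<^sup>+x. h x \<partial>ivl c d)" for c d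
    by (simp only: nn_integral_ivl_shift[OF assms(1), symmetric] per)
  show ?thesis
  proof (cases "t \<ge> 0")
    case True
    have "(\<integral>\<^sup>+x. h x \<partial>ivl (- pi + t) (pi + t)) = (\<integral>\<^sup>+x. h x \<partial>ivl (- pi + t) pi) + (\<integral>\<^sup>+x. h x \<partial>ivl pi (pi + t))"
      using t True by (intro nn_integral_ivl_split) auto
    also have "(\<integral>\<^sup>+x. h x \<partial>ivl pi (pi + t)) = (\<integral>\<^sup>+x. h x \<partial>ivl (- pi) (- pi + t))"
      using P[of "- pi" "- pi + t"] by (simp add: algebra_simps)
    also have "(\<integral>\<^sup>+x. h x \<partial>ivl (- pi + t) pi) + \<dots> = (\<integral>\<^sup>+x. h x \<partial>ivl (- pi) pi)"
      using t True nn_integral_ivl_split[of h "- pi" "- pi + t" pi] by (simp add: add.commute)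
    finally show ?thesis by (simp add: nn_integral_ivl_shift)
  next
    case False
    have "(\<integral>\<^sup>+x. h x \<partial>ivl (- pi + t) (pi + t)) = (\<integral>\<^sup>+x. h x \<partial>ivl (- pi + t) (- pi)) + (\<integral>\<^sup>+x. h x \<partial>ivl (- pi) (pi + t))"
      using t False by (intro nn_integral_ivl_split) auto
    also have "(\<integral>\<^sup>+x. h x \<partial>ivl (- pi + t) (- pi)) = (\<integral>\<^sup>+x. h x \<partial>ivl (pi + t) pi)"
      using P[of "- pi + t" "- pi"] by (simp add: algebra_simps)
    also have "\<dots> + (\<integral>\<^sup>+x. h x \<partial>ivl (- pi) (pi + t)) = (\<integral>\<^sup>+x. h x \<partial>ivl (- pi) pi)"
      using t False nn_integral_ivl_split[of h "- pi" "pi + t" pi] by (simp add: add.commute)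
    finally show ?thesis by (simp add: nn_integral_ivl_shift)
  qed
qed

lemma nn_integral_ivl_symmetric:
  fixes h :: "real \<Rightarrow> ennreal"
  assumes [measurable]: "h \<in> borel_measurable borel"
  shows "(\<integral>\<^sup>+x. h x \<partial>ivl (- pi) pi) = (\<integral>\<^sup>+x. h x + h (- x) \<partial>ivl 0 pi)"
proof -
  have "(\<integral>\<^sup>+x. h x * indicator {- pi..0} x \<partial>lborel)
      = (\<integral>\<^sup>+x. h (0 + (-1) * x) * indicator {- pi..0} (0 + (-1) * x) \<partial>lborel)"
    by (subst nn_integral_real_affine[where c="-1" and t=0]) auto
  also have "\<dots> = (\<integral>\<^sup>+x. h (- x) * indicator {0..pi} x \<partial>lborel)"
    by (intro nn_integral_cong) (auto split: split_indicator)
  finally have "(\<integral>\<^sup>+x. h x \<partial>ivl (- pi) 0) = (\<integral>\<^sup>+x. h (- x) \<partial>ivl 0 pi)" by (simp add: nn_integral_ivl)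
  then show ?thesis
    using nn_integral_ivl_split[of h "- pi" 0 pi] by (simp add: nn_integral_add add.commute)
qed

text \<open>Substituting y = x + t turns the increment form into a double integral over the circle.
  Oddness of f gives \<open>H (- x) (- y) = H x y\<close>, so folding both variables yields the
  half-circle integral twice; this cancels the 2 in
  \<open>nn_integral_sine_series_diff\<close>.\<close>

lemma nn_integral_sine_series_circle:
  fixes a :: "nat \<Rightarrow> real"
  assumes a: "summable (\<lambda>m. \<bar>a m\<bar>)" and S: "(\<lambda>m. real m * (a m)\<^sup>2) sums S"
  defines "f \<equiv> \<lambda>x. \<Sum>m. a m * sin (real m * x)"
  defines "H \<equiv> \<lambda>x y. ennreal ((f x - f y)\<^sup>2 / (4 * (sin ((x - y) / 2))\<^sup>2))"
  shows "(\<integral>\<^sup>+x. \<integral>\<^sup>+y. H x y + H x (- y) \<partial>ivl 0 pi \<partial>ivl 0 pi) = ennreal (pi\<^sup>2 * S)"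
proof -
  interpret pair_sigma_finite "ivl (- pi) pi" "ivl (- pi) pi" by (rule pair_sigma_finite_ivl)
  interpret S: sigma_finite_measure "ivl c d" for c d by (rule sigma_finite_ivl)
  have [measurable]: "f \<in> borel_measurable borel" unfolding f_def by measurable
  have Hm [measurable]: "(\<lambda>p. H (g1 p) (g2 p)) \<in> borel_measurable M"
    if [measurable]: "g1 \<in> borel_measurable M" "g2 \<in> borel_measurable M" for g1 g2 and M :: "'m measure"
    unfolding H_def by measurable
  have fper: "f (x + 2 * pi) = f x" for x
  proof -
    have "sin (real m * (x + 2 * pi)) = sin (real m * x)" for m
    proof -
      have "real m * (x + 2 * pi) = real m * x + 2 * real m * pi" by (simp add: algebra_simps)
      then have "sin (real m * (x + 2 * pi)) = sin (real m * x + 2 * real m * pi)" by (rule arg_cong)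
      also have "\<dots> = sin (real m * x)" unfolding sin_add sin_2npi cos_2npi by simp
      finally show ?thesis .
    qed
    then show ?thesis by (simp add: f_def)
  qed
  have Hper: "H x (y + 2 * pi) = H x y" for x y
  proof -
    \<comment> \<open>The half-angle moves by pi only, so the sine changes its sign; the square
      hides this.\<close>
    have "(x - (y + 2 * pi)) / 2 = (x - y) / 2 - pi" by (simp add: field_simps)
    then show ?thesis by (simp only: H_def fper sin_minus_pi power2_minus)
  qed
  have Hneg: "H (- x) (- y) = H x y" for x y
  proof -
    have "f (- x) = - f x" for x
    proof -
      have "summable (\<lambda>m. a m * sin (real m * x))"
        by (intro summable_comparison_test'[OF a, of 0]) (auto simp: abs_mult mult_left_le)
      then show ?thesis by (simp add: f_def suminf_minus)
    qed
    moreover have "(- x - - y) / 2 = - ((x - y) / 2)" by (simp add: field_simps)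
    moreover have "(- f x - - f y)\<^sup>2 = (f x - f y)\<^sup>2" by (simp add: power2_eq_square algebra_simps)
    ultimately show ?thesis by (simp only: H_def sin_minus power2_minus)
  qed
  have "ennreal (2 * pi\<^sup>2 * S) =
    (\<integral>\<^sup>+t. \<integral>\<^sup>+x. ennreal ((f x - f (x + t))\<^sup>2 / (4 * (sin (t / 2))\<^sup>2)) \<partial>ivl (- pi) pi \<partial>ivl (- pi) pi)"
    using nn_integral_sine_series_diff[OF a S] by (simp add: f_def)
  also have "\<dots> = (\<integral>\<^sup>+t. \<integral>\<^sup>+x. H x (t + x) \<partial>ivl (- pi) pi \<partial>ivl (- pi) pi)"
    by (simp add: H_def add.commute)
  also have "\<dots> = (\<integral>\<^sup>+x. \<integral>\<^sup>+t. H x (t + x) \<partial>ivl (- pi) pi \<partial>ivl (- pi) pi)"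
    by (rule Fubini') measurable
  also have "\<dots> = (\<integral>\<^sup>+x. \<integral>\<^sup>+y. H x y \<partial>ivl (- pi) pi \<partial>ivl (- pi) pi)"
  proof (rule nn_integral_cong_AE)
    have "(\<integral>\<^sup>+t. H x (t + x) \<partial>ivl (- pi) pi) = (\<integral>\<^sup>+y. H x y \<partial>ivl (- pi) pi)" if "x \<in> {- pi..pi}" for x
      using that Hper by (intro nn_integral_periodic_shift) auto
    then show "AE x in ivl (- pi) pi. (\<integral>\<^sup>+t. H x (t + x) \<partial>ivl (- pi) pi) = (\<integral>\<^sup>+y. H x y \<partial>ivl (- pi) pi)"
      by (subst AE_density) (auto split: split_indicator)
  qed
  also have "\<dots> = (\<integral>\<^sup>+x. \<integral>\<^sup>+y. H x y + H x (- y) \<partial>ivl 0 pi \<partial>ivl (- pi) pi)"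
    by (intro nn_integral_cong nn_integral_ivl_symmetric) measurable
  also have "\<dots> = (\<integral>\<^sup>+x. (\<integral>\<^sup>+y. H x y + H x (- y) \<partial>ivl 0 pi) + (\<integral>\<^sup>+y. H (- x) y + H (- x) (- y) \<partial>ivl 0 pi) \<partial>ivl 0 pi)"
    by (rule nn_integral_ivl_symmetric) measurable
  also have "\<dots> = (\<integral>\<^sup>+x. 2 * (\<integral>\<^sup>+y. H x y + H x (- y) \<partial>ivl 0 pi) \<partial>ivl 0 pi)"
  proof -
    have "H (- x) y = H x (- y)" for x y using Hneg[of x "- y"] by simp
    then show ?thesis by (simp add: Hneg add.commute mult_2)
  qed
  also have "\<dots> = 2 * (\<integral>\<^sup>+x. (\<integral>\<^sup>+y. H x y + H x (- y) \<partial>ivl 0 pi) \<partial>ivl 0 pi)"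
    by (rule nn_integral_cmult) measurable
  finally have "2 * (\<integral>\<^sup>+x. (\<integral>\<^sup>+y. H x y + H x (- y) \<partial>ivl 0 pi) \<partial>ivl 0 pi) = 2 * ennreal (pi\<^sup>2 * S)"
    by (simp add: ennreal_mult' mult.assoc)
  then show ?thesis by (simp add: ennreal_mult_cancel_left)
qed

text \<open>An antiderivative is -2 cot((x + y) / 2), and between the endpoints it yields 2 tan(x /
  2) + 2 cot(x / 2) = 4 / sin x. This is the boundary weight that the reflected terms
  produce.\<close>

lemma nn_integral_inverse_sin_sq_half:
  assumes "0 < x" "x < pi"
  shows "(\<integral>\<^sup>+y. ennreal (1 / (sin ((x + y) / 2))\<^sup>2) \<partial>ivl 0 pi) = ennreal (4 / sin x)"
proof -
  have pos: "sin ((x + y) / 2) > 0" if "0 \<le> y" "y \<le> pi" for y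
    using assms that by (intro sin_gt_zero) (auto simp: field_simps)
  have "(\<integral>\<^sup>+y. ennreal (1 / (sin ((x + y) / 2))\<^sup>2) * indicator {0..pi} y \<partial>lborel)
      = ennreal (- 2 * cot ((x + pi) / 2) - (- 2 * cot ((x + 0) / 2)))"
  proof (rule nn_integral_FTC_Icc)
    fix y assume "y \<in> {0..pi}"
    then have y: "0 \<le> y" "y \<le> pi" by auto
    show "((\<lambda>y. - 2 * cot ((x + y) / 2)) has_real_derivative 1 / (sin ((x + y) / 2))\<^sup>2) (at y)"
    proof -
      have "((\<lambda>y. cot ((x + y) / 2)) has_real_derivative
          - inverse ((sin ((x + y) / 2))\<^sup>2) * (1 / 2)) (at y)"
        using pos[OF y] by (intro DERIV_chain2[OF DERIV_cot]) (auto intro!: derivative_eq_intros)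
      then have "((\<lambda>y. - 2 * cot ((x + y) / 2)) has_real_derivative
          - 2 * (- inverse ((sin ((x + y) / 2))\<^sup>2) * (1 / 2))) (at y)"
        by (rule DERIV_cmult)
      moreover have "- 2 * (- inverse w * (1 / 2)) = 1 / w" for w :: real by (simp add: field_simps)
      ultimately show ?thesis by (simp only:)
    qed
  qed auto
  also have "- 2 * cot ((x + pi) / 2) - (- 2 * cot ((x + 0) / 2)) = 4 / sin x"
  proof -
    have s: "sin (x / 2) > 0" "cos (x / 2) > 0"
      using assms by (auto intro!: sin_gt_zero cos_gt_zero_pi simp: field_simps)
    have "cot ((x + pi) / 2) = - (sin (x / 2) / cos (x / 2))"
      by (simp add: cot_def add_divide_distrib sin_add cos_add)
    then have "- 2 * cot ((x + pi) / 2) - (- 2 * cot ((x + 0) / 2))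
        = - 2 * - (sin (x / 2) / cos (x / 2)) - (- 2 * (cos (x / 2) / sin (x / 2)))"
      by (simp only: add_0_right) (simp only: cot_def)
    also have "\<dots> = 2 * ((sin (x / 2))\<^sup>2 + (cos (x / 2))\<^sup>2) / (sin (x / 2) * cos (x / 2))"
      using s by (simp add: field_simps power2_eq_square del: sin_cos_squared_add3)
    also have "\<dots> = 2 / (sin (x / 2) * cos (x / 2))" by simp
    also have "\<dots> = 4 / sin x"
      using s sin_double[of "x / 2"] by (simp add: field_simps)
    finally show ?thesis .
  qed
  finally show ?thesis by (simp add: nn_integral_ivl)
qed

text \<open>With p and m the half-sum and the half-difference, cos x - cos y = -2 sin p sin m and
  sin x sin y = (sin p)^2 - (sin m)^2. The first summand is the kernel \<open>1 / (x - y)^2\<close>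
  after the cosine substitution in both variables, Jacobians included; so it is the chord kernel
  minus its reflection.\<close>

lemma sin_sin_over_cos_diff_sq:
  fixes x y :: real
  assumes "sin ((x - y) / 2) \<noteq> 0" "sin ((x + y) / 2) \<noteq> 0"
  shows "sin x * sin y / (cos x - cos y)\<^sup>2 + 1 / (4 * (sin ((x + y) / 2))\<^sup>2) = 1 / (4 * (sin ((x - y) / 2))\<^sup>2)"
proof -
  let ?p = "sin ((x + y) / 2)" and ?m = "sin ((x - y) / 2)"
  have "cos x - cos y = - 2 * ?p * ?m"
    using cos_diff_cos[of x y] sin_minus[of "(x - y) / 2"] by (simp add: minus_divide_left)
  then have c: "(cos x - cos y)\<^sup>2 = 4 * (?p\<^sup>2 * ?m\<^sup>2)" by (simp add: power_mult_distrib)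
  have "2 * (sin x * sin y) = cos (x - y) - cos (x + y)" by (simp add: cos_add cos_diff)
  also have "\<dots> = 2 * (?p\<^sup>2 - ?m\<^sup>2)"
    using one_minus_cos_half[of "x - y"] one_minus_cos_half[of "x + y"] by simp
  finally have s: "sin x * sin y = ?p\<^sup>2 - ?m\<^sup>2" by simp
  show ?thesis unfolding c s using assms by (simp add: field_simps)
qed

text \<open>Replacing the chord kernel in the folded form by \<open>sin_sin_over_cos_diff_sq\<close>
  leaves \<open>(f x - f y)^2 + (f x + f y)^2\<close> against the reflected kernel. The cross terms
  cancel, the squares of f x and f y separate, and integrating out the other variable gives the
  weight 1 / sin x.\<close>

lemma gagliardo_sine_series:
  fixes a :: "nat \<Rightarrow> real"
  assumes a: "summable (\<lambda>m. \<bar>a m\<bar>)" and S: "(\<lambda>m. real m * (a m)\<^sup>2) sums S"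
  defines "f \<equiv> \<lambda>x. \<Sum>m. a m * sin (real m * x)"
  shows "(\<integral>\<^sup>+x. \<integral>\<^sup>+y. ennreal ((f x - f y)\<^sup>2 * (sin x * sin y / (cos x - cos y)\<^sup>2)) \<partial>ivl 0 pi \<partial>ivl 0 pi)
     + (\<integral>\<^sup>+x. ennreal (4 * (f x)\<^sup>2 / sin x) \<partial>ivl 0 pi) = ennreal (pi\<^sup>2 * S)"
proof -
  interpret pair_sigma_finite "ivl 0 pi" "ivl 0 pi" by (rule pair_sigma_finite_ivl)
  have [measurable]: "f \<in> borel_measurable borel" unfolding f_def by measurable
  let ?p = "\<lambda>x y. (sin ((x + y) / 2))\<^sup>2" and ?m = "\<lambda>x y. (sin ((x - y) / 2))\<^sup>2"
  let ?D = "\<lambda>x y. ennreal ((f x - f y)\<^sup>2 * (sin x * sin y / (cos x - cos y)\<^sup>2))"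
  let ?A = "\<lambda>x y. ennreal ((f x)\<^sup>2 / 2) * ennreal (1 / ?p x y)"
  have fneg: "f (- y) = - f y" for y
  proof -
    have "summable (\<lambda>m. a m * sin (real m * y))"
      by (intro summable_comparison_test'[OF a, of 0]) (auto simp: abs_mult mult_left_le)
    then show ?thesis by (simp add: f_def suminf_minus)
  qed
  have pw: "ennreal ((f x - f y)\<^sup>2 / (4 * ?m x y)) + ennreal ((f x - f (- y))\<^sup>2 / (4 * (sin ((x - - y) / 2))\<^sup>2))
      = ?D x y + (?A x y + ?A y x)"
    if "0 < x" "x < pi" "0 < y" "y < pi" "y \<noteq> x" for x y
  proof -
    have p: "sin ((x + y) / 2) > 0" using that by (intro sin_gt_zero) auto
    have m: "sin ((x - y) / 2) \<noteq> 0"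
    proof (cases "x > y")
      case True
      then have "sin ((x - y) / 2) > 0" using that by (intro sin_gt_zero) auto
      then show ?thesis by simp
    next
      case False
      then have "sin ((y - x) / 2) > 0" using that by (intro sin_gt_zero) auto
      moreover have "sin ((x - y) / 2) = - sin ((y - x) / 2)"
        using sin_minus[of "(y - x) / 2"] by (simp add: minus_divide_left)
      ultimately show ?thesis by simp
    qed
    have ss: "sin x * sin y / (cos x - cos y)\<^sup>2 \<ge> 0"
      using that sin_gt_zero[of x] sin_gt_zero[of y] by simp
    have id: "1 / (4 * ?m x y) = sin x * sin y / (cos x - cos y)\<^sup>2 + 1 / (4 * ?p x y)"
      using sin_sin_over_cos_diff_sq[OF m] p by simp
    have "(f x - f y)\<^sup>2 / (4 * ?m x y) + (f x + f y)\<^sup>2 / (4 * ?p x y)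
        = (f x - f y)\<^sup>2 * (1 / (4 * ?m x y)) + (f x + f y)\<^sup>2 / (4 * ?p x y)" by simp
    also have "\<dots> = (f x - f y)\<^sup>2 * (sin x * sin y / (cos x - cos y)\<^sup>2)
        + ((f x - f y)\<^sup>2 + (f x + f y)\<^sup>2) * (1 / (4 * ?p x y))"
      unfolding id distrib_left distrib_right by simp
    also have "(f x - f y)\<^sup>2 + (f x + f y)\<^sup>2 = 2 * ((f x)\<^sup>2 + (f y)\<^sup>2)"
      by (simp add: power2_eq_square algebra_simps)
    also have "\<dots> * (1 / (4 * ?p x y)) = (f x)\<^sup>2 / 2 * (1 / ?p x y) + (f y)\<^sup>2 / 2 * (1 / ?p x y)"
      by (simp add: add_divide_distrib)
    finally have e: "(f x - f y)\<^sup>2 / (4 * ?m x y) + (f x + f y)\<^sup>2 / (4 * ?p x y)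
      = (f x - f y)\<^sup>2 * (sin x * sin y / (cos x - cos y)\<^sup>2)
        + ((f x)\<^sup>2 / 2 * (1 / ?p x y) + (f y)\<^sup>2 / 2 * (1 / ?p x y))" .
    have "ennreal ((f x - f y)\<^sup>2 / (4 * ?m x y)) + ennreal ((f x - f (- y))\<^sup>2 / (4 * (sin ((x - - y) / 2))\<^sup>2))
        = ennreal ((f x - f y)\<^sup>2 / (4 * ?m x y) + (f x + f y)\<^sup>2 / (4 * ?p x y))"
      by (subst ennreal_plus) (auto simp: fneg)
    also have "\<dots> = ?D x y + (ennreal ((f x)\<^sup>2 / 2 * (1 / ?p x y)) + ennreal ((f y)\<^sup>2 / 2 * (1 / ?p x y)))"
      unfolding e using mult_nonneg_nonneg[OF zero_le_power2[of "f x - f y"] ss] by (subst ennreal_plus[symmetric], simp, simp, subst ennreal_plus[symmetric]) auto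
    also have "\<dots> = ?D x y + (?A x y + ?A y x)"
      by (simp add: ennreal_mult'[symmetric] add.commute)
    finally show ?thesis .
  qed
  have AE0: "AE x in ivl 0 pi. 0 < x \<and> x < pi"
    using AE_lborel_singleton[of 0] AE_lborel_singleton[of pi]
    by (subst AE_density) (auto split: split_indicator elim: eventually_elim2)
  have AEy: "AE y in ivl 0 pi. y \<noteq> x" for x
    using AE_lborel_singleton[of x] by (subst AE_density) (auto split: split_indicator elim: eventually_mono)
  have AA: "(\<integral>\<^sup>+x. \<integral>\<^sup>+y. ?A x y \<partial>ivl 0 pi \<partial>ivl 0 pi) = (\<integral>\<^sup>+x. ennreal (2 * (f x)\<^sup>2 / sin x) \<partial>ivl 0 pi)"
  proof (rule nn_integral_cong_AE)
    show "AE x in ivl 0 pi. (\<integral>\<^sup>+y. ?A x y \<partial>ivl 0 pi) = ennreal (2 * (f x)\<^sup>2 / sin x)"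
      using AE0
    proof eventually_elim
      case (elim x)
      then have "sin x > 0" by (auto intro: sin_gt_zero)
      have "(\<integral>\<^sup>+y. ?A x y \<partial>ivl 0 pi) = ennreal ((f x)\<^sup>2 / 2) * ennreal (4 / sin x)"
        using elim nn_integral_inverse_sin_sq_half[of x] by (subst nn_integral_cmult) auto
      also have "\<dots> = ennreal (2 * (f x)\<^sup>2 / sin x)"
        using \<open>sin x > 0\<close> by (subst ennreal_mult'[symmetric]) auto
      finally show ?case .
    qed
  qed
  have AA': "(\<integral>\<^sup>+x. \<integral>\<^sup>+y. ?A y x \<partial>ivl 0 pi \<partial>ivl 0 pi) = (\<integral>\<^sup>+x. ennreal (2 * (f x)\<^sup>2 / sin x) \<partial>ivl 0 pi)"
    unfolding AA[symmetric] by (rule Fubini') measurable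
  have "ennreal (pi\<^sup>2 * S) = (\<integral>\<^sup>+x. \<integral>\<^sup>+y. ennreal ((f x - f y)\<^sup>2 / (4 * ?m x y))
      + ennreal ((f x - f (- y))\<^sup>2 / (4 * (sin ((x - - y) / 2))\<^sup>2)) \<partial>ivl 0 pi \<partial>ivl 0 pi)"
    using nn_integral_sine_series_circle[OF a S] by (simp add: f_def)
  also have "\<dots> = (\<integral>\<^sup>+x. \<integral>\<^sup>+y. ?D x y + (?A x y + ?A y x) \<partial>ivl 0 pi \<partial>ivl 0 pi)"
  proof (rule nn_integral_cong_AE)
    show "AE x in ivl 0 pi. (\<integral>\<^sup>+y. ennreal ((f x - f y)\<^sup>2 / (4 * ?m x y))
      + ennreal ((f x - f (- y))\<^sup>2 / (4 * (sin ((x - - y) / 2))\<^sup>2)) \<partial>ivl 0 pi) = (\<integral>\<^sup>+y. ?D x y + (?A x y + ?A y x) \<partial>ivl 0 pi)"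
      using AE0
    proof eventually_elim
      case (elim x)
      show ?case
      proof (rule nn_integral_cong_AE)
        show "AE y in ivl 0 pi. ennreal ((f x - f y)\<^sup>2 / (4 * ?m x y))
          + ennreal ((f x - f (- y))\<^sup>2 / (4 * (sin ((x - - y) / 2))\<^sup>2)) = ?D x y + (?A x y + ?A y x)"
          using AE0 AEy[of x] by eventually_elim (rule pw; use elim in simp)
      qed
    qed
  qed
  also have "\<dots> = (\<integral>\<^sup>+x. (\<integral>\<^sup>+y. ?D x y \<partial>ivl 0 pi) + ((\<integral>\<^sup>+y. ?A x y \<partial>ivl 0 pi) + (\<integral>\<^sup>+y. ?A y x \<partial>ivl 0 pi)) \<partial>ivl 0 pi)"
    by (subst nn_integral_add, measurable, subst nn_integral_add) auto
  also have "\<dots> = (\<integral>\<^sup>+x. \<integral>\<^sup>+y. ?D x y \<partial>ivl 0 pi \<partial>ivl 0 pi)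
      + ((\<integral>\<^sup>+x. \<integral>\<^sup>+y. ?A x y \<partial>ivl 0 pi \<partial>ivl 0 pi) + (\<integral>\<^sup>+x. \<integral>\<^sup>+y. ?A y x \<partial>ivl 0 pi \<partial>ivl 0 pi))"
    by (subst nn_integral_add, measurable, subst nn_integral_add) auto
  also have "(\<integral>\<^sup>+x. \<integral>\<^sup>+y. ?A x y \<partial>ivl 0 pi \<partial>ivl 0 pi) + (\<integral>\<^sup>+x. \<integral>\<^sup>+y. ?A y x \<partial>ivl 0 pi \<partial>ivl 0 pi)
      = (\<integral>\<^sup>+x. ennreal (4 * (f x)\<^sup>2 / sin x) \<partial>ivl 0 pi)"
  proof -
    have "AE x in ivl 0 pi. ennreal (2 * (f x)\<^sup>2 / sin x) + ennreal (2 * (f x)\<^sup>2 / sin x) = ennreal (4 * (f x)\<^sup>2 / sin x)"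
      using AE0
    proof eventually_elim
      case (elim x)
      then have "sin x > 0" by (auto intro: sin_gt_zero)
      then show ?case by (subst ennreal_plus[symmetric]) auto
    qed
    then show ?thesis unfolding AA AA' by (subst nn_integral_add[symmetric]) (auto intro: nn_integral_cong_AE)
  qed
  finally show ?thesis by simp
qed

section \<open>The Poisson kernel of the half-Laplacian on an interval\<close>

text \<open>The real value at \<open>x\<close> outside \<open>[a,b]\<close> of the branch of \<open>sqrt ((z - a) (z - b))\<close> with \<open>R z ~ z\<close>.\<close>

definition sqrt_ext :: "real \<Rightarrow> real \<Rightarrow> real \<Rightarrow> real" where
  "sqrt_ext a b x = (x - b) * sqrt ((x - a) / (x - b))"

text \<open>The Poisson kernel of the half-Laplacian \<open>(-\<Delta>)\<^sup>1\<^sup>/\<^sup>2\<close> on \<open>[a,b]\<close>, extended by zero in \<open>z\<close>;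
  clamping \<open>z\<close> to \<open>[a,b]\<close> in the denominator makes it continuous in \<open>z\<close> on the whole line.\<close>

definition poisson_kernel :: "real \<Rightarrow> real \<Rightarrow> real \<Rightarrow> real \<Rightarrow> real" where
  "poisson_kernel a b z x =
     sqrt (max 0 ((z - a) * (b - z))) / (pi * sqrt_ext a b x * (x - max a (min b z)))"

section \<open>Expansion of both kernels in powers of the Joukowski parameter\<close>

lemma sin_series:
  fixes q :: real
  assumes "\<bar>q\<bar> < 1"
  shows "(\<lambda>m. q ^ m * sin (real m * t)) sums (q * sin t / (1 - 2 * q * cos t + q\<^sup>2))"
    and "(\<lambda>m. q ^ m * (real m * sin (real m * t))) sums
      (q * (1 - q\<^sup>2) * sin t / (1 - 2 * q * cos t + q\<^sup>2)\<^sup>2)"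
proof -
  \<comment> \<open>Both sums are imaginary parts at w = q e^(i t): of the geometric series 1 / (1 -
    w), and of w / (1 - w)^2, which is w times its derivative.\<close>
  let ?w = "of_real q * cis t"
  let ?d = "1 - 2 * q * cos t + q\<^sup>2"
  have w: "norm ?w < 1" using assms by (simp add: norm_mult)
  then have ne: "1 - ?w \<noteq> 0" by auto
  have pow: "?w ^ m = of_real (q ^ m) * cis (real m * t)" for m
    by (simp add: power_mult_distrib Complex.DeMoivre)
  have d: "(norm (1 - ?w))\<^sup>2 = ?d"
  proof -
    have "(norm (1 - ?w))\<^sup>2 = (1 - q * cos t)\<^sup>2 + (q * sin t)\<^sup>2" by (simp add: cmod_power2)
    also have "\<dots> = 1 - 2 * q * cos t + q\<^sup>2 * ((sin t)\<^sup>2 + (cos t)\<^sup>2)"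
      by (simp add: power2_eq_square algebra_simps del: sin_cos_squared_add3)
    finally show ?thesis by simp
  qed
  have "(\<lambda>m. ?w ^ m) sums (1 / (1 - ?w))" by (rule geometric_sums[OF w])
  then have "(\<lambda>m. Im (?w ^ m)) sums Im (1 / (1 - ?w))" by (rule sums_Im)
  moreover have "Im (1 / (1 - ?w)) = q * sin t / ?d"
    unfolding d[symmetric] by (simp add: Im_divide cmod_power2)
  ultimately show "(\<lambda>m. q ^ m * sin (real m * t)) sums (q * sin t / ?d)"
    by (simp add: pow)
  have "(\<lambda>m. of_nat (Suc m) * ?w ^ m) sums (1 / (1 - ?w)\<^sup>2)" by (rule geometric_deriv_sums[OF w])
  then have "(\<lambda>m. ?w * (of_nat (Suc m) * ?w ^ m)) sums (?w * (1 / (1 - ?w)\<^sup>2))" by (rule sums_mult)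
  then have "(\<lambda>m. of_nat (Suc m) * ?w ^ Suc m) sums (?w / (1 - ?w)\<^sup>2)"
    by (simp add: mult_ac)
  then have "(\<lambda>m. of_nat m * ?w ^ m) sums (?w / (1 - ?w)\<^sup>2)"
    by (subst (asm) sums_Suc_iff) simp
  then have "(\<lambda>m. Im (of_nat m * ?w ^ m)) sums Im (?w / (1 - ?w)\<^sup>2)" by (rule sums_Im)
  moreover have "Im (of_nat m * ?w ^ m) = q ^ m * (real m * sin (real m * t))" for m
    by (simp add: pow)
  moreover have "Im (?w / (1 - ?w)\<^sup>2) = q * (1 - q\<^sup>2) * sin t / ?d\<^sup>2"
  proof -
    have "?w / (1 - ?w)\<^sup>2 = ?w * cnj ((1 - ?w)\<^sup>2) / of_real ((norm ((1 - ?w)\<^sup>2))\<^sup>2)"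
      by (subst complex_div_cnj) simp
    also have "(norm ((1 - ?w)\<^sup>2))\<^sup>2 = ?d\<^sup>2" unfolding d[symmetric] by (simp add: norm_power)
    finally have "Im (?w / (1 - ?w)\<^sup>2) = Im (?w * cnj ((1 - ?w)\<^sup>2)) / ?d\<^sup>2"
      by (simp only: Im_divide_of_real)
    also have "?w * cnj ((1 - ?w)\<^sup>2) = ?w - 2 * (?w * cnj ?w) + (?w * cnj ?w) * cnj ?w"
      by (simp add: power2_eq_square algebra_simps)
    also have "?w * cnj ?w = of_real (q\<^sup>2)"
      by (simp only: complex_norm_square[symmetric]) (simp add: norm_mult)
    also have "Im (?w - 2 * of_real (q\<^sup>2) + of_real (q\<^sup>2) * cnj ?w) = q * (1 - q\<^sup>2) * sin t"
      by (simp add: algebra_simps power2_eq_square)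
    finally show ?thesis .
  qed
  ultimately show "(\<lambda>m. q ^ m * (real m * sin (real m * t))) sums
      (q * (1 - q\<^sup>2) * sin t / ?d\<^sup>2)" by (simp only:)
qed

lemma sqrt_ext_sq:
  assumes "a \<le> b" "x < a \<or> b < x"
  shows "(sqrt_ext a b x)\<^sup>2 = (x - a) * (x - b)"
proof -
  have "(x - a) / (x - b) \<ge> 0" using assms by (auto simp: zero_le_divide_iff)
  then have "(sqrt_ext a b x)\<^sup>2 = (x - b)\<^sup>2 * ((x - a) / (x - b))"
    by (simp add: sqrt_ext_def power_mult_distrib)
  then show ?thesis using assms by (auto simp: power2_eq_square)
qed

lemma sqrt_ext_measurable [measurable]: "sqrt_ext a b \<in> borel_measurable borel"
  unfolding sqrt_ext_def[abs_def] by measurable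

lemma poisson_kernel_measurable [measurable]:
  assumes [measurable]: "f \<in> borel_measurable M" "g \<in> borel_measurable M"
  shows "(\<lambda>x. poisson_kernel a b (f x) (g x)) \<in> borel_measurable M"
  unfolding poisson_kernel_def by measurable

lemma abs_sqrt_ext_ge:
  assumes "a \<le> b" "0 < d" "x \<le> a - d \<or> b + d \<le> x"
  shows "d \<le> \<bar>sqrt_ext a b x\<bar>"
proof -
  have "d * d \<le> (x - a) * (x - b)"
  proof (cases "b + d \<le> x")
    case True
    then show ?thesis using assms by (intro mult_mono) auto
  next
    case False
    have "d * d \<le> (a - x) * (b - x)" using assms False by (intro mult_mono) auto
    then show ?thesis by (simp add: algebra_simps)
  qed
  then have "d\<^sup>2 \<le> (sqrt_ext a b x)\<^sup>2"
    using assms by (subst sqrt_ext_sq) (auto simp: power2_eq_square)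
  then show ?thesis using assms by (simp add: abs_le_square_iff[symmetric])
qed

text \<open>The Joukowski parameter \<open>q\<close> of an exterior point \<open>x\<close>, normalised by \<open>\<bar>q\<bar> < 1\<close>:
  \<open>(q + 1/q)/2\<close> is the affine image of \<open>x\<close> under the map taking \<open>[a,b]\<close> to \<open>[-1,1]\<close>, reversed.\<close>

definition joukowski :: "real \<Rightarrow> real \<Rightarrow> real \<Rightarrow> real" where
  "joukowski a b x = ((a + b) / 2 - x + sqrt_ext a b x) / ((b - a) / 2)"

lemma joukowski_measurable [measurable]: "joukowski a b \<in> borel_measurable borel"
  unfolding joukowski_def[abs_def] by measurable

text \<open>With Y the centre minus x and R the branch, (Y + R) (Y - R) = l^2, hence q = l / (Y -
  R). R has the sign of x minus the centre, opposite to that of Y, so the absolute value of Y - R is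
  at least that of Y and thus at least l + d; nothing cancels, and q stays uniformly below 1 in
  absolute value.\<close>

lemma joukowski:
  assumes ab: "a < b" and d: "0 < d" and x: "x \<le> a - d \<or> b + d \<le> x"
  shows "\<bar>joukowski a b x\<bar> \<le> 1 / (1 + d / ((b - a) / 2))"
    and "joukowski a b x * ((a + b) / 2 - x - sqrt_ext a b x) = (b - a) / 2"
proof -
  define R where "R = sqrt_ext a b x"
  define l where "l = (b - a) / 2"
  define Y where "Y = (a + b) / 2 - x"
  have l: "l > 0" using ab by (simp add: l_def)
  have R2: "R\<^sup>2 = Y\<^sup>2 - l\<^sup>2"
    using sqrt_ext_sq[of a b x] ab d x
    by (auto simp: R_def Y_def l_def power2_eq_square field_simps)
  have q: "joukowski a b x = (Y + R) / l" by (simp add: joukowski_def R_def l_def Y_def)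
  have prod: "(Y + R) * (Y - R) = l\<^sup>2" using R2 by (simp add: power2_eq_square algebra_simps)
  then show eq: "joukowski a b x * ((a + b) / 2 - x - sqrt_ext a b x) = (b - a) / 2"
    using l unfolding q by (fold R_def Y_def l_def) (simp add: power2_eq_square)
  have big: "l + d \<le> \<bar>Y - R\<bar>"
  proof (cases "b + d \<le> x")
    case True
    then have "R \<ge> 0" "- Y \<ge> l + d"
      using ab d by (auto simp: R_def sqrt_ext_def Y_def l_def field_simps intro!: mult_nonneg_nonneg)
    then show ?thesis by linarith
  next
    case False
    then have xa: "x \<le> a - d" using x by auto
    have "R \<le> 0"
      unfolding R_def sqrt_ext_def using xa ab d
      by (intro mult_nonpos_nonneg) (auto simp: zero_le_divide_iff)
    moreover have "Y \<ge> l + d" using xa by (simp add: Y_def l_def field_simps)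
    ultimately show ?thesis by linarith
  qed
  have "\<bar>joukowski a b x\<bar> * \<bar>Y - R\<bar> = l"
    using eq l by (simp add: abs_mult[symmetric] Y_def R_def l_def)
  moreover have "\<bar>joukowski a b x\<bar> * (l + d) \<le> \<bar>joukowski a b x\<bar> * \<bar>Y - R\<bar>"
    using big by (intro mult_left_mono) auto
  ultimately have "\<bar>joukowski a b x\<bar> * (l + d) \<le> l" by simp
  then have "\<bar>joukowski a b x\<bar> \<le> l / (l + d)" using l d by (simp add: field_simps)
  also have "\<dots> = 1 / (1 + d / l)" using l d by (simp add: field_simps)
  finally show "\<bar>joukowski a b x\<bar> \<le> 1 / (1 + d / ((b - a) / 2))" by (simp add: l_def)
qed

text \<open>Both parts rest on l (1 - 2 q cos t + q^2) = 2 q (z - x), which identifies the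
  denominators in \<open>sin_series\<close> with powers of z - x. The two expansions have the same
  coefficients apart from the factor pi m: in the angle variable, multiplication by m plays the role
  of the half-Laplacian.\<close>

lemma poisson_kernel_series:
  assumes ab: "a < b" and d: "0 < d" and x: "x \<le> a - d \<or> b + d \<le> x" and t: "0 \<le> t" "t \<le> pi"
  defines "z \<equiv> (a + b) / 2 - (b - a) / 2 * cos t"
  shows "poisson_kernel a b z x = - 2 / (pi * sqrt_ext a b x) * (\<Sum>m. joukowski a b x ^ m * sin (real m * t))"
    and "(b - a) / 2 * sin t / (x - z)\<^sup>2
      = pi * (- 2 / (pi * sqrt_ext a b x) * (\<Sum>m. joukowski a b x ^ m * (real m * sin (real m * t))))"
proof -
  define R where "R = sqrt_ext a b x"
  define l where "l = (b - a) / 2"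
  define Y where "Y = (a + b) / 2 - x"
  define q where "q = joukowski a b x"
  have l: "l > 0" using ab by (simp add: l_def)
  have "R \<noteq> 0" using abs_sqrt_ext_ge[of a b d x] ab d x by (auto simp: R_def)
  have qY: "q * (Y - R) = l" "q * l = Y + R"
    using joukowski(2)[OF ab d x] ab by (auto simp: q_def Y_def R_def l_def joukowski_def)
  have q0: "q \<noteq> 0" using qY(1) l by auto
  have "\<bar>q\<bar> \<le> 1 / (1 + d / l)" using joukowski(1)[OF ab d x] by (simp add: q_def l_def)
  also have "\<dots> < 1"
  proof -
    have "0 < d / l" using d l by simp
    then show ?thesis by (simp add: divide_less_eq)
  qed
  finally have q1: "\<bar>q\<bar> < 1" .
  have z: "z - a = l * (1 - cos t)" "b - z = l * (1 + cos t)" "x - z = l * cos t - Y"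
    by (auto simp: z_def l_def Y_def field_simps)
  have rad: "max 0 ((z - a) * (b - z)) = (l * sin t)\<^sup>2"
  proof -
    have "(z - a) * (b - z) = l\<^sup>2 * (1 - (cos t)\<^sup>2)"
      unfolding z by (simp add: power2_eq_square algebra_simps)
    also have "\<dots> = (l * sin t)\<^sup>2" by (simp add: sin_squared_eq power_mult_distrib)
    finally show ?thesis by simp
  qed
  have zab: "a \<le> z" "z \<le> b"
    using z(1,2) l cos_le_one[of t] cos_ge_minus_one[of t]
    by (smt (verit) mult_nonneg_nonneg)+
  then have clamp: "max a (min b z) = z" by simp
  have Yne: "Y - l * cos t \<noteq> 0" using zab x d z(3) by auto
  have pk: "poisson_kernel a b z x = l * sin t / (pi * R * (l * cos t - Y))"
    unfolding poisson_kernel_def rad clamp z(3) R_def[symmetric] using l t sin_ge_zero[of t] by simp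
  have den: "l * (1 - 2 * q * cos t + q\<^sup>2) = 2 * q * (Y - l * cos t)"
  proof -
    have "l + q * (q * l) = 2 * q * Y"
      unfolding qY(2) using qY(1) by (simp add: algebra_simps)
    then show ?thesis by (simp add: power2_eq_square algebra_simps)
  qed
  then have D: "1 - 2 * q * cos t + q\<^sup>2 = 2 * q * (Y - l * cos t) / l" using l by (simp add: field_simps)
  have "(\<Sum>m. q ^ m * sin (real m * t)) = q * sin t / (2 * q * (Y - l * cos t) / l)"
    using sin_series(1)[OF q1, of t] unfolding D by (simp add: sums_iff)
  also have "\<dots> = l * sin t / (2 * (Y - l * cos t))" using q0 l Yne by simp
  finally have S1: "(\<Sum>m. q ^ m * sin (real m * t)) = l * sin t / (2 * (Y - l * cos t))" .
  show "poisson_kernel a b z x = - 2 / (pi * sqrt_ext a b x) * (\<Sum>m. joukowski a b x ^ m * sin (real m * t))"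
    unfolding pk R_def[symmetric] q_def[symmetric] S1 using Yne \<open>R \<noteq> 0\<close> by (simp add: field_simps)
  \<comment> \<open>That is, 1 / q - q = - 2 R / l: up to scale, the branch R is the difference of
    the two roots of the Joukowski equation.\<close>
  have num: "l * (q * (1 - q\<^sup>2)) = - 2 * q\<^sup>2 * R"
  proof -
    have "l * (q * (1 - q\<^sup>2)) = q * (l - q * (q * l))" by (simp add: power2_eq_square algebra_simps)
    also have "\<dots> = q * (q * (Y - R) - q * (Y + R))" unfolding qY ..
    also have "\<dots> = - 2 * q\<^sup>2 * R" by (simp add: power2_eq_square algebra_simps)
    finally show ?thesis .
  qed
  have "(\<Sum>m. q ^ m * (real m * sin (real m * t))) = q * (1 - q\<^sup>2) * sin t / (2 * q * (Y - l * cos t) / l)\<^sup>2"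
    using sin_series(2)[OF q1, of t] unfolding D by (simp add: sums_iff)
  also have "\<dots> = l * (l * (q * (1 - q\<^sup>2))) * sin t / (4 * q\<^sup>2 * (Y - l * cos t)\<^sup>2)"
    by (simp add: power2_eq_square field_simps)
  also have "\<dots> = - R * l * sin t / (2 * (Y - l * cos t)\<^sup>2)"
    unfolding num using q0 Yne by (simp add: field_simps)
  finally have S2: "(\<Sum>m. q ^ m * (real m * sin (real m * t))) = - R * l * sin t / (2 * (Y - l * cos t)\<^sup>2)" .
  have "(x - z)\<^sup>2 = (Y - l * cos t)\<^sup>2" unfolding z(3) by (rule power2_commute)
  then show "(b - a) / 2 * sin t / (x - z)\<^sup>2
      = pi * (- 2 / (pi * sqrt_ext a b x) * (\<Sum>m. joukowski a b x ^ m * (real m * sin (real m * t))))"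
    unfolding R_def[symmetric] q_def[symmetric] S2 l_def[symmetric] using \<open>R \<noteq> 0\<close> by simp
qed

text \<open>The points of the support keep the distance d from [a, b], so the Joukowski parameter is
  bounded by some r < 1 and \<open>A m\<close> decays like r^m; this justifies exchanging sum and
  integral. The bound \<open>Suc m\<close> on the weights covers both sin(m t) and m sin(m t) and
  matches the convergent series of (m + 1) r^m.\<close>

lemma poisson_coefficient_sums:
  fixes M :: "real measure" and \<mu> w :: "_ \<Rightarrow> real"
  assumes ab: "a < b" and d: "0 < d"
    and id [measurable]: "(\<lambda>x. x) \<in> borel_measurable M" and \<mu>: "integrable M \<mu>"
    and supp: "\<And>x. x \<in> space M \<Longrightarrow> \<mu> x \<noteq> 0 \<Longrightarrow> x \<le> a - d \<or> b + d \<le> x"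
    and w: "\<And>m. \<bar>w m\<bar> \<le> real (Suc m)"
  defines "A \<equiv> \<lambda>m. \<integral>x. \<mu> x * (- 2 / (pi * sqrt_ext a b x) * joukowski a b x ^ m) \<partial>M"
  shows "(\<lambda>m. A m * w m) sums
      (\<integral>x. \<mu> x * (- 2 / (pi * sqrt_ext a b x) * (\<Sum>m. joukowski a b x ^ m * w m)) \<partial>M)"
    and "summable (\<lambda>m. real (Suc m) * \<bar>A m\<bar>)"
proof -
  define r where "r = 1 / (1 + d / ((b - a) / 2))"
  have r: "0 \<le> r" "r < 1"
  proof -
    have "0 < d / ((b - a) / 2)" using ab d by simp
    then show "0 \<le> r" "r < 1" by (auto simp: r_def divide_less_eq)
  qed
  note [measurable] = borel_measurable_integrable[OF \<mu>]
  define g where "g x = \<mu> x * (- 2 / (pi * sqrt_ext a b x))" for x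
  have [measurable]: "g \<in> borel_measurable M" unfolding g_def[abs_def] by measurable
  have gB: "\<bar>g x\<bar> \<le> \<bar>\<mu> x\<bar> * (2 / (pi * d))" if "x \<in> space M" for x
  proof (cases "\<mu> x = 0")
    case False
    then have "d \<le> \<bar>sqrt_ext a b x\<bar>" using abs_sqrt_ext_ge[of a b d x] ab d supp that by auto
    then have "2 / (pi * \<bar>sqrt_ext a b x\<bar>) \<le> 2 / (pi * d)"
      using d by (intro divide_left_mono mult_left_mono mult_pos_pos) auto
    then have "\<bar>\<mu> x\<bar> * (2 / (pi * \<bar>sqrt_ext a b x\<bar>)) \<le> \<bar>\<mu> x\<bar> * (2 / (pi * d))"
      by (rule mult_left_mono) simp
    then show ?thesis by (simp add: g_def abs_mult)
  qed (simp add: g_def)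
  have g: "integrable M g"
  proof (rule Bochner_Integration.integrable_bound)
    show "integrable M (\<lambda>x. \<bar>\<mu> x\<bar> * (2 / (pi * d)))" using \<mu> by auto
    show "AE x in M. norm (g x) \<le> norm (\<bar>\<mu> x\<bar> * (2 / (pi * d)))"
      using gB d by (intro AE_I2) auto
  qed measurable
  have qB: "\<bar>g x * joukowski a b x ^ m\<bar> \<le> \<bar>g x\<bar> * r ^ m" if "x \<in> space M" for x m
  proof (cases "\<mu> x = 0")
    case False
    then have "\<bar>joukowski a b x\<bar> \<le> r" using joukowski(1)[OF ab d] supp that by (auto simp: r_def)
    then show ?thesis by (simp add: abs_mult power_abs mult_left_mono power_mono)
  qed (simp add: g_def)
  have geo: "summable (\<lambda>m. real (Suc m) * r ^ m)"
    using geometric_deriv_sums[of r] r by (auto simp: sums_iff)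
  have int: "integrable M (\<lambda>x. g x * joukowski a b x ^ m)" for m
  proof (rule Bochner_Integration.integrable_bound)
    show "integrable M (\<lambda>x. \<bar>g x\<bar> * r ^ m)" using g by auto
    show "AE x in M. norm (g x * joukowski a b x ^ m) \<le> norm (\<bar>g x\<bar> * r ^ m)"
      using qB r by (intro AE_I2) (auto simp: abs_mult)
  qed measurable
  have A: "A m = (\<integral>x. g x * joukowski a b x ^ m \<partial>M)" for m
    by (simp add: A_def g_def mult.assoc)
  have intB: "(\<integral>x. \<bar>g x * joukowski a b x ^ m\<bar> \<partial>M) \<le> (\<integral>x. \<bar>g x\<bar> \<partial>M) * r ^ m" for m
  proof -
    have "(\<integral>x. \<bar>g x * joukowski a b x ^ m\<bar> \<partial>M) \<le> (\<integral>x. \<bar>g x\<bar> * r ^ m \<partial>M)"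
      using int[of m] g qB by (intro integral_mono) auto
    then show ?thesis by simp
  qed
  show "summable (\<lambda>m. real (Suc m) * \<bar>A m\<bar>)"
  proof (rule summable_comparison_test'[of "\<lambda>m. (\<integral>x. \<bar>g x\<bar> \<partial>M) * (real (Suc m) * r ^ m)" 0])
    show "summable (\<lambda>m. (\<integral>x. \<bar>g x\<bar> \<partial>M) * (real (Suc m) * r ^ m))" by (rule summable_mult[OF geo])
    show "norm (real (Suc m) * \<bar>A m\<bar>) \<le> (\<integral>x. \<bar>g x\<bar> \<partial>M) * (real (Suc m) * r ^ m)" for m
    proof -
      have "\<bar>A m\<bar> \<le> (\<integral>x. \<bar>g x\<bar> \<partial>M) * r ^ m"
        unfolding A using integral_abs_bound[of M "\<lambda>x. g x * joukowski a b x ^ m"] intB[of m] by linarith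
      then have "real (Suc m) * \<bar>A m\<bar> \<le> real (Suc m) * ((\<integral>x. \<bar>g x\<bar> \<partial>M) * r ^ m)"
        by (rule mult_left_mono) simp
      then show ?thesis by (simp add: mult_ac)
    qed
  qed
  have "(\<lambda>m. \<integral>x. g x * joukowski a b x ^ m * w m \<partial>M) sums (\<integral>x. (\<Sum>m. g x * joukowski a b x ^ m * w m) \<partial>M)"
  proof (rule sums_integral)
    show "integrable M (\<lambda>x. g x * joukowski a b x ^ m * w m)" for m using int[of m] by auto
    have le: "\<bar>g x * joukowski a b x ^ m * w m\<bar> \<le> \<bar>g x\<bar> * (real (Suc m) * r ^ m)" if "x \<in> space M" for x m
    proof -
      have "\<bar>g x * joukowski a b x ^ m\<bar> * \<bar>w m\<bar> \<le> (\<bar>g x\<bar> * r ^ m) * real (Suc m)"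
        using qB[OF that] w[of m] r by (intro mult_mono) auto
      then show ?thesis by (simp add: abs_mult mult_ac)
    qed
    show "AE x in M. summable (\<lambda>m. norm (g x * joukowski a b x ^ m * w m))"
    proof (rule AE_I2)
      fix x assume "x \<in> space M"
      then show "summable (\<lambda>m. norm (g x * joukowski a b x ^ m * w m))"
        using le by (intro summable_comparison_test'[OF summable_mult[OF geo, of "\<bar>g x\<bar>"], of 0]) auto
    qed
    show "summable (\<lambda>m. \<integral>x. norm (g x * joukowski a b x ^ m * w m) \<partial>M)"
    proof (rule summable_comparison_test'[OF summable_mult[OF geo, of "\<integral>x. \<bar>g x\<bar> \<partial>M"], of 0])
      fix m
      have "(\<integral>x. norm (g x * joukowski a b x ^ m * w m) \<partial>M) \<le> (\<integral>x. \<bar>g x\<bar> * (real (Suc m) * r ^ m) \<partial>M)"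
        using int[of m] g le by (intro integral_mono) auto
      then show "norm (\<integral>x. norm (g x * joukowski a b x ^ m * w m) \<partial>M) \<le> (\<integral>x. \<bar>g x\<bar> \<partial>M) * (real (Suc m) * r ^ m)"
        by simp
    qed
  qed
  moreover have "(\<integral>x. (\<Sum>m. g x * joukowski a b x ^ m * w m) \<partial>M)
      = (\<integral>x. \<mu> x * (- 2 / (pi * sqrt_ext a b x) * (\<Sum>m. joukowski a b x ^ m * w m)) \<partial>M)"
  proof (rule Bochner_Integration.integral_cong[OF refl])
    fix x assume x: "x \<in> space M"
    show "(\<Sum>m. g x * joukowski a b x ^ m * w m)
        = \<mu> x * (- 2 / (pi * sqrt_ext a b x) * (\<Sum>m. joukowski a b x ^ m * w m))"
    proof (cases "\<mu> x = 0")
      case False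
      then have q: "\<bar>joukowski a b x\<bar> \<le> r" using joukowski(1)[OF ab d] supp x by (auto simp: r_def)
      have "summable (\<lambda>m. joukowski a b x ^ m * w m)"
      proof (rule summable_comparison_test'[OF geo, of 0])
        fix m
        have "\<bar>joukowski a b x\<bar> ^ m * \<bar>w m\<bar> \<le> r ^ m * real (Suc m)"
          using q w[of m] r by (intro mult_mono power_mono) auto
        then show "norm (joukowski a b x ^ m * w m) \<le> real (Suc m) * r ^ m"
          by (simp add: abs_mult power_abs mult_ac)
      qed
      from suminf_mult[OF this, of "g x"] show ?thesis by (simp add: g_def mult.assoc)
    qed (simp add: g_def)
  qed
  moreover have "(\<integral>x. g x * joukowski a b x ^ m * w m \<partial>M) = A m * w m" for m
    unfolding A by simp
  ultimately show "(\<lambda>m. A m * w m) sums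
      (\<integral>x. \<mu> x * (- 2 / (pi * sqrt_ext a b x) * (\<Sum>m. joukowski a b x ^ m * w m)) \<partial>M)"
    by (simp only:)
qed

text \<open>As an identity of measures it yields the change of variables for nonnegative and for
  Bochner integrals alike. The density is the Jacobian, which is nonnegative on [0, pi].\<close>

lemma ivl_cos_substitution:
  assumes ab: "a < b"
  shows "ivl a b = distr (density (ivl 0 pi) (\<lambda>t. ennreal ((b - a) / 2 * sin t))) borel
    (\<lambda>t. (a + b) / 2 - (b - a) / 2 * cos t)" (is "_ = distr (density _ ?w) _ ?g")
proof (rule measure_eqI)
  fix A assume "A \<in> sets (ivl a b)"
  then have A [measurable]: "A \<in> sets borel" by simp
  have g: "?g 0 = a" "?g pi = b" by (auto simp: field_simps)
  have "emeasure (ivl a b) A = (\<integral>\<^sup>+x. indicator A x * indicator {?g 0..?g pi} x \<partial>lborel)"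
    unfolding g by (subst emeasure_density) (auto simp: mult.commute)
  also have "\<dots> = (\<integral>\<^sup>+t. indicator A (?g t) * ennreal ((b - a) / 2 * sin t) * indicator {0..pi} t \<partial>lborel)"
  proof (rule nn_integral_substitution_aux)
    show "(?g has_real_derivative (b - a) / 2 * sin t) (at t)" for t
      by (auto intro!: derivative_eq_intros)
    show "0 \<le> (b - a) / 2 * sin t" if "t \<in> {0..pi}" for t
      using that ab by (intro mult_nonneg_nonneg sin_ge_zero) auto
  qed (auto intro!: continuous_intros)
  also have "\<dots> = (\<integral>\<^sup>+t. ?w t * indicator A (?g t) \<partial>ivl 0 pi)"
    by (subst nn_integral_ivl) (auto simp: mult_ac)
  also have "\<dots> = (\<integral>\<^sup>+x. indicator A x \<partial>distr (density (ivl 0 pi) ?w) borel ?g)"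
    by (subst nn_integral_distr) (auto simp: nn_integral_density)
  finally show "emeasure (ivl a b) A = emeasure (distr (density (ivl 0 pi) ?w) borel ?g) A"
    by simp
qed simp

lemma nn_integral_ivl_cos:
  assumes "a < b" and [measurable]: "h \<in> borel_measurable borel"
  shows "(\<integral>\<^sup>+x. h x \<partial>ivl a b) =
    (\<integral>\<^sup>+t. ennreal ((b - a) / 2 * sin t) * h ((a + b) / 2 - (b - a) / 2 * cos t) \<partial>ivl 0 pi)"
  by (subst ivl_cos_substitution[OF assms(1)], subst nn_integral_distr)
    (auto simp: nn_integral_density)

lemma integral_ivl_cos_subst:
  fixes h :: "real \<Rightarrow> real"
  assumes ab: "a < b" and [measurable]: "h \<in> borel_measurable borel"
  shows "(\<integral>x. h x \<partial>ivl a b) =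
    (\<integral>t. (b - a) / 2 * sin t * h ((a + b) / 2 - (b - a) / 2 * cos t) \<partial>ivl 0 pi)"
proof -
  have "AE t in ivl 0 pi. 0 \<le> (b - a) / 2 * sin t"
    using ab by (subst AE_density) (auto split: split_indicator intro!: mult_nonneg_nonneg sin_ge_zero)
  then show ?thesis
    by (subst ivl_cos_substitution[OF ab], subst integral_distr) (auto simp: integral_density)
qed

lemma integral_ivl_half_sin_sin:
  fixes m n :: nat
  shows "(\<integral>x. sin (m * x) * sin (n * x) \<partial>ivl 0 pi) = (if m = n then (if m = 0 then 0 else pi / 2) else 0)"
proof -
  have c: "(\<integral>x. cos (of_int k * x) \<partial>ivl 0 pi) = (if k = 0 then pi else 0)" for k
  proof (cases "k = 0")
    case True
    have "(\<integral>x. 1 \<partial>ivl 0 pi) = pi - 0"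
      by (rule integral_ivl_FTC) (auto intro!: derivative_eq_intros)
    then show ?thesis using True by simp
  next
    case False
    have "(\<integral>x. cos (of_int k * x) \<partial>ivl 0 pi) = sin (of_int k * pi) / k - sin (of_int k * 0) / k"
      using False by (intro integral_ivl_FTC) (auto intro!: derivative_eq_intros simp: field_simps)
    moreover have "sin (of_int k * pi) = 0" by (subst sin_zero_iff_int2) blast
    ultimately show ?thesis using False by simp
  qed
  have "sin (m * x) * sin (n * x) =
      1/2 * cos (of_int (int m - int n) * x) - 1/2 * cos (of_int (int m + int n) * x)" for x :: real
    by (simp add: cos_add cos_diff algebra_simps)
  moreover have "integrable (ivl 0 pi) (\<lambda>x. cos (of_int k * x))" for k
    by (rule integrable_ivl_bounded[where B=1]) auto
  ultimately show ?thesis by (simp add: c del: of_int_add of_int_diff)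
qed

text \<open>On the diagonal the integrand has the junk value \<open>0/0 = 0\<close>; the diagonal is a null set.\<close>

definition gagliardo :: "(real \<Rightarrow> real) \<Rightarrow> ennreal" where
  "gagliardo u = (\<integral>\<^sup>+x. \<integral>\<^sup>+y. ennreal (((u x - u y) / (x - y))\<^sup>2) \<partial>lborel \<partial>lborel)"

text \<open>Each of the two rays contributes the reciprocal of its distance from x; the left ray is
  reflected so that one computation serves for both.\<close>

lemma nn_integral_exterior_inverse_square:
  fixes x :: real
  assumes x: "a < x" "x < b"
  shows "(\<integral>\<^sup>+y. ennreal (1 / (x - y)\<^sup>2) * indicator (- {a..b}) y \<partial>lborel) = ennreal (1 / (x - a) + 1 / (b - x))"
proof -
  have right: "(\<integral>\<^sup>+y. ennreal (1 / (c - y)\<^sup>2) * indicator {d..} y \<partial>lborel) = ennreal (1 / (d - c))"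
    if "c < d" for c d :: real
  proof -
    have "(\<integral>\<^sup>+y. ennreal (1 / (c - y)\<^sup>2) * indicator {d..} y \<partial>lborel) = ennreal (0 - (- 1 / (d - c)))"
    proof (rule nn_integral_FTC_atLeast)
      fix y assume "d \<le> y"
      then have "y - c \<noteq> 0" using that by simp
      then show "((\<lambda>y. - 1 / (y - c)) has_real_derivative 1 / (c - y)\<^sup>2) (at y)"
        by (auto intro!: derivative_eq_intros simp: power2_commute[of c y] power2_eq_square[of "y - c"])
      show "0 \<le> 1 / (c - y)\<^sup>2" by simp
    next
      have "((\<lambda>y. - inverse (y - c)) \<longlongrightarrow> - 0) at_top"
        by (intro tendsto_minus tendsto_inverse_0_at_top)
          (simp add: filterlim_at_top_add_at_top filterlim_ident filterlim_tendsto_add_at_top[OF tendsto_const, of _ _ "- c", simplified])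
      then show "((\<lambda>y. - 1 / (y - c)) \<longlongrightarrow> 0) at_top" by (simp add: divide_inverse)
    qed measurable
    then show ?thesis by simp
  qed
  have "(\<integral>\<^sup>+y. ennreal (1 / (x - y)\<^sup>2) * indicator (- {a..b}) y \<partial>lborel)
      = (\<integral>\<^sup>+y. ennreal (1 / (x - y)\<^sup>2) * indicator {..a} y + ennreal (1 / (x - y)\<^sup>2) * indicator {b..} y \<partial>lborel)"
    using AE_lborel_singleton[of a] AE_lborel_singleton[of b] x
    by (intro nn_integral_cong_AE) (auto split: split_indicator elim: eventually_elim2)
  also have "\<dots> = (\<integral>\<^sup>+y. ennreal (1 / (x - y)\<^sup>2) * indicator {..a} y \<partial>lborel)
      + (\<integral>\<^sup>+y. ennreal (1 / (x - y)\<^sup>2) * indicator {b..} y \<partial>lborel)"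
    by (rule nn_integral_add) measurable
  also have "(\<integral>\<^sup>+y. ennreal (1 / (x - y)\<^sup>2) * indicator {..a} y \<partial>lborel)
      = (\<integral>\<^sup>+y. ennreal (1 / (x - (0 + (-1) * y))\<^sup>2) * indicator {..a} (0 + (-1) * y) \<partial>lborel)"
    by (subst nn_integral_real_affine[where c="-1" and t=0]) auto
  also have "\<dots> = (\<integral>\<^sup>+y. ennreal (1 / (- x - y)\<^sup>2) * indicator {- a..} y \<partial>lborel)"
  proof (rule nn_integral_cong)
    fix y :: real
    have "(x - (0 + (-1) * y))\<^sup>2 = (- x - y)\<^sup>2" by (simp add: power2_eq_square algebra_simps)
    then show "ennreal (1 / (x - (0 + (-1) * y))\<^sup>2) * indicator {..a} (0 + (-1) * y)
        = ennreal (1 / (- x - y)\<^sup>2) * indicator {- a..} y"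
      by (auto split: split_indicator)
  qed
  finally show ?thesis using x by (simp add: right)
qed

text \<open>The plane splits into the square over [a, b], two strips with exactly one variable
  outside, and the rest, where both values of u vanish. The strips are mirror images, hence the
  factor 2; in each the outside variable is integrated out.\<close>

lemma gagliardo_supported:
  fixes u :: "real \<Rightarrow> real"
  assumes u [measurable]: "u \<in> borel_measurable borel" and supp: "\<And>x. x \<notin> {a..b} \<Longrightarrow> u x = 0"
  shows "gagliardo u = (\<integral>\<^sup>+x. \<integral>\<^sup>+y. ennreal (((u x - u y) / (x - y))\<^sup>2) \<partial>ivl a b \<partial>ivl a b)
      + (\<integral>\<^sup>+x. ennreal (2 * (u x)\<^sup>2 * (1 / (x - a) + 1 / (b - x))) \<partial>ivl a b)"
proof -
  interpret S: sigma_finite_measure "ivl a b" by (rule sigma_finite_ivl)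
  let ?K = "\<lambda>x y. ennreal (((u x - u y) / (x - y))\<^sup>2)"
  let ?I = "indicator {a..b} :: real \<Rightarrow> ennreal" and ?J = "indicator (- {a..b}) :: real \<Rightarrow> ennreal"
  let ?E = "\<lambda>x y. ennreal ((u x)\<^sup>2) * ?I x * (ennreal (1 / (x - y)\<^sup>2) * ?J y)"
  have pw: "?K x y = ?I x * (?K x y * ?I y) + (?E x y + ?E y x)" for x y
  proof (cases "x \<in> {a..b}"; cases "y \<in> {a..b}")
    assume "x \<in> {a..b}" "y \<notin> {a..b}"
    then show ?thesis using supp[of y] by (simp add: ennreal_mult'[symmetric] power_divide)
  next
    assume "x \<notin> {a..b}" "y \<in> {a..b}"
    then show ?thesis using supp[of x]
      by (simp add: ennreal_mult'[symmetric] power_divide power2_commute[of x y])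
  qed (use supp in auto)
  have EE: "(\<integral>\<^sup>+x. \<integral>\<^sup>+y. ?E x y \<partial>lborel \<partial>lborel)
      = (\<integral>\<^sup>+x. ennreal ((u x)\<^sup>2 * (1 / (x - a) + 1 / (b - x))) * ?I x \<partial>lborel)"
  proof (rule nn_integral_cong_AE)
    have "(\<integral>\<^sup>+y. ?E x y \<partial>lborel) = ennreal ((u x)\<^sup>2 * (1 / (x - a) + 1 / (b - x))) * ?I x"
      if "x \<noteq> a" "x \<noteq> b" for x
    proof (cases "x \<in> {a..b}")
      case True
      then have "a < x" "x < b" using that by auto
      then show ?thesis
        using True by (subst nn_integral_cmult) (auto simp: nn_integral_exterior_inverse_square ennreal_mult')
    qed simp
    then show "AE x in lborel. (\<integral>\<^sup>+y. ?E x y \<partial>lborel)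
        = ennreal ((u x)\<^sup>2 * (1 / (x - a) + 1 / (b - x))) * ?I x"
      using AE_lborel_singleton[of a] AE_lborel_singleton[of b] by (auto elim: eventually_elim2)
  qed
  have EE': "(\<integral>\<^sup>+x. \<integral>\<^sup>+y. ?E y x \<partial>lborel \<partial>lborel) = (\<integral>\<^sup>+x. \<integral>\<^sup>+y. ?E x y \<partial>lborel \<partial>lborel)"
    by (rule lborel_pair.Fubini') measurable
  have "gagliardo u = (\<integral>\<^sup>+x. \<integral>\<^sup>+y. ?I x * (?K x y * ?I y) + (?E x y + ?E y x) \<partial>lborel \<partial>lborel)"
    unfolding gagliardo_def using pw by (intro nn_integral_cong) auto
  also have "\<dots> = (\<integral>\<^sup>+x. (\<integral>\<^sup>+y. ?I x * (?K x y * ?I y) \<partial>lborel)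
      + ((\<integral>\<^sup>+y. ?E x y \<partial>lborel) + (\<integral>\<^sup>+y. ?E y x \<partial>lborel)) \<partial>lborel)"
    by (subst nn_integral_add, measurable, subst nn_integral_add) auto
  also have "\<dots> = (\<integral>\<^sup>+x. \<integral>\<^sup>+y. ?I x * (?K x y * ?I y) \<partial>lborel \<partial>lborel)
      + ((\<integral>\<^sup>+x. \<integral>\<^sup>+y. ?E x y \<partial>lborel \<partial>lborel) + (\<integral>\<^sup>+x. \<integral>\<^sup>+y. ?E y x \<partial>lborel \<partial>lborel))"
    by (subst nn_integral_add, measurable, subst nn_integral_add) auto
  also have "(\<integral>\<^sup>+x. \<integral>\<^sup>+y. ?I x * (?K x y * ?I y) \<partial>lborel \<partial>lborel)
      = (\<integral>\<^sup>+x. \<integral>\<^sup>+y. ?K x y \<partial>ivl a b \<partial>ivl a b)"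
  proof -
    have "(\<integral>\<^sup>+x. \<integral>\<^sup>+y. ?K x y \<partial>ivl a b \<partial>ivl a b) = (\<integral>\<^sup>+x. ?I x * (\<integral>\<^sup>+y. ?K x y \<partial>ivl a b) \<partial>lborel)"
      by (rule nn_integral_density) measurable
    also have "\<dots> = (\<integral>\<^sup>+x. \<integral>\<^sup>+y. ?I x * (?K x y * ?I y) \<partial>lborel \<partial>lborel)"
    proof (rule nn_integral_cong)
      fix x :: real
      have "(\<integral>\<^sup>+y. ?K x y \<partial>ivl a b) = (\<integral>\<^sup>+y. ?K x y * ?I y \<partial>lborel)"
        by (rule nn_integral_ivl) measurable
      then show "?I x * (\<integral>\<^sup>+y. ?K x y \<partial>ivl a b) = (\<integral>\<^sup>+y. ?I x * (?K x y * ?I y) \<partial>lborel)"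
        by (simp add: nn_integral_cmult)
    qed
    finally show ?thesis by simp
  qed
  also have "(\<integral>\<^sup>+x. \<integral>\<^sup>+y. ?E x y \<partial>lborel \<partial>lborel) + (\<integral>\<^sup>+x. \<integral>\<^sup>+y. ?E y x \<partial>lborel \<partial>lborel)
      = (\<integral>\<^sup>+x. ennreal (2 * (u x)\<^sup>2 * (1 / (x - a) + 1 / (b - x))) \<partial>ivl a b)"
  proof -
    let ?e = "\<lambda>x. ennreal ((u x)\<^sup>2 * (1 / (x - a) + 1 / (b - x))) * ?I x"
    have "(\<integral>\<^sup>+x. ?e x \<partial>lborel) + (\<integral>\<^sup>+x. ?e x \<partial>lborel) = (\<integral>\<^sup>+x. ?e x + ?e x \<partial>lborel)"
      by (rule nn_integral_add[symmetric]) measurable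
    also have "\<dots> = (\<integral>\<^sup>+x. ennreal (2 * (u x)\<^sup>2 * (1 / (x - a) + 1 / (b - x))) * ?I x \<partial>lborel)"
    proof (rule nn_integral_cong)
      fix x :: real
      show "?e x + ?e x = ennreal (2 * (u x)\<^sup>2 * (1 / (x - a) + 1 / (b - x))) * ?I x"
      proof (cases "x \<in> {a..b}")
        case True
        then have "0 \<le> (u x)\<^sup>2 * (1 / (x - a) + 1 / (b - x))" by (intro mult_nonneg_nonneg) auto
        then show ?thesis using True by (simp add: ennreal_plus[symmetric] del: ennreal_plus)
      qed simp
    qed
    also have "\<dots> = (\<integral>\<^sup>+x. ennreal (2 * (u x)\<^sup>2 * (1 / (x - a) + 1 / (b - x))) \<partial>ivl a b)"
      by (rule nn_integral_ivl[symmetric]) measurable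
    finally show ?thesis unfolding EE EE' .
  qed
  finally show ?thesis .
qed

text \<open>The function \<open>u\<close> is the half-harmonic extension into \<open>[a,b]\<close> of the exterior data \<open>\<mu>\<close>;
  the identity is the weak form of \<open>(-\<Delta>)\<^sup>1\<^sup>/\<^sup>2 (u + \<mu>) = 0\<close> on \<open>[a,b]\<close>, tested with \<open>u\<close> itself.\<close>

theorem gagliardo_poisson:
  fixes M :: "real measure" and \<mu> :: "real \<Rightarrow> real"
  assumes ab: "a < b" and d: "0 < d"
    and id: "(\<lambda>x. x) \<in> borel_measurable M" and \<mu>: "integrable M \<mu>"
    and supp: "\<And>x. x \<in> space M \<Longrightarrow> \<mu> x \<noteq> 0 \<Longrightarrow> x \<le> a - d \<or> b + d \<le> x"
  defines "u \<equiv> \<lambda>z. \<integral>x. \<mu> x * poisson_kernel a b z x \<partial>M"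
  assumes u [measurable]: "u \<in> borel_measurable borel"
    and W [measurable]: "(\<lambda>z. \<integral>x. \<mu> x / (x - z)\<^sup>2 \<partial>M) \<in> borel_measurable borel"
  shows "gagliardo u = ennreal (2 * (\<integral>z. u z * (\<integral>x. \<mu> x / (x - z)\<^sup>2 \<partial>M) \<partial>ivl a b))"
    and "0 \<le> (\<integral>z. u z * (\<integral>x. \<mu> x / (x - z)\<^sup>2 \<partial>M) \<partial>ivl a b)"
proof -
  \<comment> \<open>The sine coefficients of u in the angle t. The potential, multiplied by the
    Jacobian, has the coefficients pi m A_m.\<close>
  define A where "A m = (\<integral>x. \<mu> x * (- 2 / (pi * sqrt_ext a b x) * joukowski a b x ^ m) \<partial>M)" for m
  note coeff = poisson_coefficient_sums[OF ab d id \<mu>, folded A_def]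
  let ?z = "\<lambda>t. (a + b) / 2 - (b - a) / 2 * cos t"
  let ?f = "\<lambda>t. \<Sum>m. A m * sin (real m * t)" and ?g = "\<lambda>t. \<Sum>m. (real m * A m) * sin (real m * t)"
  have sA': "summable (\<lambda>m. real (Suc m) * \<bar>A m\<bar>)" using coeff(2)[where w="\<lambda>_. 0", OF supp] by simp
  have sA: "summable (\<lambda>m. \<bar>A m\<bar>)"
    by (rule summable_comparison_test'[OF sA', of 0]) (simp add: distrib_right)
  have smA: "summable (\<lambda>m. \<bar>real m * A m\<bar>)"
    by (rule summable_comparison_test'[OF sA', of 0]) (simp add: abs_mult distrib_right)
  have sin1: "\<bar>sin (real m * t)\<bar> \<le> real (Suc m)" for m t
    using abs_sin_le_one[of "real m * t"] of_nat_0_le_iff[of m] unfolding of_nat_Suc by linarith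
  have sin2: "\<bar>real m * sin (real m * t)\<bar> \<le> real (Suc m)" for m t
  proof -
    have "real m * \<bar>sin (real m * t)\<bar> \<le> real m * 1" by (intro mult_left_mono) auto
    then show ?thesis by (simp add: abs_mult)
  qed
  have uf: "u (?z t) = ?f t" if "0 \<le> t" "t \<le> pi" for t
  proof -
    have "u (?z t) = (\<integral>x. \<mu> x * (- 2 / (pi * sqrt_ext a b x) * (\<Sum>m. joukowski a b x ^ m * sin (real m * t))) \<partial>M)"
      unfolding u_def
    proof (rule Bochner_Integration.integral_cong[OF refl])
      fix x assume "x \<in> space M"
      then show "\<mu> x * poisson_kernel a b (?z t) x
          = \<mu> x * (- 2 / (pi * sqrt_ext a b x) * (\<Sum>m. joukowski a b x ^ m * sin (real m * t)))"
        using poisson_kernel_series(1)[OF ab d _ that] supp by (cases "\<mu> x = 0") auto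
    qed
    then show ?thesis using coeff(1)[where w="\<lambda>m. sin (real m * t)", OF supp sin1] by (simp add: sums_iff)
  qed
  have Wg: "(b - a) / 2 * sin t * (\<integral>x. \<mu> x / (x - ?z t)\<^sup>2 \<partial>M) = pi * ?g t" if "0 \<le> t" "t \<le> pi" for t
  proof -
    have "(b - a) / 2 * sin t * (\<integral>x. \<mu> x / (x - ?z t)\<^sup>2 \<partial>M)
        = (\<integral>x. (b - a) / 2 * sin t * (\<mu> x / (x - ?z t)\<^sup>2) \<partial>M)"
      by (rule integral_mult_right_zero[symmetric])
    also have "\<dots> = (\<integral>x. pi * (\<mu> x * (- 2 / (pi * sqrt_ext a b x) *
        (\<Sum>m. joukowski a b x ^ m * (real m * sin (real m * t))))) \<partial>M)"
    proof (rule Bochner_Integration.integral_cong[OF refl])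
      fix x assume x: "x \<in> space M"
      have "(b - a) / 2 * sin t * (\<mu> x / (x - ?z t)\<^sup>2) = \<mu> x * ((b - a) / 2 * sin t / (x - ?z t)\<^sup>2)"
        by simp
      also have "\<dots> = \<mu> x * (pi * (- 2 / (pi * sqrt_ext a b x) *
          (\<Sum>m. joukowski a b x ^ m * (real m * sin (real m * t)))))"
        using poisson_kernel_series(2)[OF ab d _ that] supp[OF x] by (cases "\<mu> x = 0") auto
      finally show "(b - a) / 2 * sin t * (\<mu> x / (x - ?z t)\<^sup>2) = pi * (\<mu> x * (- 2 / (pi * sqrt_ext a b x) *
        (\<Sum>m. joukowski a b x ^ m * (real m * sin (real m * t)))))" by (simp only: mult.left_commute)
    qed
    also have "\<dots> = pi * (\<integral>x. \<mu> x * (- 2 / (pi * sqrt_ext a b x) *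
        (\<Sum>m. joukowski a b x ^ m * (real m * sin (real m * t)))) \<partial>M)"
      by (rule integral_mult_right_zero)
    also have "\<dots> = pi * ?g t" using coeff(1)[where w="\<lambda>m. real m * sin (real m * t)", OF supp sin2] by (simp add: sums_iff mult_ac)
    finally show ?thesis .
  qed
  \<comment> \<open>Parseval identifies the energy sum with the pairing of u and the potential: here
    the series turns into the weak equation.\<close>
  have "(\<lambda>m. A m * (real m * A m) * (if m = 0 then 0 else pi / 2)) sums (\<integral>t. ?f t * ?g t \<partial>ivl 0 pi)"
    by (rule integral_sum_sq_orthogonal[OF sA smA, where B=1]) (auto simp: integral_ivl_half_sin_sin)
  moreover have "A m * (real m * A m) * (if m = 0 then 0 else pi / 2) = real m * (A m)\<^sup>2 * (pi / 2)" for m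
    by (simp add: power2_eq_square)
  ultimately have "(\<lambda>m. real m * (A m)\<^sup>2 * (pi / 2)) sums (\<integral>t. ?f t * ?g t \<partial>ivl 0 pi)" by simp
  from sums_mult2[OF this, of "2 / pi"]
  have S: "(\<lambda>m. real m * (A m)\<^sup>2) sums ((\<integral>t. ?f t * ?g t \<partial>ivl 0 pi) * (2 / pi))" by simp
  have I: "(\<integral>z. u z * (\<integral>x. \<mu> x / (x - z)\<^sup>2 \<partial>M) \<partial>ivl a b) = pi * (\<integral>t. ?f t * ?g t \<partial>ivl 0 pi)"
  proof -
    have "(\<integral>z. u z * (\<integral>x. \<mu> x / (x - z)\<^sup>2 \<partial>M) \<partial>ivl a b)
        = (\<integral>t. (b - a) / 2 * sin t * (u (?z t) * (\<integral>x. \<mu> x / (x - ?z t)\<^sup>2 \<partial>M)) \<partial>ivl 0 pi)"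
      by (rule integral_ivl_cos_subst[OF ab]) measurable
    also have "\<dots> = (\<integral>t. pi * (?f t * ?g t) \<partial>ivl 0 pi)"
    proof (rule integral_cong_AE)
      have "(b - a) / 2 * sin t * (u (?z t) * (\<integral>x. \<mu> x / (x - ?z t)\<^sup>2 \<partial>M)) = pi * (?f t * ?g t)"
        if "0 \<le> t" "t \<le> pi" for t
        using Wg[OF that] uf[OF that] by (metis (no_types, lifting) mult.assoc mult.left_commute)
      then show "AE t in ivl 0 pi. (b - a) / 2 * sin t * (u (?z t) * (\<integral>x. \<mu> x / (x - ?z t)\<^sup>2 \<partial>M)) = pi * (?f t * ?g t)"
        by (subst AE_density) (auto split: split_indicator)
    qed (use measurable_compose[OF _ W] in measurable)
    finally show ?thesis by simp
  qed
  have AE0: "AE t in ivl 0 pi. 0 < t \<and> t < pi"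
    using AE_lborel_singleton[of 0] AE_lborel_singleton[of pi]
    by (subst AE_density) (auto split: split_indicator elim: eventually_elim2)
  define l where "l = (b - a) / 2"
  have l: "l > 0" using ab by (simp add: l_def)
  have "gagliardo u = (\<integral>\<^sup>+x. \<integral>\<^sup>+y. ennreal (((u x - u y) / (x - y))\<^sup>2) \<partial>ivl a b \<partial>ivl a b)
      + (\<integral>\<^sup>+x. ennreal (2 * (u x)\<^sup>2 * (1 / (x - a) + 1 / (b - x))) \<partial>ivl a b)"
  proof (rule gagliardo_supported[OF u])
    fix z assume "z \<notin> {a..b}"
    then have "(z - a) * (b - z) \<le> 0" using ab by (auto simp: mult_le_0_iff)
    then show "u z = 0" by (simp add: u_def poisson_kernel_def)
  qed
  also have "(\<integral>\<^sup>+x. \<integral>\<^sup>+y. ennreal (((u x - u y) / (x - y))\<^sup>2) \<partial>ivl a b \<partial>ivl a b)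
      = (\<integral>\<^sup>+s. \<integral>\<^sup>+t. ennreal ((?f s - ?f t)\<^sup>2 * (sin s * sin t / (cos s - cos t)\<^sup>2)) \<partial>ivl 0 pi \<partial>ivl 0 pi)"
  proof -
    interpret S: sigma_finite_measure "ivl c d" for c d by (rule sigma_finite_ivl)
    have "(\<integral>\<^sup>+x. \<integral>\<^sup>+y. ennreal (((u x - u y) / (x - y))\<^sup>2) \<partial>ivl a b \<partial>ivl a b)
        = (\<integral>\<^sup>+x. \<integral>\<^sup>+t. ennreal (l * sin t) * ennreal (((u x - u (?z t)) / (x - ?z t))\<^sup>2) \<partial>ivl 0 pi \<partial>ivl a b)"
      unfolding l_def by (intro nn_integral_cong nn_integral_ivl_cos[OF ab]) measurable
    also have "\<dots> = (\<integral>\<^sup>+s. ennreal (l * sin s) *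
        (\<integral>\<^sup>+t. ennreal (l * sin t) * ennreal (((u (?z s) - u (?z t)) / (?z s - ?z t))\<^sup>2) \<partial>ivl 0 pi) \<partial>ivl 0 pi)"
      unfolding l_def by (rule nn_integral_ivl_cos[OF ab]) measurable
    also have "\<dots> = (\<integral>\<^sup>+s. \<integral>\<^sup>+t. ennreal (l * sin s) *
        (ennreal (l * sin t) * ennreal (((u (?z s) - u (?z t)) / (?z s - ?z t))\<^sup>2)) \<partial>ivl 0 pi \<partial>ivl 0 pi)"
      by (intro nn_integral_cong nn_integral_cmult[symmetric]) measurable
    also have "\<dots> = (\<integral>\<^sup>+s. \<integral>\<^sup>+t. ennreal ((?f s - ?f t)\<^sup>2 * (sin s * sin t / (cos s - cos t)\<^sup>2)) \<partial>ivl 0 pi \<partial>ivl 0 pi)"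
    proof (rule nn_integral_cong_AE)
      \<comment> \<open>The Jacobians l sin s and l sin t cancel the l^2 in the squared distance:
        the energy is scale invariant.\<close>
      have e: "ennreal (l * sin s) * (ennreal (l * sin t) * ennreal (((u (?z s) - u (?z t)) / (?z s - ?z t))\<^sup>2))
          = ennreal ((?f s - ?f t)\<^sup>2 * (sin s * sin t / (cos s - cos t)\<^sup>2))"
        if "0 < s \<and> s < pi" "0 < t \<and> t < pi" for s t
      proof -
        have p: "sin s > 0" "sin t > 0" using that by (auto intro: sin_gt_zero)
        have "?z s - ?z t = - (l * (cos s - cos t))" by (simp add: l_def right_diff_distrib)
        then have "(?z s - ?z t)\<^sup>2 = (l * (cos s - cos t))\<^sup>2" by (simp only: power2_minus)
        then have "l * sin s * (l * sin t * ((u (?z s) - u (?z t)) / (?z s - ?z t))\<^sup>2)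
            = l * sin s * (l * sin t * ((u (?z s) - u (?z t))\<^sup>2 / (l * (cos s - cos t))\<^sup>2))"
          by (simp only: power_divide)
        also have "\<dots> = (u (?z s) - u (?z t))\<^sup>2 * (sin s * sin t / (cos s - cos t)\<^sup>2)"
          using l by (simp add: power_mult_distrib power2_eq_square[of l])
        finally have "l * sin s * (l * sin t * ((u (?z s) - u (?z t)) / (?z s - ?z t))\<^sup>2)
            = (?f s - ?f t)\<^sup>2 * (sin s * sin t / (cos s - cos t)\<^sup>2)"
          using uf[of s] uf[of t] that by simp
        then show ?thesis using p l by (simp only: ennreal_mult'[symmetric] mult_nonneg_nonneg less_imp_le)
      qed
      show "AE s in ivl 0 pi. (\<integral>\<^sup>+t. ennreal (l * sin s) *
        (ennreal (l * sin t) * ennreal (((u (?z s) - u (?z t)) / (?z s - ?z t))\<^sup>2)) \<partial>ivl 0 pi)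
        = (\<integral>\<^sup>+t. ennreal ((?f s - ?f t)\<^sup>2 * (sin s * sin t / (cos s - cos t)\<^sup>2)) \<partial>ivl 0 pi)"
        using AE0
      proof eventually_elim
        case (elim s)
        show ?case
          by (rule nn_integral_cong_AE) (use AE0 in eventually_elim, rule e[OF elim])
      qed
    qed
    finally show ?thesis .
  qed
  also have "(\<integral>\<^sup>+x. ennreal (2 * (u x)\<^sup>2 * (1 / (x - a) + 1 / (b - x))) \<partial>ivl a b)
      = (\<integral>\<^sup>+t. ennreal (4 * (?f t)\<^sup>2 / sin t) \<partial>ivl 0 pi)"
  proof -
    have "(\<integral>\<^sup>+x. ennreal (2 * (u x)\<^sup>2 * (1 / (x - a) + 1 / (b - x))) \<partial>ivl a b)
      = (\<integral>\<^sup>+t. ennreal (l * sin t) * ennreal (2 * (u (?z t))\<^sup>2 * (1 / (?z t - a) + 1 / (b - ?z t))) \<partial>ivl 0 pi)"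
      unfolding l_def by (rule nn_integral_ivl_cos[OF ab]) measurable
    also have "\<dots> = (\<integral>\<^sup>+t. ennreal (4 * (?f t)\<^sup>2 / sin t) \<partial>ivl 0 pi)"
    proof (rule nn_integral_cong_AE)
      show "AE t in ivl 0 pi. ennreal (l * sin t) * ennreal (2 * (u (?z t))\<^sup>2 * (1 / (?z t - a) + 1 / (b - ?z t)))
          = ennreal (4 * (?f t)\<^sup>2 / sin t)"
        using AE0
      proof eventually_elim
        case (elim t)
        then have s: "sin t > 0" by (auto intro: sin_gt_zero)
        \<comment> \<open>Since (1 - cos t) (1 + cos t) = (sin t)^2, the exterior weight becomes 2 /
          (l (sin t)^2); with the Jacobian it matches the boundary term of
          \<open>gagliardo_sine_series\<close>.\<close>
        have z: "?z t - a = l * (1 - cos t)" "b - ?z t = l * (1 + cos t)" by (auto simp: l_def field_simps)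
        have "(1 - cos t) * (1 + cos t) = sin t * sin t"
          using sin_squared_eq[of t] by (simp add: power2_eq_square algebra_simps)
        moreover from this have ne: "1 - cos t \<noteq> 0" "1 + cos t \<noteq> 0" using s by auto
        moreover have "1 / (l * p) + 1 / (l * q) = (p + q) / (l * (p * q))" if "p \<noteq> 0" "q \<noteq> 0" for p q
          using that l by (simp add: field_simps)
        from this[OF ne] have "1 / (l * (1 - cos t)) + 1 / (l * (1 + cos t)) = 2 / (l * ((1 - cos t) * (1 + cos t)))"
          by simp
        ultimately have "1 / (?z t - a) + 1 / (b - ?z t) = 2 / (l * (sin t * sin t))"
          unfolding z by simp
        then have "l * sin t * (2 * (u (?z t))\<^sup>2 * (1 / (?z t - a) + 1 / (b - ?z t)))
            = l * sin t * (2 * (u (?z t))\<^sup>2 * (2 / (l * (sin t * sin t))))" by (simp only:)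
        also have "\<dots> = 4 * (?f t)\<^sup>2 / sin t" using s l uf[of t] elim by simp
        finally show ?case using s l by (simp only: ennreal_mult'[symmetric] mult_nonneg_nonneg less_imp_le)
      qed
    qed
    finally show ?thesis .
  qed
  also have "(\<integral>\<^sup>+s. \<integral>\<^sup>+t. ennreal ((?f s - ?f t)\<^sup>2 * (sin s * sin t / (cos s - cos t)\<^sup>2)) \<partial>ivl 0 pi \<partial>ivl 0 pi)
      + (\<integral>\<^sup>+t. ennreal (4 * (?f t)\<^sup>2 / sin t) \<partial>ivl 0 pi)
      = ennreal (pi\<^sup>2 * ((\<integral>t. ?f t * ?g t \<partial>ivl 0 pi) * (2 / pi)))"
    by (rule gagliardo_sine_series[OF sA S])
  also have "pi\<^sup>2 * ((\<integral>t. ?f t * ?g t \<partial>ivl 0 pi) * (2 / pi)) = 2 * (pi * (\<integral>t. ?f t * ?g t \<partial>ivl 0 pi))"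
    by (simp add: power2_eq_square)
  finally show "gagliardo u = ennreal (2 * (\<integral>z. u z * (\<integral>x. \<mu> x / (x - z)\<^sup>2 \<partial>M) \<partial>ivl a b))"
    unfolding I .
  have "0 \<le> (\<integral>t. ?f t * ?g t \<partial>ivl 0 pi) * (2 / pi)"
    using S by (rule sums_le[OF _ sums_zero, rotated]) auto
  then show "0 \<le> (\<integral>z. u z * (\<integral>x. \<mu> x / (x - z)\<^sup>2 \<partial>M) \<partial>ivl a b)"
    unfolding I using mult_nonneg_nonneg[of "(\<integral>t. ?f t * ?g t \<partial>ivl 0 pi) * (2 / pi)" "pi * pi / 2"]
    by (simp add: mult_ac)
qed

text \<open>The exterior term of \<open>gagliardo_supported\<close> alone controls the L2 norm:
  every value of u inside is compared with the zero values outside, with a weight of at least 2 / (b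
  - a).\<close>

lemma gagliardo_poincare:
  fixes u :: "real \<Rightarrow> real"
  assumes ab: "a < b" and u [measurable]: "u \<in> borel_measurable borel" and supp: "\<And>x. x \<notin> {a..b} \<Longrightarrow> u x = 0"
  shows "(\<integral>\<^sup>+x. ennreal ((u x)\<^sup>2) \<partial>lborel) \<le> ennreal ((b - a) / 2) * gagliardo u"
proof -
  have "(\<integral>\<^sup>+x. ennreal ((u x)\<^sup>2) \<partial>lborel)
      \<le> (\<integral>\<^sup>+x. ennreal ((b - a) / 2) * (ennreal (2 * (u x)\<^sup>2 * (1 / (x - a) + 1 / (b - x))) * indicator {a..b} x) \<partial>lborel)"
  proof (rule nn_integral_mono)
    fix x
    show "ennreal ((u x)\<^sup>2) \<le> ennreal ((b - a) / 2) * (ennreal (2 * (u x)\<^sup>2 * (1 / (x - a) + 1 / (b - x))) * indicator {a..b} x)"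
    proof (cases "x \<in> {a..b}")
      case True
      have "1 / (b - a) \<le> 1 / (x - a) + 1 / (b - x)"
      \<comment> \<open>Since 1 / 0 = 0, at an endpoint only the summand of the other endpoint
        survives, and it equals 1 / (b - a).\<close>
      proof (cases "x = a")
        case False
        then have "1 / (b - a) \<le> 1 / (x - a)" using True by (intro divide_left_mono) auto
        moreover have "0 \<le> 1 / (b - x)" using True by simp
        ultimately show ?thesis by linarith
      qed (use ab in simp)
      then have "(b - a) * (1 / (b - a)) \<le> (b - a) * (1 / (x - a) + 1 / (b - x))"
        using ab by (intro mult_left_mono) auto
      then have "(u x)\<^sup>2 * 1 \<le> (u x)\<^sup>2 * ((b - a) * (1 / (x - a) + 1 / (b - x)))"
        using ab by (intro mult_left_mono) auto
      then have "(u x)\<^sup>2 \<le> (b - a) / 2 * (2 * (u x)\<^sup>2 * (1 / (x - a) + 1 / (b - x)))"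
        by (simp add: mult_ac)
      then have "ennreal ((u x)\<^sup>2) \<le> ennreal ((b - a) / 2 * (2 * (u x)\<^sup>2 * (1 / (x - a) + 1 / (b - x))))"
        by (rule ennreal_leI)
      also have "\<dots> = ennreal ((b - a) / 2) * ennreal (2 * (u x)\<^sup>2 * (1 / (x - a) + 1 / (b - x)))"
        using ab by (intro ennreal_mult') auto
      finally show ?thesis using True by simp
    qed (use supp in auto)
  qed
  also have "\<dots> = ennreal ((b - a) / 2) * (\<integral>\<^sup>+x. ennreal (2 * (u x)\<^sup>2 * (1 / (x - a) + 1 / (b - x))) \<partial>ivl a b)"
    by (simp add: nn_integral_cmult nn_integral_ivl)
  also have "\<dots> \<le> ennreal ((b - a) / 2) * gagliardo u"
    by (subst gagliardo_supported[OF u supp]) (auto intro!: mult_left_mono)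
  finally show ?thesis .
qed

section \<open>Bounds for the Poisson kernel and coercivity of the matrix\<close>

lemma poisson_kernel_bound:
  assumes ab: "a < b" and d: "0 < d" "x \<le> a - d \<or> b + d \<le> x"
  shows "\<bar>poisson_kernel a b z x\<bar> \<le> (b - a) / (pi * d * d)"
proof -
  have "max 0 ((z - a) * (b - z)) \<le> (b - a)\<^sup>2"
  proof (cases "a \<le> z \<and> z \<le> b")
    case True
    then have "(z - a) * (b - z) \<le> (b - a) * (b - a)" by (intro mult_mono) auto
    then show ?thesis by (simp add: power2_eq_square)
  next
    case False
    then have "(z - a) * (b - z) \<le> 0" using ab by (auto simp: mult_le_0_iff)
    then show ?thesis by simp
  qed
  then have num: "sqrt (max 0 ((z - a) * (b - z))) \<le> b - a"
    using ab real_sqrt_le_mono[of "max 0 ((z - a) * (b - z))" "(b - a)\<^sup>2"] by simp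
  have "d \<le> \<bar>x - max a (min b z)\<bar>" using assms by auto
  moreover have "d \<le> \<bar>sqrt_ext a b x\<bar>" using abs_sqrt_ext_ge[of a b d x] assms by auto
  ultimately have "pi * d * d \<le> pi * \<bar>sqrt_ext a b x\<bar> * \<bar>x - max a (min b z)\<bar>"
    using d by (intro mult_mono) auto
  then have "sqrt (max 0 ((z - a) * (b - z))) / (pi * \<bar>sqrt_ext a b x\<bar> * \<bar>x - max a (min b z)\<bar>)
      \<le> (b - a) / (pi * d * d)"
    using num d ab by (intro frac_le) auto
  then show ?thesis by (simp add: poisson_kernel_def abs_mult)
qed

lemma poisson_kernel_isCont:
  assumes "a < b" "x < a \<or> b < x"
  shows "isCont (\<lambda>z. poisson_kernel a b z x) z"
proof -
  have "sqrt_ext a b x \<noteq> 0" using assms sqrt_ext_sq[of a b x] by auto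
  moreover have "x - max a (min b z) \<noteq> 0" using assms by auto
  ultimately show ?thesis unfolding poisson_kernel_def by (intro continuous_intros) auto
qed

text \<open>Compactness of the unit sphere bounds the form from below by the norm. The bound is
  restated against the diagonal because the energies carry the diagonal entries as weights; the cap
  c <= 1 serves for scaling the off-diagonal entries by t.\<close>

lemma positive_definite_dominates_diagonal:
  fixes A :: "real^'n^'n"
  assumes "positive_definite A"
  obtains c where "0 < c" "c \<le> 1"
    and "\<And>v::'n \<Rightarrow> real. c * (\<Sum>j\<in>UNIV. A $ j $ j * (v j)\<^sup>2) \<le> (\<Sum>j\<in>UNIV. \<Sum>k\<in>UNIV. A $ j $ k * (v j * v k))"
proof -
  let ?S = "sphere (0::real^'n) 1" and ?q = "\<lambda>v::real^'n. v \<bullet> (A *v v)"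
  have "axis undefined 1 \<in> ?S" by simp
  then have ne: "?S \<noteq> {}" by blast
  have "continuous_on ?S ?q"
    by (intro continuous_intros matrix_vector_mult_linear_continuous_on)
  from continuous_attains_inf[OF compact_sphere ne this]
  obtain w where w: "w \<in> ?S" "\<And>v. v \<in> ?S \<Longrightarrow> ?q w \<le> ?q v" by blast
  have "w \<noteq> 0" using w(1) by auto
  then have m: "0 < ?q w" using assms by (simp add: positive_definite_def)
  have lower: "?q w * (norm v)\<^sup>2 \<le> ?q v" for v
  proof (cases "v = 0")
    case False
    define e where "e = (1 / norm v) *\<^sub>R v"
    have "?q w \<le> ?q e" using False by (intro w(2)) (simp add: e_def)
    also have "?q e = ?q v / (norm v)\<^sup>2"
      by (simp add: e_def matrix_vector_mult_scaleR power2_eq_square)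
    finally show ?thesis using False by (simp add: field_simps)
  qed simp
  define T where "T = (\<Sum>j\<in>UNIV. \<bar>A $ j $ j\<bar>) + 1"
  have T: "T > 0" unfolding T_def by (intro add_nonneg_pos sum_nonneg) auto
  define c where "c = min 1 (?q w / T)"
  have c: "0 < c" "c \<le> 1" "c * T \<le> ?q w"
  proof -
    show "0 < c" "c \<le> 1" using m T by (auto simp: c_def)
    have "c * T \<le> ?q w / T * T" using T by (intro mult_right_mono) (auto simp: c_def)
    then show "c * T \<le> ?q w" using T by simp
  qed
  have "c * (\<Sum>j\<in>UNIV. A $ j $ j * (v j)\<^sup>2) \<le> (\<Sum>j\<in>UNIV. \<Sum>k\<in>UNIV. A $ j $ k * (v j * v k))" for v
  proof -
    let ?v = "\<chi> j. v j"
    have n: "(norm ?v)\<^sup>2 = (\<Sum>j\<in>UNIV. (v j)\<^sup>2)"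
      unfolding power2_norm_eq_inner inner_vec_def by (simp add: power2_eq_square)
    have "(\<Sum>j\<in>UNIV. A $ j $ j * (v j)\<^sup>2) \<le> (\<Sum>j\<in>UNIV. T * (v j)\<^sup>2)"
    proof (intro sum_mono mult_right_mono)
      fix j
      have "\<bar>A $ j $ j\<bar> \<le> (\<Sum>j\<in>UNIV. \<bar>A $ j $ j\<bar>)" by (rule member_le_sum) auto
      then show "A $ j $ j \<le> T" by (simp add: T_def)
    qed simp
    then have "c * (\<Sum>j\<in>UNIV. A $ j $ j * (v j)\<^sup>2) \<le> c * T * (norm ?v)\<^sup>2"
      using c by (simp add: n sum_distrib_left[symmetric] mult.assoc mult_left_mono)
    also have "\<dots> \<le> ?q w * (norm ?v)\<^sup>2" using c by (intro mult_right_mono) auto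
    also have "\<dots> \<le> ?q ?v" by (rule lower)
    also have "\<dots> = (\<Sum>j\<in>UNIV. \<Sum>k\<in>UNIV. A $ j $ k * (v j * v k))"
      by (simp add: inner_vec_def matrix_vector_mult_def sum_distrib_left mult_ac)
    finally show ?thesis .
  qed
  with c show ?thesis by (intro that)
qed

section \<open>Systems of intervals\<close>

locale interval_system =
  fixes \<alpha> \<beta> :: "'n::{finite,linorder} \<Rightarrow> real" and \<Theta> :: "real^'n::{finite,linorder}^'n::{finite,linorder}"
  assumes less: "\<And>j. \<alpha> j < \<beta> j"
    and ordered: "\<And>j k. j < k \<Longrightarrow> \<beta> j < \<alpha> k"
    and pd: "positive_definite \<Theta>"
begin

abbreviation J :: "'n \<Rightarrow> real set" where "J j \<equiv> {\<alpha> j..\<beta> j}"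
abbreviation M :: "real measure" where "M \<equiv> lebesgue_on (union_I \<alpha> \<beta>)"

lemma diag_pos: "0 < \<Theta> $ j $ j"
proof -
  have "0 < axis j 1 \<bullet> (\<Theta> *v axis j (1::real))"
    using pd by (auto simp: positive_definite_def axis_eq_0_iff)
  also have "\<dots> = \<Theta> $ j $ j"
    by (simp add: matrix_vector_mult_basis column_def inner_axis' )
  finally show ?thesis .
qed

lemma gap: obtains d where "0 < d" "\<And>j k x. j \<noteq> k \<Longrightarrow> x \<in> J k \<Longrightarrow> x \<le> \<alpha> j - d \<or> \<beta> j + d \<le> x"
proof -
  \<comment> \<open>The diagonal gets the filler value 1: it is positive, and for a single interval
    it is the only value.\<close>
  define g where "g = (\<lambda>(j, k). if j < k then \<alpha> k - \<beta> j else if k < j then \<alpha> j - \<beta> k else 1)"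
  define d where "d = Min (range g)"
  have "g p > 0" for p using ordered by (auto simp: g_def split: prod.splits)
  then have "0 < d" unfolding d_def by (subst Min_gr_iff) auto
  moreover have "x \<le> \<alpha> j - d \<or> \<beta> j + d \<le> x" if "j \<noteq> k" "x \<in> J k" for j k x
  proof -
    have "d \<le> g (j, k)" unfolding d_def by (rule Min_le) auto
    then show ?thesis using that by (auto simp: g_def split: if_splits)
  qed
  ultimately show ?thesis by (rule that)
qed

lemma J_disjoint: "j \<noteq> k \<Longrightarrow> x \<in> J j \<Longrightarrow> x \<notin> J k"
  using ordered[of j k] ordered[of k j] by (cases j k rule: linorder_cases) auto

section \<open>Lebesgue measure on the union of the intervals\<close>

lemma union_borel [measurable]: "union_I \<alpha> \<beta> \<in> sets borel"
  by (intro sets.finite_UN) auto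

lemma union_lmeasurable: "union_I \<alpha> \<beta> \<in> lmeasurable"
  by (intro lmeasurable_compact compact_UN) auto

lemma finite_measure_M: "finite_measure M"
  by (rule finite_measure_lebesgue_on[OF union_lmeasurable])

lemma measurable_M:
  assumes "f \<in> borel_measurable borel" shows "f \<in> borel_measurable M"
  by (intro measurable_restrict_space1 measurable_completion) (use assms in simp)

lemma ident_M [measurable]: "(\<lambda>x. x) \<in> borel_measurable M"
  by (rule measurable_M) simp

text \<open>Arguments of the operator are merely Lebesgue measurable, but its values are continuous.
  For Borel functions this passes from the completed and restricted measure to
  \<open>lborel\<close>, on which the energies are defined.\<close>

lemma integral_M:
  fixes f :: "real \<Rightarrow> real"
  assumes f: "f \<in> borel_measurable borel" and supp: "\<And>x. x \<notin> union_I \<alpha> \<beta> \<Longrightarrow> f x = 0"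
  shows "integral\<^sup>L M f = integral\<^sup>L lborel f"
proof -
  have e: "(\<lambda>x. indicator (union_I \<alpha> \<beta>) x *\<^sub>R f x) = f" using supp by (auto simp: fun_eq_iff indicator_def)
  have u: "union_I \<alpha> \<beta> \<inter> space lebesgue \<in> sets lebesgue" using union_borel by simp
  show ?thesis
    by (subst integral_restrict_space[OF u], subst e, rule integral_completion) (use f in simp)
qed

text \<open>The real form of K: the factor i in the denominator of the prefactor cancels the i of
  the boundary value of the branch. The characteristic function in z is absorbed by
  \<open>poisson_kernel\<close>, which vanishes off its interval.\<close>

definition kern :: "real \<Rightarrow> real \<Rightarrow> real" where
  "kern z x = (\<Sum>j\<in>UNIV. \<Sum>k\<in>UNIV - {j}.
     \<Theta> $ j $ k / \<Theta> $ j $ j * (poisson_kernel (\<alpha> j) (\<beta> j) z x * indicator (J k) x))"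

section \<open>Boundedness and smoothing properties of the operator\<close>

lemma kern_measurable [measurable]:
  assumes [measurable]: "f \<in> borel_measurable N" "g \<in> borel_measurable N"
  shows "(\<lambda>x. kern (f x) (g x)) \<in> borel_measurable N"
  unfolding kern_def by measurable

lemma kern_bound: obtains B where "0 \<le> B" "\<And>z x. \<bar>kern z x\<bar> \<le> B"
proof -
  obtain d where d: "0 < d" "\<And>j k x. j \<noteq> k \<Longrightarrow> x \<in> J k \<Longrightarrow> x \<le> \<alpha> j - d \<or> \<beta> j + d \<le> x"
    using gap by blast
  let ?b = "\<lambda>j k. \<bar>\<Theta> $ j $ k / \<Theta> $ j $ j\<bar> * ((\<beta> j - \<alpha> j) / (pi * d * d))"
  show ?thesis
  proof
    show "0 \<le> (\<Sum>j\<in>UNIV. \<Sum>k\<in>UNIV - {j}. ?b j k)"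
      using less d by (intro sum_nonneg mult_nonneg_nonneg divide_nonneg_nonneg) (auto simp: less_imp_le)
    show "\<bar>kern z x\<bar> \<le> (\<Sum>j\<in>UNIV. \<Sum>k\<in>UNIV - {j}. ?b j k)" for z x
      unfolding kern_def
    proof (rule order_trans[OF sum_abs], intro sum_mono order_trans[OF sum_abs])
      fix j k :: 'n assume "k \<in> UNIV - {j}"
      then have "\<bar>poisson_kernel (\<alpha> j) (\<beta> j) z x * indicator (J k) x\<bar> \<le> (\<beta> j - \<alpha> j) / (pi * d * d)"
        using poisson_kernel_bound[OF less d(1), of x j z] d(2)[of j k x] less[of j] d(1)
        by (cases "x \<in> J k") auto
      then show "\<bar>\<Theta> $ j $ k / \<Theta> $ j $ j * (poisson_kernel (\<alpha> j) (\<beta> j) z x * indicator (J k) x)\<bar> \<le> ?b j k"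
        unfolding abs_mult[of "\<Theta> $ j $ k / \<Theta> $ j $ j"] by (intro mult_left_mono) auto
    qed
  qed
qed

text \<open>The indicator acts on x only; in z each Poisson kernel falls to zero like a square root
  at the endpoints, so its extension by zero is continuous. This places the values of the operator
  in the bounded continuous functions on the whole line.\<close>

lemma kern_isCont: "isCont (\<lambda>z. kern z x) z"
  unfolding kern_def
proof (intro continuous_sum)
  fix j k :: 'n assume "k \<in> UNIV - {j}"
  have "isCont (\<lambda>z. poisson_kernel (\<alpha> j) (\<beta> j) z x * indicator (J k) x) z"
  proof (cases "x \<in> J k")
    case True
    then have "x \<notin> J j" using J_disjoint[of j k x] \<open>k \<in> UNIV - {j}\<close> by auto
    then have "isCont (\<lambda>z. poisson_kernel (\<alpha> j) (\<beta> j) z x) z"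
      using less[of j] by (intro poisson_kernel_isCont) auto
    then show ?thesis using True by simp
  qed simp
  then show "isCont (\<lambda>z. \<Theta> $ j $ k / \<Theta> $ j $ j * (poisson_kernel (\<alpha> j) (\<beta> j) z x * indicator (J k) x)) z"
    by (rule continuous_mult[OF continuous_const])
qed

definition kern_op :: "(real \<Rightarrow> real) \<Rightarrow> real \<Rightarrow> real" where
  "kern_op \<phi> z = (\<integral>x. kern z x * \<phi> x \<partial>M)"

lemma integrable_kern_mult:
  assumes "integrable M \<phi>" shows "integrable M (\<lambda>x. kern z x * \<phi> x)"
proof -
  obtain B where B: "0 \<le> B" "\<And>z x. \<bar>kern z x\<bar> \<le> B" by (rule kern_bound) blast
  note [measurable] = borel_measurable_integrable[OF assms]
  show ?thesis
  proof (rule Bochner_Integration.integrable_bound)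
    show "integrable M (\<lambda>x. B * \<bar>\<phi> x\<bar>)" using assms by auto
    show "AE x in M. norm (kern z x * \<phi> x) \<le> norm (B * \<bar>\<phi> x\<bar>)"
      using B by (intro AE_I2) (auto simp: abs_mult intro: mult_right_mono)
  qed measurable
qed

lemma kern_op_bound:
  obtains B where "0 \<le> B" "\<And>\<phi> z. integrable M \<phi> \<Longrightarrow> \<bar>kern_op \<phi> z\<bar> \<le> B * (\<integral>x. \<bar>\<phi> x\<bar> \<partial>M)"
proof -
  obtain B where B: "0 \<le> B" "\<And>z x. \<bar>kern z x\<bar> \<le> B" by (rule kern_bound) blast
  have "\<bar>kern_op \<phi> z\<bar> \<le> B * (\<integral>x. \<bar>\<phi> x\<bar> \<partial>M)" if "integrable M \<phi>" for \<phi> z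
  proof -
    have "\<bar>kern_op \<phi> z\<bar> \<le> (\<integral>x. \<bar>kern z x * \<phi> x\<bar> \<partial>M)" unfolding kern_op_def by (rule integral_abs_bound)
    also have "\<dots> \<le> (\<integral>x. B * \<bar>\<phi> x\<bar> \<partial>M)"
      using that integrable_kern_mult[OF that, of z] B(2)
      by (intro integral_mono integrable_abs integrable_mult_right) (auto simp: abs_mult mult_right_mono)
    finally show ?thesis by simp
  qed
  with B show ?thesis by (intro that)
qed

lemma kern_op_isCont:
  assumes "integrable M \<phi>" shows "isCont (kern_op \<phi>) z"
  unfolding continuous_at_sequentially o_def
proof (intro allI impI)
  fix y assume y: "y \<longlonglongrightarrow> z"
  obtain B where B: "0 \<le> B" "\<And>z x. \<bar>kern z x\<bar> \<le> B" by (rule kern_bound) blast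
  note [measurable] = borel_measurable_integrable[OF assms]
  show "(\<lambda>n. kern_op \<phi> (y n)) \<longlonglongrightarrow> kern_op \<phi> z"
    unfolding kern_op_def
  proof (rule integral_dominated_convergence[where w="\<lambda>x. B * \<bar>\<phi> x\<bar>"])
    show "integrable M (\<lambda>x. B * \<bar>\<phi> x\<bar>)" using assms by auto
    show "AE x in M. (\<lambda>n. kern (y n) x * \<phi> x) \<longlonglongrightarrow> kern z x * \<phi> x"
      by (intro AE_I2 tendsto_mult tendsto_const isCont_tendsto_compose[OF kern_isCont y])
    show "AE x in M. norm (kern (y n) x * \<phi> x) \<le> B * \<bar>\<phi> x\<bar>" for n
      using B by (intro AE_I2) (auto simp: abs_mult intro: mult_right_mono)
  qed measurable
qed

lemma kern_op_measurable [measurable]: "integrable M \<phi> \<Longrightarrow> kern_op \<phi> \<in> borel_measurable borel"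
  by (intro borel_measurable_continuous_onI continuous_at_imp_continuous_on ballI kern_op_isCont)

lemma kern_op_zero: "z \<notin> union_I \<alpha> \<beta> \<Longrightarrow> kern_op \<phi> z = 0"
proof -
  assume z: "z \<notin> union_I \<alpha> \<beta>"
  have "poisson_kernel (\<alpha> j) (\<beta> j) z x = 0" for j x
  proof -
    have "z < \<alpha> j \<or> \<beta> j < z" using z by (metis UN_I UNIV_I atLeastAtMost_iff not_le)
    then have "(z - \<alpha> j) * (\<beta> j - z) \<le> 0" using less[of j] by (auto simp: mult_le_0_iff)
    then show ?thesis by (simp add: poisson_kernel_def)
  qed
  then show ?thesis by (simp add: kern_op_def kern_def)
qed

end

section \<open>The a priori estimate\<close>

context interval_system begin

text \<open>The exterior data seen from the j-th interval: on that interval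
  \<open>kern_op \<phi>\<close> is their Poisson extension.\<close>

definition density_from :: "(real \<Rightarrow> real) \<Rightarrow> 'n \<Rightarrow> real \<Rightarrow> real" where
  "density_from \<phi> j x = (\<Sum>k\<in>UNIV - {j}. \<Theta> $ j $ k / \<Theta> $ j $ j * (\<phi> x * indicator (J k) x))"

lemma integrable_indicator_mult:
  assumes "integrable M \<phi>" shows "integrable M (\<lambda>x. \<phi> x * indicator (J k) x :: real)"
proof (rule Bochner_Integration.integrable_bound[OF assms])
  note [measurable] = borel_measurable_integrable[OF assms]
  show "(\<lambda>x. \<phi> x * indicator (J k) x) \<in> borel_measurable M" by measurable
qed (auto split: split_indicator)

lemma integrable_density_from: "integrable M \<phi> \<Longrightarrow> integrable M (density_from \<phi> j)"
  unfolding density_from_def[abs_def]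
  by (intro Bochner_Integration.integrable_sum integrable_mult_right integrable_indicator_mult)

lemma poisson_kernel_zero: "z \<notin> J j \<Longrightarrow> poisson_kernel (\<alpha> j) (\<beta> j) z x = 0"
proof -
  assume "z \<notin> J j"
  then have "(z - \<alpha> j) * (\<beta> j - z) \<le> 0" using less[of j] by (auto simp: mult_le_0_iff)
  then show ?thesis by (simp add: poisson_kernel_def)
qed

lemma kern_op_on_interval:
  "(\<integral>x. density_from \<phi> j x * poisson_kernel (\<alpha> j) (\<beta> j) z x \<partial>M) = kern_op \<phi> z * indicator (J j) z"
proof (cases "z \<in> J j")
  case True
  have "kern z x * \<phi> x = density_from \<phi> j x * poisson_kernel (\<alpha> j) (\<beta> j) z x" for x
  proof -
    have "kern z x = (\<Sum>i\<in>UNIV. if i = j then \<Sum>k\<in>UNIV - {j}. \<Theta> $ j $ k / \<Theta> $ j $ j *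
        (poisson_kernel (\<alpha> j) (\<beta> j) z x * indicator (J k) x) else 0)"
      unfolding kern_def
    proof (rule sum.cong[OF refl])
      fix i
      show "(\<Sum>k\<in>UNIV - {i}. \<Theta> $ i $ k / \<Theta> $ i $ i * (poisson_kernel (\<alpha> i) (\<beta> i) z x * indicator (J k) x))
        = (if i = j then \<Sum>k\<in>UNIV - {j}. \<Theta> $ j $ k / \<Theta> $ j $ j *
          (poisson_kernel (\<alpha> j) (\<beta> j) z x * indicator (J k) x) else 0)"
      proof (cases "i = j")
        case False
        then have "z \<notin> J i" using J_disjoint[of j i z] True by auto
        then show ?thesis using False by (simp add: poisson_kernel_zero)
      qed simp
    qed
    also have "\<dots> = (\<Sum>k\<in>UNIV - {j}. \<Theta> $ j $ k / \<Theta> $ j $ j *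
          (poisson_kernel (\<alpha> j) (\<beta> j) z x * indicator (J k) x))" by simp
    finally show ?thesis
      by (simp add: density_from_def sum_distrib_left sum_distrib_right mult_ac)
  qed
  then show ?thesis using True by (simp add: kern_op_def)
qed (simp add: poisson_kernel_zero)

text \<open>Away from the k-th interval this is a negative multiple of the half-Laplacian of h cut
  off to that interval, with a nonsingular integrand.\<close>

definition inv_sq_potential :: "(real \<Rightarrow> real) \<Rightarrow> 'n \<Rightarrow> real \<Rightarrow> real" where
  "inv_sq_potential h k z = (\<integral>x. h x * indicator (J k) x / (x - z)\<^sup>2 \<partial>M)"

lemma sigma_finite_M: "sigma_finite_measure M"
  using finite_measure_M by (simp add: finite_measure_def)

lemma inv_sq_potential_measurable:
  assumes "h \<in> borel_measurable M" shows "inv_sq_potential h k \<in> borel_measurable borel"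
proof -
  interpret sigma_finite_measure M by (rule sigma_finite_M)
  note [measurable] = assms
  have "(\<lambda>x. x) \<in> M \<rightarrow>\<^sub>M borel" by (rule ident_M)
  then have [measurable]: "(\<lambda>p. snd p) \<in> borel_measurable ((borel :: real measure) \<Otimes>\<^sub>M M)"
    using measurable_compose[OF measurable_snd] by blast
  show ?thesis unfolding inv_sq_potential_def[abs_def]
    by (rule borel_measurable_lebesgue_integral) measurable
qed

lemma inv_sq_potential_integrand:
  assumes h: "integrable M h" and d: "0 < d" "\<And>x. x \<in> J k \<Longrightarrow> d \<le> \<bar>x - z\<bar>"
  shows "integrable M (\<lambda>x. h x * indicator (J k) x / (x - z)\<^sup>2)"
    and "\<bar>inv_sq_potential h k z\<bar> \<le> (\<integral>x. \<bar>h x\<bar> \<partial>M) / d\<^sup>2"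
proof -
  note [measurable] = borel_measurable_integrable[OF h]
  have le: "\<bar>h x * indicator (J k) x / (x - z)\<^sup>2\<bar> \<le> \<bar>h x\<bar> / d\<^sup>2" for x
  proof (cases "x \<in> J k")
    case True
    then have "d\<^sup>2 \<le> \<bar>x - z\<bar>\<^sup>2" using d by (intro power_mono) auto
    then have "\<bar>h x\<bar> / (x - z)\<^sup>2 \<le> \<bar>h x\<bar> / d\<^sup>2" using d by (intro divide_left_mono) (auto intro!: mult_pos_pos)
    then show ?thesis using True by (simp add: abs_mult)
  qed (use d in auto)
  show int: "integrable M (\<lambda>x. h x * indicator (J k) x / (x - z)\<^sup>2)"
  proof (rule Bochner_Integration.integrable_bound)
    show "integrable M (\<lambda>x. \<bar>h x\<bar> / d\<^sup>2)" using h by auto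
    show "AE x in M. norm (h x * indicator (J k) x / (x - z)\<^sup>2) \<le> norm (\<bar>h x\<bar> / d\<^sup>2)"
      using le d by (intro AE_I2) auto
  qed measurable
  have "\<bar>inv_sq_potential h k z\<bar> \<le> (\<integral>x. \<bar>h x * indicator (J k) x / (x - z)\<^sup>2\<bar> \<partial>M)"
    unfolding inv_sq_potential_def by (rule integral_abs_bound)
  also have "\<dots> \<le> (\<integral>x. \<bar>h x\<bar> / d\<^sup>2 \<partial>M)"
    using le int h by (intro integral_mono integrable_abs integrable_divide) auto
  finally show "\<bar>inv_sq_potential h k z\<bar> \<le> (\<integral>x. \<bar>h x\<bar> \<partial>M) / d\<^sup>2" by simp
qed

lemma integrable_M_bounded:
  fixes f :: "real \<Rightarrow> real"
  assumes "f \<in> borel_measurable M" "\<And>x. \<bar>f x\<bar> \<le> B"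
  shows "integrable M f"
  using assms by (intro finite_measure.integrable_const_bound[OF finite_measure_M, of _ B]) auto

text \<open>The residual enters only through potentials evaluated at distance at least d from its
  cut-off pieces, hence only through its L1 norm. The constant does not depend on t because the
  coercivity constant does not.\<close>

theorem a_priori:
  obtains K where "0 \<le> K"
    "\<And>t \<phi>. \<lbrakk>0 \<le> t; t \<le> 1; integrable M \<phi>\<rbrakk> \<Longrightarrow>
      (\<integral>x. (kern_op (\<lambda>x. t * \<phi> x) x)\<^sup>2 \<partial>M) \<le> K * (\<integral>x. \<bar>\<phi> x - kern_op (\<lambda>x. t * \<phi> x) x\<bar> \<partial>M)\<^sup>2"
proof -
  obtain d where d: "0 < d" and gap: "\<And>j k x. j \<noteq> k \<Longrightarrow> x \<in> J k \<Longrightarrow> x \<le> \<alpha> j - d \<or> \<beta> j + d \<le> x"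
    using gap by blast
  obtain c where c: "0 < c" "c \<le> 1"
    and cpd: "\<And>v::'n \<Rightarrow> real. c * (\<Sum>j\<in>UNIV. \<Theta> $ j $ j * (v j)\<^sup>2) \<le> (\<Sum>j\<in>UNIV. \<Sum>k\<in>UNIV. \<Theta> $ j $ k * (v j * v k))"
    using positive_definite_dominates_diagonal[OF pd] by blast
  \<comment> \<open>L collects the Poincare constants relative to the diagonal weights, 1 / c is the
    price of coercivity, and S bounds the pairing with the residual.\<close>
  define L where "L = (\<Sum>j\<in>UNIV. (\<beta> j - \<alpha> j) / \<Theta> $ j $ j)"
  define S where "S = (\<Sum>j\<in>UNIV. \<Sum>k\<in>UNIV - {j}. \<bar>\<Theta> $ j $ k\<bar>) / d\<^sup>2"
  define C where "C = L / c * S"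
  have L: "0 \<le> L" unfolding L_def using less diag_pos by (intro sum_nonneg divide_nonneg_nonneg) (auto intro: less_imp_le)
  have S: "0 \<le> S" unfolding S_def by (intro divide_nonneg_nonneg sum_nonneg) auto
  have "(\<integral>x. (kern_op (\<lambda>x. t * \<phi> x) x)\<^sup>2 \<partial>M) \<le> C\<^sup>2 * measure M (space M) * (\<integral>x. \<bar>\<phi> x - kern_op (\<lambda>x. t * \<phi> x) x\<bar> \<partial>M)\<^sup>2"
    if t: "0 \<le> t" "t \<le> 1" and \<phi>: "integrable M \<phi>" for t \<phi>
  proof -
    define \<psi> where "\<psi> = (\<lambda>x. t * \<phi> x)"
    define u where "u = kern_op \<psi>"
    define g where "g = (\<lambda>x. \<phi> x - u x)"
    define X where "X = (\<integral>x. \<bar>g x\<bar> \<partial>M)"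
    define Y where "Y = (\<integral>x. \<bar>u x\<bar> \<partial>M)"
    have \<psi>: "integrable M \<psi>" using \<phi> by (simp add: \<psi>_def)
    have um [measurable]: "u \<in> borel_measurable borel" unfolding u_def by (rule kern_op_measurable[OF \<psi>])
    obtain B where B: "\<And>z. \<bar>u z\<bar> \<le> B"
      using kern_op_bound[of thesis] \<psi> unfolding u_def by metis
    have B0: "0 \<le> B" using B[of 0] by linarith
    have u: "integrable M u" by (rule integrable_M_bounded[OF measurable_M[OF um] B])
    have g: "integrable M g" unfolding g_def using \<phi> u by auto
    have u_out: "x \<notin> union_I \<alpha> \<beta> \<Longrightarrow> u x = 0" for x unfolding u_def by (rule kern_op_zero)
    define v where "v j x = u x * indicator (J j) x" for j x
    have vm [measurable]: "v j \<in> borel_measurable borel" for j unfolding v_def by measurable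
    have vB: "\<bar>v j x\<bar> \<le> B" for j x using B[of x] B0 by (auto simp: v_def split: split_indicator)
    have v_out: "x \<notin> J j \<Longrightarrow> v j x = 0" for j x by (simp add: v_def)
    have dist: "d \<le> \<bar>x - z\<bar>" if "j \<noteq> k" "z \<in> J j" "x \<in> J k" for j k x z
      using gap[OF that(1,3)] that(2) by auto

    \<comment> \<open>Half the energy of \<open>v j\<close>, in the form supplied by
      \<open>gagliardo_poisson\<close>.\<close>
    define Q where "Q j = (\<integral>z. v j z * (\<integral>x. density_from \<psi> j x / (x - z)\<^sup>2 \<partial>M) \<partial>ivl (\<alpha> j) (\<beta> j))" for j
    have FS: "(\<integral>x. density_from \<psi> j x / (x - z)\<^sup>2 \<partial>M)
        = (\<Sum>k\<in>UNIV - {j}. \<Theta> $ j $ k / \<Theta> $ j $ j * inv_sq_potential \<psi> k z)" if "z \<in> J j" for j z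
    proof -
      have "(\<integral>x. density_from \<psi> j x / (x - z)\<^sup>2 \<partial>M)
          = (\<integral>x. (\<Sum>k\<in>UNIV - {j}. \<Theta> $ j $ k / \<Theta> $ j $ j * (\<psi> x * indicator (J k) x / (x - z)\<^sup>2)) \<partial>M)"
        by (simp add: density_from_def sum_divide_distrib)
      also have "\<dots> = (\<Sum>k\<in>UNIV - {j}. \<integral>x. \<Theta> $ j $ k / \<Theta> $ j $ j * (\<psi> x * indicator (J k) x / (x - z)\<^sup>2) \<partial>M)"
      proof (rule Bochner_Integration.integral_sum)
        fix k :: 'n assume "k \<in> UNIV - {j}"
        then have "integrable M (\<lambda>x. \<psi> x * indicator (J k) x / (x - z)\<^sup>2)"
          using that by (intro inv_sq_potential_integrand[OF \<psi> d] dist[of j k]) auto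
        then show "integrable M (\<lambda>x. \<Theta> $ j $ k / \<Theta> $ j $ j * (\<psi> x * indicator (J k) x / (x - z)\<^sup>2))"
          by (rule integrable_mult_right)
      qed
      finally show ?thesis by (simp only: integral_mult_right_zero inv_sq_potential_def)
    qed
    have Wm: "(\<lambda>z. \<integral>x. density_from \<psi> j x / (x - z)\<^sup>2 \<partial>M) \<in> borel_measurable borel" for j
    proof -
      interpret sigma_finite_measure M by (rule sigma_finite_M)
      note [measurable] = borel_measurable_integrable[OF integrable_density_from[OF \<psi>]]
      have [measurable]: "(\<lambda>p. snd p) \<in> borel_measurable ((borel :: real measure) \<Otimes>\<^sub>M M)"
        using measurable_compose[OF measurable_snd ident_M] by blast
      show ?thesis by (rule borel_measurable_lebesgue_integral) measurable
    qed
    have vU: "v j = (\<lambda>z. \<integral>x. density_from \<psi> j x * poisson_kernel (\<alpha> j) (\<beta> j) z x \<partial>M)" for j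
      by (simp add: fun_eq_iff v_def kern_op_on_interval u_def)
    have supp: "x \<le> \<alpha> j - d \<or> \<beta> j + d \<le> x" if "density_from \<psi> j x \<noteq> 0" for j x
    proof -
      have "\<exists>k\<in>UNIV - {j}. x \<in> J k"
      proof (rule ccontr)
        assume "\<not> (\<exists>k\<in>UNIV - {j}. x \<in> J k)"
        then have "density_from \<psi> j x = 0" unfolding density_from_def by (intro sum.neutral) auto
        with that show False by simp
      qed
      then obtain k where "k \<in> UNIV - {j}" "x \<in> J k" by (rule bexE)
      then show ?thesis by (intro gap) auto
    qed
    note vm' = vm[unfolded vU]
    have gag: "gagliardo (v j) = ennreal (2 * Q j)" for j
      unfolding Q_def vU
      by (rule gagliardo_poisson(1)[OF less d ident_M integrable_density_from[OF \<psi>]])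
        (assumption | rule supp vm' Wm)+
    have Q0: "0 \<le> Q j" for j
      unfolding Q_def vU
      by (rule gagliardo_poisson(2)[OF less d ident_M integrable_density_from[OF \<psi>]])
        (assumption | rule supp vm' Wm)+

    \<comment> \<open>Pairings of the j-th piece with the potentials of the residual and of u
      itself, both cut off to the k-th interval.\<close>
    define e where "e j k = (\<integral>z. v j z * inv_sq_potential g k z \<partial>ivl (\<alpha> j) (\<beta> j))" for j k
    define p where "p j k = (\<integral>z. v j z * inv_sq_potential u k z \<partial>ivl (\<alpha> j) (\<beta> j))" for j k
    have vFb: "\<bar>v j z * inv_sq_potential h k z\<bar> \<le> B * ((\<integral>x. \<bar>h x\<bar> \<partial>M) / d\<^sup>2)" if "j \<noteq> k" "integrable M h" for j k h z
    proof (cases "z \<in> J j")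
      case True
      then have "\<bar>inv_sq_potential h k z\<bar> \<le> (\<integral>x. \<bar>h x\<bar> \<partial>M) / d\<^sup>2"
        using inv_sq_potential_integrand(2)[OF that(2) d] dist[OF that(1)] by blast
      then show ?thesis using vB[of j z] B0 unfolding abs_mult by (intro mult_mono) auto
    next
      case False
      then show ?thesis using B0 by (simp add: v_out)
    qed
    have vFi: "integrable (ivl c' d') (\<lambda>z. v j z * inv_sq_potential h k z)" if "j \<noteq> k" "integrable M h" for j k h c' d'
      using vFb[OF that] inv_sq_potential_measurable[OF borel_measurable_integrable[OF that(2)]]
      by (intro integrable_ivl_bounded) auto
    \<comment> \<open>The equation on the j-th interval, tested with \<open>v j\<close> and
      multiplied by \<open>\<Theta> $ j $ j\<close> to clear the denominator in the kernel. It is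
      closed by the relation \<psi> = t (g + u).\<close>
    have QQ: "\<Theta> $ j $ j * Q j = t * (\<Sum>k\<in>UNIV - {j}. \<Theta> $ j $ k * (e j k + p j k))" for j
    proof -
      have Fl: "inv_sq_potential \<psi> k z = t * (inv_sq_potential g k z + inv_sq_potential u k z)" if "j \<noteq> k" "z \<in> J j" for k z
      proof -
        have i: "integrable M (\<lambda>x. h x * indicator (J k) x / (x - z)\<^sup>2)" if "integrable M h" for h
          using inv_sq_potential_integrand(1)[OF that d] dist[OF \<open>j \<noteq> k\<close> \<open>z \<in> J j\<close>] by blast
        have "inv_sq_potential g k z + inv_sq_potential u k z = (\<integral>x. g x * indicator (J k) x / (x - z)\<^sup>2 + u x * indicator (J k) x / (x - z)\<^sup>2 \<partial>M)"
          unfolding inv_sq_potential_def by (rule Bochner_Integration.integral_add[symmetric]) (intro i g u)+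
        also have "\<dots> = (\<integral>x. \<phi> x * indicator (J k) x / (x - z)\<^sup>2 \<partial>M)"
          by (simp add: g_def add_divide_distrib[symmetric] distrib_right[symmetric])
        finally have "inv_sq_potential g k z + inv_sq_potential u k z = (\<integral>x. \<phi> x * indicator (J k) x / (x - z)\<^sup>2 \<partial>M)" .
        moreover have "inv_sq_potential \<psi> k z = (\<integral>x. t * (\<phi> x * indicator (J k) x / (x - z)\<^sup>2) \<partial>M)"
          by (simp add: inv_sq_potential_def \<psi>_def mult.assoc)
        ultimately show ?thesis by (simp only: integral_mult_right_zero)
      qed
      have "\<Theta> $ j $ j * Q j = (\<integral>z. \<Theta> $ j $ j * (v j z * (\<integral>x. density_from \<psi> j x / (x - z)\<^sup>2 \<partial>M)) \<partial>ivl (\<alpha> j) (\<beta> j))"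
        by (simp add: Q_def)
      also have "\<dots> = (\<integral>z. (\<Sum>k\<in>UNIV - {j}. t * \<Theta> $ j $ k * (v j z * inv_sq_potential g k z + v j z * inv_sq_potential u k z)) \<partial>ivl (\<alpha> j) (\<beta> j))"
      proof (rule Bochner_Integration.integral_cong[OF refl])
        fix z
        show "\<Theta> $ j $ j * (v j z * (\<integral>x. density_from \<psi> j x / (x - z)\<^sup>2 \<partial>M))
            = (\<Sum>k\<in>UNIV - {j}. t * \<Theta> $ j $ k * (v j z * inv_sq_potential g k z + v j z * inv_sq_potential u k z))"
        proof (cases "z \<in> J j")
          case True
          have "\<Theta> $ j $ j * (v j z * (\<integral>x. density_from \<psi> j x / (x - z)\<^sup>2 \<partial>M))
              = (\<Sum>k\<in>UNIV - {j}. \<Theta> $ j $ j * (v j z * (\<Theta> $ j $ k / \<Theta> $ j $ j * inv_sq_potential \<psi> k z)))"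
            unfolding FS[OF True] by (simp add: sum_distrib_left)
          also have "\<dots> = (\<Sum>k\<in>UNIV - {j}. t * \<Theta> $ j $ k * (v j z * inv_sq_potential g k z + v j z * inv_sq_potential u k z))"
          proof (rule sum.cong[OF refl])
            fix k :: 'n assume "k \<in> UNIV - {j}"
            then have "inv_sq_potential \<psi> k z = t * (inv_sq_potential g k z + inv_sq_potential u k z)" using True by (intro Fl) auto
            then show "\<Theta> $ j $ j * (v j z * (\<Theta> $ j $ k / \<Theta> $ j $ j * inv_sq_potential \<psi> k z))
                = t * \<Theta> $ j $ k * (v j z * inv_sq_potential g k z + v j z * inv_sq_potential u k z)"
              using diag_pos[of j] by (simp add: algebra_simps)
          qed
          finally show ?thesis .
        next
          case False
          then show ?thesis by (simp add: v_out)
        qed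
      qed
      also have "\<dots> = (\<Sum>k\<in>UNIV - {j}. \<integral>z. t * \<Theta> $ j $ k * (v j z * inv_sq_potential g k z + v j z * inv_sq_potential u k z) \<partial>ivl (\<alpha> j) (\<beta> j))"
        by (intro Bochner_Integration.integral_sum integrable_mult_right Bochner_Integration.integrable_add vFi g u) auto
      also have "\<dots> = (\<Sum>k\<in>UNIV - {j}. t * \<Theta> $ j $ k * (e j k + p j k))"
      proof (rule sum.cong[OF refl])
        fix k :: 'n assume "k \<in> UNIV - {j}"
        then have "j \<noteq> k" by auto
        have "(\<integral>z. v j z * inv_sq_potential g k z + v j z * inv_sq_potential u k z \<partial>ivl (\<alpha> j) (\<beta> j)) = e j k + p j k"
          unfolding e_def p_def by (intro Bochner_Integration.integral_add vFi g u \<open>j \<noteq> k\<close>)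
        then show "(\<integral>z. t * \<Theta> $ j $ k * (v j z * inv_sq_potential g k z + v j z * inv_sq_potential u k z) \<partial>ivl (\<alpha> j) (\<beta> j))
            = t * \<Theta> $ j $ k * (e j k + p j k)" by simp
      qed
      finally show ?thesis by (simp add: sum_distrib_left mult.assoc)
    qed
    have eB: "\<bar>e j k\<bar> \<le> Y * (X / d\<^sup>2)" if "j \<noteq> k" for j k
    proof -
      have vi: "integrable (ivl (\<alpha> j) (\<beta> j)) (v j)" by (rule integrable_ivl_bounded[OF vm vB])
      have "\<bar>e j k\<bar> \<le> (\<integral>z. \<bar>v j z * inv_sq_potential g k z\<bar> \<partial>ivl (\<alpha> j) (\<beta> j))"
        unfolding e_def by (rule integral_abs_bound)
      also have "\<dots> \<le> (\<integral>z. \<bar>v j z\<bar> * (X / d\<^sup>2) \<partial>ivl (\<alpha> j) (\<beta> j))"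
      proof (rule integral_mono)
        show "integrable (ivl (\<alpha> j) (\<beta> j)) (\<lambda>z. \<bar>v j z * inv_sq_potential g k z\<bar>)" by (intro integrable_abs vFi that g)
        show "integrable (ivl (\<alpha> j) (\<beta> j)) (\<lambda>z. \<bar>v j z\<bar> * (X / d\<^sup>2))" using vi by auto
        fix z
        show "\<bar>v j z * inv_sq_potential g k z\<bar> \<le> \<bar>v j z\<bar> * (X / d\<^sup>2)"
        proof (cases "z \<in> J j")
          case True
          then have "\<bar>inv_sq_potential g k z\<bar> \<le> X / d\<^sup>2"
            using inv_sq_potential_integrand(2)[OF g d] dist[OF that] unfolding X_def by blast
          then show ?thesis unfolding abs_mult by (intro mult_left_mono) auto
        qed (simp add: v_out)
      qed
      also have "\<dots> = (\<integral>z. \<bar>v j z\<bar> \<partial>ivl (\<alpha> j) (\<beta> j)) * (X / d\<^sup>2)" by simp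
      also have "\<dots> \<le> Y * (X / d\<^sup>2)"
      proof (rule mult_right_mono)
        have "(\<integral>z. \<bar>v j z\<bar> \<partial>ivl (\<alpha> j) (\<beta> j)) = (\<integral>z. \<bar>v j z\<bar> \<partial>lborel)"
          by (subst integral_ivl_eq) (auto intro!: Bochner_Integration.integral_cong simp: v_def split: split_indicator)
        also have "\<dots> = (\<integral>z. \<bar>v j z\<bar> \<partial>M)" by (rule integral_M[symmetric]) (auto simp: v_def)
        also have "\<dots> \<le> Y" unfolding Y_def
          using u integrable_M_bounded[OF measurable_M[OF vm] vB]
          by (intro integral_mono integrable_abs) (auto simp: v_def split: split_indicator)
        finally show "(\<integral>z. \<bar>v j z\<bar> \<partial>ivl (\<alpha> j) (\<beta> j)) \<le> Y" .
        show "0 \<le> X / d\<^sup>2" unfolding X_def by simp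
      qed
      finally show ?thesis .
    qed

    let ?N = "lborel \<Otimes>\<^sub>M (lborel :: real measure)"
    \<comment> \<open>Difference quotients on the plane. Their squared norm is the finite energy 2 Q
      j, which also makes all mixed products integrable.\<close>
    define V where "V j q = (v j (fst q) - v j (snd q)) / (fst q - snd q)" for j and q :: "real \<times> real"
    have Vm [measurable]: "V j \<in> borel_measurable ?N" for j unfolding V_def[abs_def] by measurable
    have VV: "integrable ?N (\<lambda>q. (V j q)\<^sup>2)" "(\<integral>q. (V j q)\<^sup>2 \<partial>?N) = 2 * Q j" for j
    proof -
      have nn: "(\<integral>\<^sup>+q. ennreal ((V j q)\<^sup>2) \<partial>?N) = ennreal (2 * Q j)"
        unfolding gag[symmetric] gagliardo_def
        by (subst lborel.nn_integral_fst[symmetric]) (auto simp: V_def)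
      show "integrable ?N (\<lambda>q. (V j q)\<^sup>2)" by (rule integrableI_nonneg) (auto simp: nn)
      show "(\<integral>q. (V j q)\<^sup>2 \<partial>?N) = 2 * Q j"
        using nn Q0[of j] by (intro integral_eq_nn_integral[THEN trans]) auto
    qed
    have Vi: "integrable ?N (\<lambda>q. V j q * V k q)" for j k
    proof (rule Bochner_Integration.integrable_bound)
      show "integrable ?N (\<lambda>q. (V j q)\<^sup>2 + (V k q)\<^sup>2)" using VV(1) by auto
      have "\<bar>a * b\<bar> \<le> a\<^sup>2 + b\<^sup>2" for a b :: real
      proof -
        have "2 * \<bar>a * b\<bar> \<le> a\<^sup>2 + b\<^sup>2"
          using sum_squares_bound[of "\<bar>a\<bar>" "\<bar>b\<bar>"] by (simp add: abs_mult mult.assoc)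
        then show ?thesis using abs_ge_zero[of "a * b"] by linarith
      qed
      then show "AE q in ?N. norm (V j q * V k q) \<le> norm ((V j q)\<^sup>2 + (V k q)\<^sup>2)"
        by (intro AE_I2) auto
    qed measurable
    \<comment> \<open>For disjoint supports the products at a common point vanish, which leaves two
      mirror-image terms.\<close>
    have off: "(\<integral>q. V j q * V k q \<partial>?N) = - 2 * p j k" if jk: "j \<noteq> k" for j k
    proof -
      define G where "G q = v j (fst q) * v k (snd q) / (fst q - snd q)\<^sup>2" for q :: "real \<times> real"
      have Gm [measurable]: "G \<in> borel_measurable ?N" unfolding G_def[abs_def] by measurable
      have Gi: "integrable ?N G"
      proof (rule Bochner_Integration.integrable_bound)
        have "emeasure ?N (J j \<times> J k) = emeasure lborel (J j) * emeasure lborel (J k)"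
          by (rule lborel.emeasure_pair_measure_Times) auto
        also have "\<dots> < \<infinity>" using less[of j] less[of k] by (simp add: ennreal_mult_less_top)
        finally show "integrable ?N (\<lambda>q. B * B / d\<^sup>2 * indicator (J j \<times> J k) q)"
          by (intro integrable_mult_right integrable_real_indicator) auto
        have "\<bar>G (x, y)\<bar> \<le> B * B / d\<^sup>2 * indicator (J j \<times> J k) (x, y)" for x y
        proof (cases "x \<in> J j \<and> y \<in> J k")
          case True
          have "d \<le> \<bar>x - y\<bar>" using dist[OF jk, of x y] True by auto
          then have "d\<^sup>2 \<le> (x - y)\<^sup>2" using d power_mono[of d "\<bar>x - y\<bar>" 2] by simp
          moreover have "\<bar>v j x\<bar> * \<bar>v k y\<bar> \<le> B * B" using vB B0 by (intro mult_mono) auto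
          ultimately have "\<bar>v j x\<bar> * \<bar>v k y\<bar> / (x - y)\<^sup>2 \<le> B * B / d\<^sup>2"
            using d B0 by (intro frac_le) auto
          then show ?thesis using True by (simp add: G_def abs_mult)
        qed (auto simp: G_def v_out)
        then show "AE q in ?N. norm (G q) \<le> norm (B * B / d\<^sup>2 * indicator (J j \<times> J k) q)"
          using B0 by (intro AE_I2) (auto simp: abs_mult)
      qed measurable
      have sw: "V j q * V k q = - G q - G (snd q, fst q)" for q
      proof -
        have z: "v j x * v k x = 0" for x using J_disjoint[OF jk, of x] by (auto simp: v_def split: split_indicator)
        have "(v j x - v j y) * (v k x - v k y) = v j x * v k x + v j y * v k y - v j x * v k y - v j y * v k x" for x y
          by (simp add: algebra_simps)
        then have "(v j x - v j y) * (v k x - v k y) = - (v j x * v k y) - v j y * v k x" for x y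
          unfolding z by simp
        moreover have "(snd q - fst q)\<^sup>2 = (fst q - snd q)\<^sup>2" by (rule power2_commute)
        moreover have "V j q * V k q = (v j (fst q) - v j (snd q)) * (v k (fst q) - v k (snd q)) / (fst q - snd q)\<^sup>2"
          by (simp add: V_def power2_eq_square)
        ultimately show ?thesis by (simp add: G_def diff_divide_distrib)
      qed
      have Gsw: "integrable ?N (\<lambda>q. G (snd q, fst q))" "(\<integral>q. G (snd q, fst q) \<partial>?N) = (\<integral>q. G q \<partial>?N)"
        using lborel_pair.integrable_product_swap[OF Gi] lborel_pair.integral_product_swap[OF Gm]
        unfolding case_prod_unfold by blast+
      have "(\<integral>q. V j q * V k q \<partial>?N) = - 2 * (\<integral>q. G q \<partial>?N)"
        unfolding sw using Gi Gsw by simp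
      also have "(\<integral>q. G q \<partial>?N) = (\<integral>x. \<integral>y. G (x, y) \<partial>lborel \<partial>lborel)"
        by (rule lborel_pair.integral_fst'[OF Gi, symmetric])
      also have "\<dots> = (\<integral>x. v j x * inv_sq_potential u k x * indicator (J j) x \<partial>lborel)"
      proof (rule Bochner_Integration.integral_cong[OF refl])
        fix x :: real
        have "(\<integral>y. v k y / (x - y)\<^sup>2 \<partial>lborel) = (\<integral>y. v k y / (y - x)\<^sup>2 \<partial>lborel)"
          by (simp add: power2_commute[of x])
        also have "\<dots> = (\<integral>y. v k y / (y - x)\<^sup>2 \<partial>M)" by (rule integral_M[symmetric]) (auto simp: v_def)
        also have "\<dots> = inv_sq_potential u k x" by (simp add: inv_sq_potential_def v_def)
        finally have e: "(\<integral>y. v k y / (x - y)\<^sup>2 \<partial>lborel) = inv_sq_potential u k x" .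
        have "(\<integral>y. G (x, y) \<partial>lborel) = v j x * (\<integral>y. v k y / (x - y)\<^sup>2 \<partial>lborel)"
          by (simp add: G_def mult.assoc[symmetric] flip: times_divide_eq_right integral_mult_right_zero)
        then show "(\<integral>y. G (x, y) \<partial>lborel) = v j x * inv_sq_potential u k x * indicator (J j) x"
          unfolding e by (auto simp: v_out split: split_indicator)
      qed
      also have "\<dots> = p j k" unfolding p_def
        by (rule integral_ivl_eq[symmetric]) (use inv_sq_potential_measurable[OF borel_measurable_integrable[OF u]] in measurable)
      finally show ?thesis .
    qed
    have "c * (\<Sum>j\<in>UNIV. \<Theta> $ j $ j * (2 * Q j))
        \<le> (\<Sum>j\<in>UNIV. \<Theta> $ j $ j * (2 * Q j)) + t * (\<Sum>j\<in>UNIV. \<Sum>k\<in>UNIV - {j}. \<Theta> $ j $ k * (- 2 * p j k))"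
    proof -
      let ?D = "\<lambda>q. \<Sum>j\<in>UNIV. \<Theta> $ j $ j * (V j q)\<^sup>2"
      let ?O = "\<lambda>q. \<Sum>j\<in>UNIV. \<Sum>k\<in>UNIV - {j}. \<Theta> $ j $ k * (V j q * V k q)"
      have D: "integrable ?N ?D" "(\<integral>q. ?D q \<partial>?N) = (\<Sum>j\<in>UNIV. \<Theta> $ j $ j * (2 * Q j))"
        using VV by (auto simp: Bochner_Integration.integral_sum)
      have O: "integrable ?N ?O" "(\<integral>q. ?O q \<partial>?N) = (\<Sum>j\<in>UNIV. \<Sum>k\<in>UNIV - {j}. \<Theta> $ j $ k * (- 2 * p j k))"
      proof -
        show "integrable ?N ?O" using Vi by auto
        have "(\<integral>q. ?O q \<partial>?N) = (\<Sum>j\<in>UNIV. \<Sum>k\<in>UNIV - {j}. \<Theta> $ j $ k * (\<integral>q. V j q * V k q \<partial>?N))"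
          using Vi by (simp add: Bochner_Integration.integral_sum)
        also have "\<dots> = (\<Sum>j\<in>UNIV. \<Sum>k\<in>UNIV - {j}. \<Theta> $ j $ k * (- 2 * p j k))"
          by (intro sum.cong refl) (use off in auto)
        finally show "(\<integral>q. ?O q \<partial>?N) = (\<Sum>j\<in>UNIV. \<Sum>k\<in>UNIV - {j}. \<Theta> $ j $ k * (- 2 * p j k))" .
      qed
      \<comment> \<open>The form D + t O is the mixture t (D + O) + (1 - t) D. The first part is
        controlled by \<open>cpd\<close>, the second by c <= 1 and D >= 0.\<close>
      have pw: "c * ?D q \<le> ?D q + t * ?O q" for q
      proof -
        have "(\<Sum>j\<in>UNIV. \<Sum>k\<in>UNIV. \<Theta> $ j $ k * (V j q * V k q)) = ?D q + ?O q"
          unfolding sum.distrib[symmetric]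
        proof (rule sum.cong[OF refl])
          show "(\<Sum>k\<in>UNIV. \<Theta> $ j $ k * (V j q * V k q))
              = \<Theta> $ j $ j * (V j q)\<^sup>2 + (\<Sum>k\<in>UNIV - {j}. \<Theta> $ j $ k * (V j q * V k q))" for j
            by (subst sum.remove[of UNIV j]) (auto simp: power2_eq_square)
        qed
        then have "c * ?D q \<le> ?D q + ?O q" using cpd[of "\<lambda>j. V j q"] by simp
        then have "t * (c * ?D q) \<le> t * (?D q + ?O q)" using t by (intro mult_left_mono) auto
        moreover have "0 \<le> ?D q" using diag_pos by (intro sum_nonneg mult_nonneg_nonneg) (auto intro: less_imp_le)
        then have "(1 - t) * (c * ?D q) \<le> (1 - t) * (1 * ?D q)"
          using c t by (intro mult_left_mono mult_right_mono) auto
        ultimately show ?thesis by (simp add: algebra_simps)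
      qed
      have "(\<integral>q. c * ?D q \<partial>?N) \<le> (\<integral>q. ?D q + t * ?O q \<partial>?N)"
        using D(1) O(1) pw
        by (intro integral_mono integrable_mult_right Bochner_Integration.integrable_add)
      also have "\<dots> = (\<integral>q. ?D q \<partial>?N) + t * (\<integral>q. ?O q \<partial>?N)"
        using D(1) O(1) by (subst Bochner_Integration.integral_add) (auto simp only: integral_mult_right_zero integrable_mult_right)
      finally show ?thesis unfolding D(2) O(2) by (simp only: integral_mult_right_zero D(2))
    qed
    \<comment> \<open>The terms \<open>p j k\<close> contributed by the equation cancel those of the
      off-diagonal energy, so only the residual remains.\<close>
    also have "\<dots> = 2 * t * (\<Sum>j\<in>UNIV. \<Sum>k\<in>UNIV - {j}. \<Theta> $ j $ k * e j k)"
    proof -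
      have "\<Theta> $ j $ j * (2 * Q j) = 2 * t * (\<Sum>k\<in>UNIV - {j}. \<Theta> $ j $ k * e j k)
          + 2 * t * (\<Sum>k\<in>UNIV - {j}. \<Theta> $ j $ k * p j k)" for j
        using QQ[of j] by (simp add: distrib_left sum.distrib)
      then have "(\<Sum>j\<in>UNIV. \<Theta> $ j $ j * (2 * Q j)) = 2 * t * (\<Sum>j\<in>UNIV. \<Sum>k\<in>UNIV - {j}. \<Theta> $ j $ k * e j k)
          + 2 * t * (\<Sum>j\<in>UNIV. \<Sum>k\<in>UNIV - {j}. \<Theta> $ j $ k * p j k)"
        by (simp only: sum.distrib sum_distrib_left)
      moreover have "(\<Sum>j\<in>UNIV. \<Sum>k\<in>UNIV - {j}. \<Theta> $ j $ k * (- 2 * p j k))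
          = - 2 * (\<Sum>j\<in>UNIV. \<Sum>k\<in>UNIV - {j}. \<Theta> $ j $ k * p j k)"
        by (simp only: sum_distrib_left mult.left_commute)
      ultimately show ?thesis by simp
    qed
    also have "\<dots> \<le> 2 * 1 * (S * (X * Y))"
    proof -
      have "(\<Sum>j\<in>UNIV. \<Sum>k\<in>UNIV - {j}. \<Theta> $ j $ k * e j k)
          \<le> (\<Sum>j\<in>UNIV. \<Sum>k\<in>UNIV - {j}. \<bar>\<Theta> $ j $ k\<bar> * (Y * (X / d\<^sup>2)))"
      proof (intro sum_mono)
        fix j k :: 'n assume "k \<in> UNIV - {j}"
        then have "\<bar>\<Theta> $ j $ k\<bar> * \<bar>e j k\<bar> \<le> \<bar>\<Theta> $ j $ k\<bar> * (Y * (X / d\<^sup>2))"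
          using eB[of j k] by (intro mult_left_mono) auto
        then show "\<Theta> $ j $ k * e j k \<le> \<bar>\<Theta> $ j $ k\<bar> * (Y * (X / d\<^sup>2))"
          using abs_ge_self[of "\<Theta> $ j $ k * e j k"] by (simp add: abs_mult)
      qed
      also have "\<dots> = S * (X * Y)" 
        unfolding S_def sum_divide_distrib sum_distrib_right by (intro sum.cong refl) simp
      finally have *: "(\<Sum>j\<in>UNIV. \<Sum>k\<in>UNIV - {j}. \<Theta> $ j $ k * e j k) \<le> S * (X * Y)" .
      have "0 \<le> S * (X * Y)" using S by (simp add: X_def Y_def)
      then have "t * (\<Sum>j\<in>UNIV. \<Sum>k\<in>UNIV - {j}. \<Theta> $ j $ k * e j k) \<le> 1 * (S * (X * Y))"
        using * t by (meson mult_left_mono mult_right_mono order_trans)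
      then show ?thesis by simp
    qed
    finally have energy: "c * (\<Sum>j\<in>UNIV. \<Theta> $ j $ j * Q j) \<le> S * (X * Y)"
      by (simp add: sum_distrib_left mult.left_commute[of _ 2] flip: sum_distrib_left)

    have u2: "(\<integral>x. (u x)\<^sup>2 \<partial>M) \<le> C * X * Y"
    proof -
      have v2: "integrable lborel (\<lambda>x. (v j x)\<^sup>2)" "(\<integral>x. (v j x)\<^sup>2 \<partial>lborel) \<le> (\<beta> j - \<alpha> j) * Q j" for j
      proof -
        have nn: "(\<integral>\<^sup>+x. ennreal ((v j x)\<^sup>2) \<partial>lborel) \<le> ennreal ((\<beta> j - \<alpha> j) * Q j)"
        proof -
          have "(\<integral>\<^sup>+x. ennreal ((v j x)\<^sup>2) \<partial>lborel) \<le> ennreal ((\<beta> j - \<alpha> j) / 2) * ennreal (2 * Q j)"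
            using gagliardo_poincare[OF less vm, of j] v_out gag by simp
          also have "\<dots> = ennreal ((\<beta> j - \<alpha> j) * Q j)"
            using less[of j] by (subst ennreal_mult'[symmetric]) auto
          finally show ?thesis .
        qed
        show i: "integrable lborel (\<lambda>x. (v j x)\<^sup>2)"
          using nn by (intro integrableI_nonneg) (auto simp: le_less_trans[OF nn])
        have "ennreal (\<integral>x. (v j x)\<^sup>2 \<partial>lborel) \<le> ennreal ((\<beta> j - \<alpha> j) * Q j)"
          using nn by (subst nn_integral_eq_integral[OF i, symmetric]) auto
        then show "(\<integral>x. (v j x)\<^sup>2 \<partial>lborel) \<le> (\<beta> j - \<alpha> j) * Q j"
          using less[of j] Q0[of j] by (subst (asm) ennreal_le_iff) auto
      qed
      have us: "(u x)\<^sup>2 = (\<Sum>j\<in>UNIV. (v j x)\<^sup>2)" for x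
      proof (cases "x \<in> union_I \<alpha> \<beta>")
        case True
        then obtain i where i: "x \<in> J i" by blast
        have "(\<Sum>j\<in>UNIV. (v j x)\<^sup>2) = (\<Sum>j\<in>UNIV. if j = i then (u x)\<^sup>2 else 0)"
          using J_disjoint[of i _ x] i by (intro sum.cong refl) (auto simp: v_def)
        then show ?thesis by simp
      next
        case False
        then show ?thesis using u_out[OF False] by (auto simp: v_def)
      qed
      have "(\<integral>x. (u x)\<^sup>2 \<partial>M) = (\<integral>x. (u x)\<^sup>2 \<partial>lborel)"
        using u_out by (intro integral_M) auto
      also have "\<dots> = (\<Sum>j\<in>UNIV. \<integral>x. (v j x)\<^sup>2 \<partial>lborel)"
        unfolding us using v2(1) by (rule Bochner_Integration.integral_sum)
      also have "\<dots> \<le> (\<Sum>j\<in>UNIV. L * (\<Theta> $ j $ j * Q j))"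
      proof (rule sum_mono)
        fix j :: 'n
        have "(\<beta> j - \<alpha> j) / \<Theta> $ j $ j \<le> L"
          unfolding L_def using less diag_pos by (intro member_le_sum divide_nonneg_nonneg) (auto intro: less_imp_le)
        then have "(\<beta> j - \<alpha> j) / \<Theta> $ j $ j * (\<Theta> $ j $ j * Q j) \<le> L * (\<Theta> $ j $ j * Q j)"
          using diag_pos[of j] Q0[of j] by (intro mult_right_mono) auto
        then show "(\<integral>x. (v j x)\<^sup>2 \<partial>lborel) \<le> L * (\<Theta> $ j $ j * Q j)"
          using v2(2)[of j] diag_pos[of j] by simp
      qed
      also have "\<dots> = L / c * (c * (\<Sum>j\<in>UNIV. \<Theta> $ j $ j * Q j))" using c by (simp add: sum_distrib_left)
      also have "\<dots> \<le> L / c * (S * (X * Y))" using energy L c by (intro mult_left_mono) auto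
      finally show ?thesis by (simp add: C_def mult.assoc)
    qed
    have ui2: "integrable M (\<lambda>x. (u x)\<^sup>2)"
    proof (rule integrable_M_bounded)
      show "(\<lambda>x. (u x)\<^sup>2) \<in> borel_measurable M" by (rule measurable_M) simp
      show "\<bar>(u x)\<^sup>2\<bar> \<le> B\<^sup>2" for x using power_mono[OF B[of x], of 2] by simp
    qed
    have constM: "integrable M (\<lambda>x. (C * X)\<^sup>2)" by (rule finite_measure.integrable_const[OF finite_measure_M])
    \<comment> \<open>Young's inequality bounds C X Y by half the integral of u^2 plus half of (C
      X)^2 times the total mass; the first half is absorbed into the left-hand side of
      \<open>u2\<close>.\<close>
    have "C * X * Y \<le> (\<integral>x. ((u x)\<^sup>2 + (C * X)\<^sup>2) / 2 \<partial>M)"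
    proof -
      have "(\<integral>x. C * X * \<bar>u x\<bar> \<partial>M) \<le> (\<integral>x. ((u x)\<^sup>2 + (C * X)\<^sup>2) / 2 \<partial>M)"
      proof (rule integral_mono)
        show "integrable M (\<lambda>x. C * X * \<bar>u x\<bar>)" using u by auto
        show "integrable M (\<lambda>x. ((u x)\<^sup>2 + (C * X)\<^sup>2) / 2)"
          by (intro integrable_divide Bochner_Integration.integrable_add ui2 constM)
        show "C * X * \<bar>u x\<bar> \<le> ((u x)\<^sup>2 + (C * X)\<^sup>2) / 2" for x
          using sum_squares_bound[of "C * X" "\<bar>u x\<bar>"] by (simp add: algebra_simps)
      qed
      then show ?thesis by (simp add: Y_def)
    qed
    also have "\<dots> = ((\<integral>x. (u x)\<^sup>2 \<partial>M) + (C * X)\<^sup>2 * measure M (space M)) / 2"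
      using ui2 constM by (simp add: mult.commute)
    finally have "(\<integral>x. (u x)\<^sup>2 \<partial>M) \<le> (C * X)\<^sup>2 * measure M (space M)" using u2 by simp
    then show ?thesis
      by (simp add: u_def \<psi>_def X_def g_def power_mult_distrib mult_ac)
  qed
  then show ?thesis by (intro that[of "C\<^sup>2 * measure M (space M)"]) auto
qed

end

section \<open>Solvability\<close>

text \<open>The bound makes the solution operator at every t Lipschitz with the same constant C. A
  step of length 1 / N with C B < N is therefore always a contraction, and N steps lead from the
  identity at t = 0 to t = 1.\<close>

lemma method_of_continuity:
  fixes K :: "'a::{real_normed_vector, complete_space} \<Rightarrow> 'a"
  assumes K: "bounded_linear K" and C: "0 \<le> C"
    and bound: "\<And>t u. 0 \<le> t \<Longrightarrow> t \<le> 1 \<Longrightarrow> norm u \<le> C * norm (u - t *\<^sub>R K u)"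
  shows "\<exists>u. u - K u = h"
proof -
  interpret K: bounded_linear K by (rule K)
  obtain B where B: "0 \<le> B" "\<And>x. norm (K x) \<le> norm x * B" using K.nonneg_bounded by blast
  obtain N :: nat where N: "C * B < real N" using reals_Archimedean2 by blast
  then have N0: "0 < real N" using C B(1) by (meson le_less_trans mult_nonneg_nonneg)
  have "\<forall>h. \<exists>u. u - (real k / real N) *\<^sub>R K u = h" if "k \<le> N" for k
    using that
  proof (induction k)
    case 0
    then show ?case by simp
  next
    case (Suc k)
    define t where "t = real k / real N"
    have t: "0 \<le> t" "t \<le> 1" using Suc.prems N0 by (auto simp: t_def)
    have "\<forall>h. \<exists>u. u - t *\<^sub>R K u = h" using Suc by (simp add: t_def)
    then obtain S where S: "\<And>h. S h - t *\<^sub>R K (S h) = h" by metis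
    have lip: "dist (S a) (S b) \<le> C * dist a b" for a b
    proof -
      have "(S a - S b) - t *\<^sub>R K (S a - S b) = a - b"
      proof -
        have "(S a - S b) - t *\<^sub>R K (S a - S b) = (S a - t *\<^sub>R K (S a)) - (S b - t *\<^sub>R K (S b))"
          by (simp only: K.diff scaleR_diff_right) simp
        then show ?thesis by (simp only: S)
      qed
      then show ?thesis using bound[OF t, of "S a - S b"] by (simp add: dist_norm)
    qed
    show ?case
    proof
      fix h
      \<comment> \<open>Advancing t by 1 / N: the equation u - (t + 1 / N) K u = h says that u is a
        fixed point of this map.\<close>
      have "\<exists>!u. S (h + (1 / real N) *\<^sub>R K u) = u"
      proof (rule banach_fix_type[where c="C * B / real N"])
        show "0 \<le> C * B / real N" using C B(1) by simp
        show "C * B / real N < 1" using N N0 by simp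
        show "\<forall>x y. dist (S (h + (1 / real N) *\<^sub>R K x)) (S (h + (1 / real N) *\<^sub>R K y)) \<le> C * B / real N * dist x y"
        proof (intro allI)
          fix x y
          have "dist (h + (1 / real N) *\<^sub>R K x) (h + (1 / real N) *\<^sub>R K y) = (1 / real N) * norm (K (x - y))"
            by (simp add: dist_norm K.diff flip: scaleR_diff_right)
          also have "\<dots> \<le> (1 / real N) * (norm (x - y) * B)" using B by (intro mult_left_mono) auto
          finally have "C * dist (h + (1 / real N) *\<^sub>R K x) (h + (1 / real N) *\<^sub>R K y) \<le> C * ((1 / real N) * (norm (x - y) * B))"
            using C by (rule mult_left_mono)
          then show "dist (S (h + (1 / real N) *\<^sub>R K x)) (S (h + (1 / real N) *\<^sub>R K y)) \<le> C * B / real N * dist x y"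
            using lip[of "h + (1 / real N) *\<^sub>R K x" "h + (1 / real N) *\<^sub>R K y"]
            by (simp add: dist_norm mult_ac)
        qed
      qed
      then obtain u where u: "S (h + (1 / real N) *\<^sub>R K u) = u" by blast
      have "u - t *\<^sub>R K u = h + (1 / real N) *\<^sub>R K u" using S[of "h + (1 / real N) *\<^sub>R K u"] unfolding u .
      moreover have "real (Suc k) / real N = t + 1 / real N" by (simp add: t_def add_divide_distrib)
      ultimately have "u - (real (Suc k) / real N) *\<^sub>R K u = h" by (simp add: scaleR_add_left algebra_simps)
      then show "\<exists>u. u - (real (Suc k) / real N) *\<^sub>R K u = h" ..
    qed
  qed
  from this[of N] show ?thesis using N0 by auto
qed

text \<open>Cauchy-Schwarz, by expanding the integral of the square of (m + 1) |w| - A, where A is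
  the L1 norm of w. With m + 1 in place of the total mass m there is a positive factor to cancel
  even when m = 0.\<close>

lemma integral_abs_sq_le:
  fixes w :: "'a \<Rightarrow> real"
  assumes M: "finite_measure M" and w: "integrable M w" "integrable M (\<lambda>x. (w x)\<^sup>2)"
  shows "(\<integral>x. \<bar>w x\<bar> \<partial>M)\<^sup>2 \<le> (measure M (space M) + 1) * (\<integral>x. (w x)\<^sup>2 \<partial>M)"
proof -
  define m where "m = measure M (space M)"
  define A where "A = (\<integral>x. \<bar>w x\<bar> \<partial>M)"
  define I where "I = (\<integral>x. (w x)\<^sup>2 \<partial>M)"
  have m: "0 \<le> m" by (simp add: m_def)
  have c: "integrable M (\<lambda>x. c)" for c :: real by (rule finite_measure.integrable_const[OF M])
  have "0 \<le> (\<integral>x. ((m + 1) * \<bar>w x\<bar> - A)\<^sup>2 \<partial>M)" by simp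
  also have "(\<integral>x. ((m + 1) * \<bar>w x\<bar> - A)\<^sup>2 \<partial>M)
      = (\<integral>x. (m + 1)\<^sup>2 * (w x)\<^sup>2 - 2 * (m + 1) * A * \<bar>w x\<bar> + A\<^sup>2 \<partial>M)"
    by (intro Bochner_Integration.integral_cong refl)
      (simp add: power2_diff power_mult_distrib mult_ac)
  also have "\<dots> = (m + 1)\<^sup>2 * I - 2 * (m + 1) * A * A + A\<^sup>2 * m"
  proof -
    have i: "integrable M (\<lambda>x. (m + 1)\<^sup>2 * (w x)\<^sup>2)" "integrable M (\<lambda>x. 2 * (m + 1) * A * \<bar>w x\<bar>)"
      using w by (auto intro!: integrable_mult_right integrable_abs)
    have "(\<integral>x. (m + 1)\<^sup>2 * (w x)\<^sup>2 - 2 * (m + 1) * A * \<bar>w x\<bar> + A\<^sup>2 \<partial>M)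
        = (\<integral>x. (m + 1)\<^sup>2 * (w x)\<^sup>2 \<partial>M) - (\<integral>x. 2 * (m + 1) * A * \<bar>w x\<bar> \<partial>M) + (\<integral>x. A\<^sup>2 \<partial>M)"
      by (simp only: Bochner_Integration.integral_add Bochner_Integration.integral_diff
          Bochner_Integration.integrable_diff i c)
    then show ?thesis by (simp add: I_def A_def m_def mult.commute)
  qed
  finally have "(m + 2) * A\<^sup>2 \<le> (m + 1)\<^sup>2 * I" by (simp add: power2_eq_square algebra_simps)
  moreover have "(m + 1) * A\<^sup>2 \<le> (m + 2) * A\<^sup>2" by (intro mult_right_mono) auto
  ultimately have "(m + 1) * A\<^sup>2 \<le> (m + 1) * ((m + 1) * I)" by (simp add: power2_eq_square mult.assoc)
  then have "A\<^sup>2 \<le> (m + 1) * I" by (rule mult_left_le_imp_le) (use m in simp)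
  then show ?thesis by (simp only: m_def A_def I_def)
qed

context interval_system begin

section \<open>Estimates for 1 - t K in L1 and L2, and solvability of the equation\<close>

lemma kern_op_linear:
  assumes "integrable M f" "integrable M g"
  shows "kern_op (\<lambda>x. f x + g x) z = kern_op f z + kern_op g z" "kern_op (\<lambda>x. c * f x) z = c * kern_op f z"
proof -
  show "kern_op (\<lambda>x. f x + g x) z = kern_op f z + kern_op g z"
    unfolding kern_op_def distrib_left
    by (intro Bochner_Integration.integral_add integrable_kern_mult assms)
  show "kern_op (\<lambda>x. c * f x) z = c * kern_op f z"
    unfolding kern_op_def by (subst integral_mult_right_zero[symmetric]) (simp add: mult.left_commute)
qed

lemma kern_op_integrable:
  assumes "integrable M f"
  shows "integrable M (kern_op f)" "integrable M (\<lambda>x. (kern_op f x)\<^sup>2)"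
proof -
  obtain B where B: "\<And>z. \<bar>kern_op f z\<bar> \<le> B" using kern_op_bound[of thesis] assms by metis
  have m: "kern_op f \<in> borel_measurable M" by (intro measurable_M kern_op_measurable assms)
  then show "integrable M (kern_op f)" by (rule integrable_M_bounded[OF _ B])
  show "integrable M (\<lambda>x. (kern_op f x)\<^sup>2)"
    by (rule integrable_M_bounded[where B="B\<^sup>2"]) (use m B power_mono[OF B, of _ 2] in auto)
qed

text \<open>Split \<phi> into the residual and t K \<phi>. The L1 form is what the method of
  continuity can use, since K maps L1 into bounded functions and so turns it into a bound in the
  supremum norm.\<close>

lemma a_priori_L1:
  obtains K where "0 \<le> K"
    "\<And>t \<phi>. \<lbrakk>0 \<le> t; t \<le> 1; integrable M \<phi>\<rbrakk> \<Longrightarrow>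
      (\<integral>x. \<bar>\<phi> x\<bar> \<partial>M) \<le> K * (\<integral>x. \<bar>\<phi> x - t * kern_op \<phi> x\<bar> \<partial>M)"
proof -
  obtain K where K: "0 \<le> K"
    "\<And>t \<phi>. \<lbrakk>0 \<le> t; t \<le> 1; integrable M \<phi>\<rbrakk> \<Longrightarrow>
      (\<integral>x. (kern_op (\<lambda>x. t * \<phi> x) x)\<^sup>2 \<partial>M) \<le> K * (\<integral>x. \<bar>\<phi> x - kern_op (\<lambda>x. t * \<phi> x) x\<bar> \<partial>M)\<^sup>2"
    by (rule a_priori) blast
  define m where "m = measure M (space M) + 1"
  have m: "0 \<le> m" by (simp add: m_def)
  have "(\<integral>x. \<bar>\<phi> x\<bar> \<partial>M) \<le> (1 + sqrt (m * K)) * (\<integral>x. \<bar>\<phi> x - t * kern_op \<phi> x\<bar> \<partial>M)"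
    if t: "0 \<le> t" "t \<le> 1" and \<phi>: "integrable M \<phi>" for t \<phi>
  proof -
    have e: "kern_op (\<lambda>x. t * \<phi> x) = (\<lambda>x. t * kern_op \<phi> x)" by (simp add: fun_eq_iff kern_op_linear[OF \<phi> \<phi>])
    have i: "integrable M (\<lambda>x. t * kern_op \<phi> x)" "integrable M (\<lambda>x. (t * kern_op \<phi> x)\<^sup>2)"
      using kern_op_integrable[of "\<lambda>x. t * \<phi> x"] \<phi> by (auto simp: e)
    define X where "X = (\<integral>x. \<bar>\<phi> x - t * kern_op \<phi> x\<bar> \<partial>M)"
    have X: "0 \<le> X" by (simp add: X_def)
    have "(\<integral>x. \<bar>t * kern_op \<phi> x\<bar> \<partial>M)\<^sup>2 \<le> m * (\<integral>x. (t * kern_op \<phi> x)\<^sup>2 \<partial>M)"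
      unfolding m_def by (rule integral_abs_sq_le[OF finite_measure_M i])
    also have "\<dots> \<le> m * (K * X\<^sup>2)" using K(2)[OF t \<phi>] m by (intro mult_left_mono) (auto simp: e X_def)
    also have "\<dots> = (sqrt (m * K) * X)\<^sup>2" using m K(1) by (simp add: power_mult_distrib)
    finally have "(\<integral>x. \<bar>t * kern_op \<phi> x\<bar> \<partial>M) \<le> sqrt (m * K) * X"
      by (rule power2_le_imp_le) (use m K(1) X in auto)
    moreover have "(\<integral>x. \<bar>\<phi> x\<bar> \<partial>M) \<le> (\<integral>x. \<bar>\<phi> x - t * kern_op \<phi> x\<bar> + \<bar>t * kern_op \<phi> x\<bar> \<partial>M)"
      using \<phi> i by (intro integral_mono integrable_abs Bochner_Integration.integrable_add
          Bochner_Integration.integrable_diff) auto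
    moreover have "\<dots> = X + (\<integral>x. \<bar>t * kern_op \<phi> x\<bar> \<partial>M)"
      unfolding X_def using \<phi> i by (intro Bochner_Integration.integral_add integrable_abs
          Bochner_Integration.integrable_diff)
    ultimately show ?thesis by (simp add: X_def[symmetric] distrib_right)
  qed
  then show ?thesis using m K(1) by (intro that[of "1 + sqrt (m * K)"]) auto
qed

text \<open>The case t = 1 in the norm of the Hilbert space; it later yields both injectivity and
  the bound on the inverse.\<close>

lemma a_priori_L2:
  obtains K where "0 \<le> K"
    "\<And>\<phi>. \<lbrakk>integrable M \<phi>; integrable M (\<lambda>x. (\<phi> x)\<^sup>2)\<rbrakk> \<Longrightarrow>
      (\<integral>x. (\<phi> x)\<^sup>2 \<partial>M) \<le> K * (\<integral>x. (\<phi> x - kern_op \<phi> x)\<^sup>2 \<partial>M)"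
proof -
  obtain K where K: "0 \<le> K"
    "\<And>t \<phi>. \<lbrakk>0 \<le> t; t \<le> 1; integrable M \<phi>\<rbrakk> \<Longrightarrow>
      (\<integral>x. (kern_op (\<lambda>x. t * \<phi> x) x)\<^sup>2 \<partial>M) \<le> K * (\<integral>x. \<bar>\<phi> x - kern_op (\<lambda>x. t * \<phi> x) x\<bar> \<partial>M)\<^sup>2"
    by (rule a_priori) blast
  define m where "m = measure M (space M) + 1"
  have m: "0 \<le> m" by (simp add: m_def)
  have "(\<integral>x. (\<phi> x)\<^sup>2 \<partial>M) \<le> (2 + 2 * (K * m)) * (\<integral>x. (\<phi> x - kern_op \<phi> x)\<^sup>2 \<partial>M)"
    if \<phi>: "integrable M \<phi>" "integrable M (\<lambda>x. (\<phi> x)\<^sup>2)" for \<phi>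
  proof -
    have sq: "(a + b)\<^sup>2 \<le> 2 * a\<^sup>2 + 2 * b\<^sup>2" for a b :: real
      using zero_le_power2[of "a - b"] by (simp add: power2_eq_square algebra_simps)
    have g1: "integrable M (\<lambda>x. \<phi> x - kern_op \<phi> x)" using \<phi> kern_op_integrable(1)[OF \<phi>(1)] by auto
    have g2: "integrable M (\<lambda>x. (\<phi> x - kern_op \<phi> x)\<^sup>2)"
    proof (rule Bochner_Integration.integrable_bound)
      show "integrable M (\<lambda>x. 2 * (\<phi> x)\<^sup>2 + 2 * (kern_op \<phi> x)\<^sup>2)" using \<phi> kern_op_integrable(2)[OF \<phi>(1)] by auto
      show "(\<lambda>x. (\<phi> x - kern_op \<phi> x)\<^sup>2) \<in> borel_measurable M" using g1 by auto
      show "AE x in M. norm ((\<phi> x - kern_op \<phi> x)\<^sup>2) \<le> norm (2 * (\<phi> x)\<^sup>2 + 2 * (kern_op \<phi> x)\<^sup>2)"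
        using sq[of "\<phi> _" "- kern_op \<phi> _"] by (intro AE_I2) auto
    qed
    have split: "(\<phi> x)\<^sup>2 \<le> 2 * (\<phi> x - kern_op \<phi> x)\<^sup>2 + 2 * (kern_op \<phi> x)\<^sup>2" for x
      using sq[of "\<phi> x - kern_op \<phi> x" "kern_op \<phi> x"] by simp
    have "(\<integral>x. (kern_op \<phi> x)\<^sup>2 \<partial>M) \<le> K * (\<integral>x. \<bar>\<phi> x - kern_op \<phi> x\<bar> \<partial>M)\<^sup>2" using K(2)[of 1 \<phi>] \<phi> by simp
    also have "\<dots> \<le> K * (m * (\<integral>x. (\<phi> x - kern_op \<phi> x)\<^sup>2 \<partial>M))"
      using integral_abs_sq_le[OF finite_measure_M g1 g2] K(1) by (intro mult_left_mono) (auto simp: m_def)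
    finally have "(\<integral>x. (kern_op \<phi> x)\<^sup>2 \<partial>M) \<le> K * (m * (\<integral>x. (\<phi> x - kern_op \<phi> x)\<^sup>2 \<partial>M))" .
    moreover have "(\<integral>x. (\<phi> x)\<^sup>2 \<partial>M) \<le> (\<integral>x. 2 * (\<phi> x - kern_op \<phi> x)\<^sup>2 + 2 * (kern_op \<phi> x)\<^sup>2 \<partial>M)"
      using \<phi> g2 kern_op_integrable(2)[OF \<phi>(1)] split by (intro integral_mono) auto
    moreover have "\<dots> = 2 * (\<integral>x. (\<phi> x - kern_op \<phi> x)\<^sup>2 \<partial>M) + 2 * (\<integral>x. (kern_op \<phi> x)\<^sup>2 \<partial>M)"
      using g2 kern_op_integrable(2)[OF \<phi>(1)] by simp
    ultimately show ?thesis by (simp add: algebra_simps)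
  qed
  then show ?thesis using m K(1) by (intro that[of "2 + 2 * (K * m)"]) auto
qed

text \<open>The right-hand side is K f rather than f: it is bounded and continuous even when f is
  merely integrable, so the equation can be solved among bounded continuous functions. Then f + u
  solves the equation with right-hand side f.\<close>

lemma kern_op_solvable:
  assumes f: "integrable M f"
  obtains u where "integrable M u" "integrable M (\<lambda>x. (u x)\<^sup>2)" "\<And>z. u z - kern_op u z = kern_op f z"
proof -
  obtain B where B: "0 \<le> B" "\<And>\<phi> z. integrable M \<phi> \<Longrightarrow> \<bar>kern_op \<phi> z\<bar> \<le> B * (\<integral>x. \<bar>\<phi> x\<bar> \<partial>M)"
    by (rule kern_op_bound) blast
  obtain K where K: "0 \<le> K"
    "\<And>t \<phi>. \<lbrakk>0 \<le> t; t \<le> 1; integrable M \<phi>\<rbrakk> \<Longrightarrow>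
      (\<integral>x. \<bar>\<phi> x\<bar> \<partial>M) \<le> K * (\<integral>x. \<bar>\<phi> x - t * kern_op \<phi> x\<bar> \<partial>M)"
    by (rule a_priori_L1) blast
  define m where "m = measure M (space M)"
  have m: "0 \<le> m" by (simp add: m_def)
  have bc: "kern_op \<phi> \<in> bcontfun" if "integrable M \<phi>" for \<phi>
    using B(2)[OF that] kern_op_isCont[OF that]
    by (intro bcontfun_normI[of _ "B * (\<integral>x. \<bar>\<phi> x\<bar> \<partial>M)"] continuous_at_imp_continuous_on) auto
  have int: "integrable M (apply_bcontfun v)" and int2: "integrable M (\<lambda>x. (apply_bcontfun v x)\<^sup>2)" for v :: "real \<Rightarrow>\<^sub>C real"
  proof -
    have meas: "apply_bcontfun v \<in> borel_measurable M"
      by (intro measurable_M borel_measurable_continuous_onI) simp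
    have b: "\<bar>apply_bcontfun v x\<bar> \<le> norm v" for x using norm_bounded[of v x] by simp
    show "integrable M (apply_bcontfun v)" by (rule integrable_M_bounded[OF meas b])
    show "integrable M (\<lambda>x. (apply_bcontfun v x)\<^sup>2)"
      by (rule integrable_M_bounded[where B="(norm v)\<^sup>2"]) (use meas power_mono[OF b, of _ 2] in auto)
  qed
  have L1: "(\<integral>x. \<bar>apply_bcontfun v x\<bar> \<partial>M) \<le> m * norm v" for v :: "real \<Rightarrow>\<^sub>C real"
  proof -
    have "(\<integral>x. \<bar>apply_bcontfun v x\<bar> \<partial>M) \<le> (\<integral>x. norm v \<partial>M)"
      using norm_bounded[of v] by (intro integral_mono integrable_abs int finite_measure.integrable_const finite_measure_M) auto
    then show ?thesis by (simp add: m_def)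
  qed
  define \<T> :: "(real \<Rightarrow>\<^sub>C real) \<Rightarrow> (real \<Rightarrow>\<^sub>C real)" where "\<T> v = Bcontfun (kern_op (apply_bcontfun v))" for v
  have app: "apply_bcontfun (\<T> v) = kern_op (apply_bcontfun v)" for v
    unfolding \<T>_def by (rule Bcontfun_inverse[OF bc[OF int]])
  have bl: "bounded_linear \<T>"
  proof (rule bounded_linear_intro)
    show "\<T> (v + w) = \<T> v + \<T> w" for v w
      by (rule bcontfun_eqI) (simp add: app plus_bcontfun.rep_eq kern_op_linear[OF int int] cong: kern_op_linear)
    show "\<T> (r *\<^sub>R v) = r *\<^sub>R \<T> v" for r v
      by (rule bcontfun_eqI) (simp add: app scaleR_bcontfun.rep_eq kern_op_linear[OF int int])
    show "norm (\<T> v) \<le> norm v * (B * m)" for v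
    proof (rule norm_bound)
      fix x
      have "\<bar>kern_op (apply_bcontfun v) x\<bar> \<le> B * (m * norm v)"
        using B(2)[OF int[of v], of x] mult_left_mono[OF L1[of v] B(1)] by linarith
      then show "norm (apply_bcontfun (\<T> v) x) \<le> norm v * (B * m)" by (simp add: app mult_ac)
    qed
  qed
  have "\<exists>v. v - \<T> v = Bcontfun (kern_op f)"
  proof (rule method_of_continuity[OF bl])
    show "0 \<le> 1 + B * (K * m)" using B(1) K(1) m by simp
    fix t :: real and v :: "real \<Rightarrow>\<^sub>C real"
    assume t: "0 \<le> t" "t \<le> 1"
    define h where "h = v - t *\<^sub>R \<T> v"
    have h: "apply_bcontfun h x = apply_bcontfun v x - t * kern_op (apply_bcontfun v) x" for x
      by (simp add: h_def minus_bcontfun.rep_eq scaleR_bcontfun.rep_eq app)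
    have "(\<integral>x. \<bar>apply_bcontfun v x\<bar> \<partial>M) \<le> K * (\<integral>x. \<bar>apply_bcontfun h x\<bar> \<partial>M)"
      unfolding h by (rule K(2)[OF t int])
    also have "\<dots> \<le> K * (m * norm h)" using K(1) L1 by (intro mult_left_mono) auto
    finally have v1: "(\<integral>x. \<bar>apply_bcontfun v x\<bar> \<partial>M) \<le> K * (m * norm h)" .
    \<comment> \<open>From v = h + t K v: the supremum of K v is at most B times the L1 norm of v,
      which \<open>v1\<close> bounds by the supremum norm of h.\<close>
    show "norm v \<le> (1 + B * (K * m)) * norm (v - t *\<^sub>R \<T> v)"
    proof (rule norm_bound)
      fix x
      have "\<bar>kern_op (apply_bcontfun v) x\<bar> \<le> B * (K * (m * norm h))"
        using B(2)[OF int[of v], of x] mult_left_mono[OF v1 B(1)] by linarith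
      then have "t * \<bar>kern_op (apply_bcontfun v) x\<bar> \<le> 1 * (B * (K * (m * norm h)))"
        using t by (intro mult_mono) auto
      moreover have "\<bar>apply_bcontfun h x\<bar> \<le> norm h" using norm_bounded[of h x] by simp
      moreover have "apply_bcontfun v x = apply_bcontfun h x + t * kern_op (apply_bcontfun v) x" by (simp add: h)
      moreover have "\<bar>t * kern_op (apply_bcontfun v) x\<bar> = t * \<bar>kern_op (apply_bcontfun v) x\<bar>" using t by (simp add: abs_mult)
      ultimately have "\<bar>apply_bcontfun v x\<bar> \<le> norm h + B * (K * (m * norm h))" by linarith
      then show "norm (apply_bcontfun v x) \<le> (1 + B * (K * m)) * norm (v - t *\<^sub>R \<T> v)"
        by (simp add: h_def[symmetric] algebra_simps)
    qed
  qed
  then obtain v where v: "v - \<T> v = Bcontfun (kern_op f)" ..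
  have "apply_bcontfun v z - kern_op (apply_bcontfun v) z = kern_op f z" for z
    using arg_cong[OF v, of "\<lambda>w. apply_bcontfun w z"]
    by (simp add: minus_bcontfun.rep_eq app Bcontfun_inverse[OF bc[OF f]])
  then show ?thesis by (rule that[OF int int2])
qed

end

section \<open>The resolvent\<close>

context interval_system begin

text \<open>For x on another interval the explicit branch has a nonnegative real radicand and is
  real, while the boundary value at z is i times a nonnegative root; this i cancels the one in the
  prefactor.\<close>

lemma kernel_K_eq: "kernel_K \<alpha> \<beta> \<Theta> z x = of_real (kern z x)"
proof -
  have summand: "2 / (2 * of_real pi * \<i> * of_real (x - z)) * (of_real (\<Theta> $ j $ k) * sqrt_branch_plus (\<alpha> j) (\<beta> j) z /
        (of_real (\<Theta> $ j $ j) * sqrt_branch (\<alpha> j) (\<beta> j) (of_real x)) * indicator (J j) z * indicator (J k) x)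
      = of_real (\<Theta> $ j $ k / \<Theta> $ j $ j * (poisson_kernel (\<alpha> j) (\<beta> j) z x * indicator (J k) x))"
    if jk: "j \<noteq> k" for j k
  proof (cases "z \<in> J j \<and> x \<in> J k")
    case True
    then have xj: "x \<notin> J j" using J_disjoint[OF jk, of x] by blast
    have ratio: "0 \<le> (x - \<alpha> j) / (x - \<beta> j)" using xj less[of j] by (auto simp: zero_le_divide_iff)
    have "sqrt_branch (\<alpha> j) (\<beta> j) (of_real x)
        = (of_real x - of_real (\<beta> j)) * csqrt ((of_real x - of_real (\<alpha> j)) / (of_real x - of_real (\<beta> j)))"
      using xj by (intro sqrt_branch_explicit less) (auto simp: image_iff)
    also have "(of_real x - of_real (\<alpha> j)) / (of_real x - of_real (\<beta> j)) = complex_of_real ((x - \<alpha> j) / (x - \<beta> j))" by simp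
    also have "csqrt \<dots> = of_real (sqrt ((x - \<alpha> j) / (x - \<beta> j)))" by (rule of_real_sqrt[OF ratio, symmetric])
    finally have R: "sqrt_branch (\<alpha> j) (\<beta> j) (of_real x) = of_real (sqrt_ext (\<alpha> j) (\<beta> j) x)"
      by (simp add: sqrt_ext_def)
    have P: "sqrt_branch_plus (\<alpha> j) (\<beta> j) z = \<i> * of_real (sqrt ((z - \<alpha> j) * (\<beta> j - z)))"
      using True by (intro sqrt_branch_plus_explicit less) auto
    have "0 \<le> (z - \<alpha> j) * (\<beta> j - z)" using True by auto
    then have pk: "poisson_kernel (\<alpha> j) (\<beta> j) z x
        = sqrt ((z - \<alpha> j) * (\<beta> j - z)) / (pi * sqrt_ext (\<alpha> j) (\<beta> j) x * (x - z))"
      using True by (simp add: poisson_kernel_def max_def min_def)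
    have "2 / (2 * of_real pi * \<i> * X) * (c * (\<i> * s) / (e * r)) = c / e * (s / (of_real pi * r * X))"
      for X c s e r :: complex
      by (simp add: field_simps)
    from this[of "of_real (x - z)" "of_real (\<Theta> $ j $ k)" "of_real (sqrt ((z - \<alpha> j) * (\<beta> j - z)))"
        "of_real (\<Theta> $ j $ j)" "of_real (sqrt_ext (\<alpha> j) (\<beta> j) x)"]
    show ?thesis unfolding R P pk using True by simp
  next
    case False
    then show ?thesis using poisson_kernel_zero[of z j x] by auto
  qed
  show ?thesis
    unfolding kernel_K_def kern_def sum_distrib_left of_real_sum
    by (intro sum.cong refl summand) auto
qed

definition kern_op_complex :: "(real \<Rightarrow> complex) \<Rightarrow> real \<Rightarrow> complex" where
  "kern_op_complex f z = (\<integral>x. kernel_K \<alpha> \<beta> \<Theta> z x * f x \<partial>M)"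

section \<open>Complex-valued functions through real and imaginary parts\<close>

lemma L2_fun_parts:
  assumes "f \<in> L2_fun M"
  shows "integrable M (\<lambda>x. Re (f x))" "integrable M (\<lambda>x. Im (f x))"
    "integrable M (\<lambda>x. (Re (f x))\<^sup>2)" "integrable M (\<lambda>x. (Im (f x))\<^sup>2)"
proof -
  have m [measurable]: "f \<in> borel_measurable M" and i: "integrable M (\<lambda>x. (norm (f x))\<^sup>2)"
    using assms by (auto simp: L2_fun_def)
  have c: "integrable M (\<lambda>x. 1 + (norm (f x))\<^sup>2)"
    by (intro Bochner_Integration.integrable_add i finite_measure.integrable_const finite_measure_M)
  \<comment> \<open>On a space of finite measure this elementary bound makes square integrable
    functions integrable.\<close>
  have sq: "\<bar>y\<bar> \<le> 1 + N\<^sup>2" if "\<bar>y\<bar> \<le> N" for y N :: real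
    using that sum_squares_bound[of 1 N] by (simp add: power2_eq_square)
  show "integrable M (\<lambda>x. Re (f x))" "integrable M (\<lambda>x. Im (f x))"
    by (rule Bochner_Integration.integrable_bound[OF c]; use sq[OF abs_Re_le_cmod] sq[OF abs_Im_le_cmod] in force)+
  show "integrable M (\<lambda>x. (Re (f x))\<^sup>2)" "integrable M (\<lambda>x. (Im (f x))\<^sup>2)"
    by (rule Bochner_Integration.integrable_bound[OF i]; simp add: cmod_power2)+
qed

lemma L2_funI:
  assumes "f \<in> borel_measurable M" "integrable M (\<lambda>x. (Re (f x))\<^sup>2)" "integrable M (\<lambda>x. (Im (f x))\<^sup>2)"
  shows "f \<in> L2_fun M"
  using assms by (simp add: L2_fun_def cmod_power2)

lemma kern_op_complex_eq:
  assumes f: "f \<in> L2_fun M"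
  shows "kern_op_complex f z = Complex (kern_op (\<lambda>x. Re (f x)) z) (kern_op (\<lambda>x. Im (f x)) z)"
proof -
  have "integrable M (\<lambda>x. complex_of_real (kern z x * Re (f x)) + \<i> * complex_of_real (kern z x * Im (f x)))"
    using integrable_kern_mult[OF L2_fun_parts(1)[OF f], of z] integrable_kern_mult[OF L2_fun_parts(2)[OF f], of z]
    by (intro Bochner_Integration.integrable_add integrable_mult_right integrable_of_real)
  moreover have "complex_of_real (kern z x * Re (f x)) + \<i> * complex_of_real (kern z x * Im (f x))
      = kernel_K \<alpha> \<beta> \<Theta> z x * f x" for x
    by (simp add: kernel_K_eq complex_eq_iff)
  ultimately have i: "integrable M (\<lambda>x. kernel_K \<alpha> \<beta> \<Theta> z x * f x)" by simp
  have "Re (kern_op_complex f z) = kern_op (\<lambda>x. Re (f x)) z" "Im (kern_op_complex f z) = kern_op (\<lambda>x. Im (f x)) z"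
    unfolding kern_op_complex_def kern_op_def integral_Re[OF i, symmetric] integral_Im[OF i, symmetric] by (simp_all add: kernel_K_eq)
  then show ?thesis by (simp add: complex_eq_iff)
qed

lemma kern_op_complex_L2_fun:
  assumes f: "f \<in> L2_fun M" shows "kern_op_complex f \<in> L2_fun M"
proof (rule L2_funI)
  have e: "kern_op_complex f = (\<lambda>z. Complex (kern_op (\<lambda>x. Re (f x)) z) (kern_op (\<lambda>x. Im (f x)) z))"
    using kern_op_complex_eq[OF f] by auto
  have [measurable]: "kern_op (\<lambda>x. Re (f x)) \<in> borel_measurable borel" "kern_op (\<lambda>x. Im (f x)) \<in> borel_measurable borel"
    using L2_fun_parts[OF f] by (auto intro: kern_op_measurable)
  show "kern_op_complex f \<in> borel_measurable M"
    unfolding e Complex_eq by (rule measurable_restrict_space1, rule measurable_completion) simp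
  show "integrable M (\<lambda>x. (Re (kern_op_complex f x))\<^sup>2)" "integrable M (\<lambda>x. (Im (kern_op_complex f x))\<^sup>2)"
    using kern_op_integrable(2)[OF L2_fun_parts(1)[OF f]] kern_op_integrable(2)[OF L2_fun_parts(2)[OF f]] by (simp_all add: e)
qed

lemma operator_K_class:
  assumes f: "f \<in> L2_fun M"
  shows "operator_K \<alpha> \<beta> \<Theta> (L2_class M f) = L2_class M (kern_op_complex f)"
  unfolding operator_K_def kern_op_complex_def[abs_def]
proof (rule integral_operator_class[OF f])
  show "kernel_K \<alpha> \<beta> \<Theta> z \<in> borel_measurable M" for z
    unfolding kernel_K_eq[abs_def] by measurable
  show "(\<lambda>z. \<integral>x. kernel_K \<alpha> \<beta> \<Theta> z x * f x \<partial>M) \<in> L2_fun M"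
    using kern_op_complex_L2_fun[OF f] by (simp add: kern_op_complex_def[abs_def])
qed

lemma kern_op_complex_solvable:
  assumes g: "g \<in> L2_fun M"
  obtains f where "f \<in> L2_fun M" "\<And>z. kern_op_complex f z - f z = g z"
proof -
  note p = L2_fun_parts[OF g]
  obtain u where u: "integrable M u" "integrable M (\<lambda>x. (u x)\<^sup>2)" "\<And>z. u z - kern_op u z = kern_op (\<lambda>x. Re (g x)) z"
    using kern_op_solvable[OF p(1)] by blast
  obtain v where v: "integrable M v" "integrable M (\<lambda>x. (v x)\<^sup>2)" "\<And>z. v z - kern_op v z = kern_op (\<lambda>x. Im (g x)) z"
    using kern_op_solvable[OF p(2)] by blast
  have uv: "(\<lambda>z. complex_of_real (u z) + \<i> * complex_of_real (v z)) \<in> L2_fun M"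
  proof (rule L2_funI)
    show "(\<lambda>z. complex_of_real (u z) + \<i> * complex_of_real (v z)) \<in> borel_measurable M"
      using u(1) v(1) by auto
  qed (use u(2) v(2) in simp_all)
  \<comment> \<open>The minus sign passes from 1 - K to K - 1. With w = u + i v one gets K f - f = g
    + (w - K w) - K g, and w was chosen so that the last terms cancel.\<close>
  define f where "f = (\<lambda>z. - 1 * (g z + (complex_of_real (u z) + \<i> * complex_of_real (v z))))"
  have f: "f \<in> L2_fun M" unfolding f_def by (intro L2_fun_scale L2_fun_add g uv)
  have neg: "kern_op (\<lambda>x. - 1 * (h x + w x)) z = - (kern_op h z + kern_op w z)" if "integrable M h" "integrable M w" for h w z
    using kern_op_linear(1)[OF that, of z] kern_op_linear(2)[of "\<lambda>x. h x + w x" "\<lambda>x. h x + w x" "- 1" z] that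
    by simp
  have "(\<lambda>x. Re (f x)) = (\<lambda>x. - 1 * (Re (g x) + u x))" by (simp add: f_def fun_eq_iff)
  then have "kern_op (\<lambda>x. Re (f x)) z = - (kern_op (\<lambda>x. Re (g x)) z + kern_op u z)" for z
    by (simp only: neg[OF p(1) u(1)])
  moreover have "(\<lambda>x. Im (f x)) = (\<lambda>x. - 1 * (Im (g x) + v x))" by (simp add: f_def fun_eq_iff)
  then have "kern_op (\<lambda>x. Im (f x)) z = - (kern_op (\<lambda>x. Im (g x)) z + kern_op v z)" for z
    by (simp only: neg[OF p(2) v(1)])
  moreover have "Re (f z) = - (Re (g z) + u z)" "Im (f z) = - (Im (g z) + v z)" for z by (simp_all add: f_def)
  ultimately have "kern_op_complex f z - f z = g z" for z
    unfolding kern_op_complex_eq[OF f] complex_eq_iff using u(3)[of z] v(3)[of z] by simp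
  with f show ?thesis by (rule that)
qed

lemma kern_op_complex_bounded_below:
  obtains K where "0 \<le> K"
    "\<And>f. f \<in> L2_fun M \<Longrightarrow> (\<integral>x. (norm (f x))\<^sup>2 \<partial>M) \<le> K * (\<integral>x. (norm (kern_op_complex f x - f x))\<^sup>2 \<partial>M)"
proof -
  obtain K where K: "0 \<le> K" "\<And>\<phi>. \<lbrakk>integrable M \<phi>; integrable M (\<lambda>x. (\<phi> x)\<^sup>2)\<rbrakk> \<Longrightarrow>
      (\<integral>x. (\<phi> x)\<^sup>2 \<partial>M) \<le> K * (\<integral>x. (\<phi> x - kern_op \<phi> x)\<^sup>2 \<partial>M)"
    by (rule a_priori_L2) blast
  have "(\<integral>x. (norm (f x))\<^sup>2 \<partial>M) \<le> K * (\<integral>x. (norm (kern_op_complex f x - f x))\<^sup>2 \<partial>M)" if f: "f \<in> L2_fun M" for f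
  proof -
    note p = L2_fun_parts[OF f]
    have "(\<lambda>x. kern_op_complex f x + - 1 * f x) \<in> L2_fun M" by (intro L2_fun_add kern_op_complex_L2_fun L2_fun_scale f)
    from L2_fun_parts(3,4)[OF this]
    have d: "integrable M (\<lambda>x. (Re (f x) - kern_op (\<lambda>x. Re (f x)) x)\<^sup>2)" "integrable M (\<lambda>x. (Im (f x) - kern_op (\<lambda>x. Im (f x)) x)\<^sup>2)"
      by (simp_all add: kern_op_complex_eq[OF f] power2_commute)
    have "(\<integral>x. (norm (f x))\<^sup>2 \<partial>M) = (\<integral>x. (Re (f x))\<^sup>2 \<partial>M) + (\<integral>x. (Im (f x))\<^sup>2 \<partial>M)"
      using p by (simp add: cmod_power2)
    also have "\<dots> \<le> K * (\<integral>x. (Re (f x) - kern_op (\<lambda>x. Re (f x)) x)\<^sup>2 \<partial>M)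
        + K * (\<integral>x. (Im (f x) - kern_op (\<lambda>x. Im (f x)) x)\<^sup>2 \<partial>M)"
      using K(2) p by (intro add_mono) auto
    also have "\<dots> = K * (\<integral>x. (norm (kern_op_complex f x - f x))\<^sup>2 \<partial>M)"
      using d by (simp add: cmod_power2 kern_op_complex_eq[OF f] power2_commute[of "kern_op _ _"] distrib_left)
    finally show ?thesis .
  qed
  with K(1) show ?thesis by (rule that)
qed

end

section \<open>Passage to classes modulo null sets and to the resolvent\<close>

lemma L2_obtain:
  assumes "F \<in> L2 M" obtains f where "f \<in> L2_fun M" "F = L2_class M f"
  using assms by (auto simp: L2_def elim: quotientE)

text \<open>A stands for T - \<mu> acting on representatives. The lower bound serves twice: it makes
  preimages unique up to null sets, so that choosing them representative by representative defines a
  map on classes, and it bounds that map.\<close>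

lemma L2_resolventI:
  assumes A: "\<And>f. f \<in> L2_fun M \<Longrightarrow> A f \<in> L2_fun M"
    and shift: "\<And>f. f \<in> L2_fun M \<Longrightarrow> L2_shift M T \<mu> (L2_class M f) = L2_class M (A f)"
    and add: "\<And>f g x. f \<in> L2_fun M \<Longrightarrow> g \<in> L2_fun M \<Longrightarrow> A (\<lambda>x. f x + g x) x = A f x + A g x"
    and scale: "\<And>c f x. f \<in> L2_fun M \<Longrightarrow> A (\<lambda>x. c * f x) x = c * A f x"
    and surj: "\<And>g. g \<in> L2_fun M \<Longrightarrow> \<exists>f\<in>L2_fun M. \<forall>x. A f x = g x"
    and K: "0 \<le> K" "\<And>f. f \<in> L2_fun M \<Longrightarrow> (\<integral>x. (norm (f x))\<^sup>2 \<partial>M) \<le> K * (\<integral>x. (norm (A f x))\<^sup>2 \<partial>M)"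
  shows "\<mu> \<in> L2_resolvent_set M T"
proof -
  obtain s where s: "\<And>g. g \<in> L2_fun M \<Longrightarrow> s g \<in> L2_fun M" "\<And>g x. g \<in> L2_fun M \<Longrightarrow> A (s g) x = g x"
    using surj by metis
  define S where "S G = L2_class M (s (SOME g. g \<in> G))" for G
  have S: "S (L2_class M g) = L2_class M f"
    if f: "f \<in> L2_fun M" and g: "g \<in> L2_fun M" and ae: "AE x in M. A f x = g x" for f g
  proof -
    define h where "h = (SOME h. h \<in> L2_class M g)"
    have "h \<in> L2_class M g"
      unfolding h_def by (rule someI[of "\<lambda>h. h \<in> L2_class M g"]) (rule L2_class_mem(1)[OF g])
    then have h: "h \<in> L2_fun M" "AE x in M. g x = h x" by (auto simp: L2_rel_def)
    \<comment> \<open>The chosen preimage and f differ by w, and A w = 0 almost everywhere; the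
      lower bound then forces w = 0 almost everywhere.\<close>
    define w where "w = (\<lambda>x. s h x + - 1 * f x)"
    have w: "w \<in> L2_fun M" unfolding w_def by (intro L2_fun_add L2_fun_scale s h f)
    have "A w x = h x - A f x" for x
      unfolding w_def using add[OF s(1)[OF h(1)] L2_fun_scale[OF f], of "- 1" x] scale[OF f, of "- 1" x] s(2)[OF h(1)]
      by simp
    then have "AE x in M. A w x = 0" using h(2) ae by (auto elim: eventually_elim2)
    then have "(\<integral>x. (norm (A w x))\<^sup>2 \<partial>M) = 0"
      by (intro integral_eq_zero_AE) (auto elim: eventually_mono)
    then have "(\<integral>x. (norm (w x))\<^sup>2 \<partial>M) = 0" using K(2)[OF w] by (simp add: order_antisym)
    moreover have "integrable M (\<lambda>x. (norm (w x))\<^sup>2)" using w by (simp add: L2_fun_def)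
    ultimately have "AE x in M. (norm (w x))\<^sup>2 = 0" by (subst (asm) integral_nonneg_eq_0_iff_AE) auto
    then have "AE x in M. s h x = f x" by eventually_elim (simp add: w_def)
    then show ?thesis
      unfolding S_def h_def[symmetric] using s h f by (intro L2_class_eqI) auto
  qed
  have S': thesis
    if "F \<in> L2 M" and that: "\<And>f g. \<lbrakk>f \<in> L2_fun M; F = L2_class M f; g \<in> L2_fun M; S F = L2_class M g; A g = f\<rbrakk> \<Longrightarrow> thesis"
    for F thesis
  proof -
    from \<open>F \<in> L2 M\<close> obtain f where f: "f \<in> L2_fun M" "F = L2_class M f" by (rule L2_obtain)
    have "A (s f) = f" using s(2)[OF f(1)] by auto
    then show thesis using f S[OF s(1) f(1)] by (intro that[of f "s f"] s(1)) auto
  qed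
  have "L2_bounded_operator M S"
    unfolding L2_bounded_operator_def
  proof (intro conjI ballI allI)
    fix F assume "F \<in> L2 M"
    then obtain f where "f \<in> L2_fun M" "S F = L2_class M f" by (rule S')
    then show "S F \<in> L2 M" by (simp add: L2_class_mem(2))
  next
    fix F G assume "F \<in> L2 M" "G \<in> L2 M"
    obtain f f' where f: "f \<in> L2_fun M" "F = L2_class M f" "f' \<in> L2_fun M" "S F = L2_class M f'" "A f' = f"
      using \<open>F \<in> L2 M\<close> by (rule S')
    obtain g g' where g: "g \<in> L2_fun M" "G = L2_class M g" "g' \<in> L2_fun M" "S G = L2_class M g'" "A g' = g"
      using \<open>G \<in> L2 M\<close> by (rule S')
    have "S (L2_class M (\<lambda>x. f x + g x)) = L2_class M (\<lambda>x. f' x + g' x)"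
      using f g by (intro S L2_fun_add) (auto simp: add)
    then show "S (L2_add M F G) = L2_add M (S F) (S G)"
      using f g by (simp add: L2_add_class)
  next
    fix c F assume "F \<in> L2 M"
    then obtain f f' where f: "f \<in> L2_fun M" "F = L2_class M f" "f' \<in> L2_fun M" "S F = L2_class M f'" "A f' = f"
      by (rule S')
    have "S (L2_class M (\<lambda>x. c * f x)) = L2_class M (\<lambda>x. c * f' x)"
      using f by (intro S L2_fun_scale) (auto simp: scale)
    then show "S (L2_scale M c F) = L2_scale M c (S F)"
      using f by (simp add: L2_scale_class)
  next
    show "\<exists>C. \<forall>F\<in>L2 M. L2_norm M (S F) \<le> C * L2_norm M F"
    proof (intro exI ballI)
      fix F assume "F \<in> L2 M"
      then obtain f f' where f: "f \<in> L2_fun M" "F = L2_class M f" "f' \<in> L2_fun M" "S F = L2_class M f'" "A f' = f"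
        by (rule S')
      have "sqrt (\<integral>x. (norm (f' x))\<^sup>2 \<partial>M) \<le> sqrt (K * (\<integral>x. (norm (f x))\<^sup>2 \<partial>M))"
        using K(2)[OF f(3)] by (simp add: f(5))
      then show "L2_norm M (S F) \<le> sqrt K * L2_norm M F"
        using f by (simp add: L2_norm_class real_sqrt_mult)
    qed
  qed
  moreover have "S (L2_shift M T \<mu> F) = F" if "F \<in> L2 M" for F
  proof -
    from that obtain f where f: "f \<in> L2_fun M" "F = L2_class M f" by (rule L2_obtain)
    then show ?thesis using S[OF f(1) A[OF f(1)]] by (simp add: shift)
  qed
  moreover have "L2_shift M T \<mu> (S F) = F" if "F \<in> L2 M" for F
  proof -
    from that obtain f f' where "F = L2_class M f" "f' \<in> L2_fun M" "S F = L2_class M f'" "A f' = f"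
      by (rule S')
    then show ?thesis by (simp add: shift)
  qed
  ultimately show ?thesis unfolding L2_resolvent_set_def by blast
qed

theorem lemma2p7:
  fixes \<alpha> \<beta> :: "'n::{finite,linorder} \<Rightarrow> real" and \<Theta> :: "real^'n::{finite,linorder}^'n::{finite,linorder}"
  assumes "\<And>j. \<alpha> j < \<beta> j"
    and "\<And>j k. j < k \<Longrightarrow> \<beta> j < \<alpha> k"
    and "transpose \<Theta> = \<Theta>"
    and "positive_definite \<Theta>"
  shows "1 \<notin> L2_spectrum (lebesgue_on (union_I \<alpha> \<beta>)) (operator_K \<alpha> \<beta> \<Theta>)"
proof -
  interpret interval_system \<alpha> \<beta> \<Theta> by unfold_locales (fact assms)+
  obtain K where K: "0 \<le> K"
    "\<And>f. f \<in> L2_fun M \<Longrightarrow> (\<integral>x. (norm (f x))\<^sup>2 \<partial>M) \<le> K * (\<integral>x. (norm (kern_op_complex f x - f x))\<^sup>2 \<partial>M)"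
    by (rule kern_op_complex_bounded_below) blast
  have "1 \<in> L2_resolvent_set M (operator_K \<alpha> \<beta> \<Theta>)"
  \<comment> \<open>The subtraction is written with the factor - 1 to match the form of
    \<open>L2_shift\<close> at the spectral parameter 1.\<close>
  proof (rule L2_resolventI[where A="\<lambda>f x. kern_op_complex f x + - 1 * f x" and K=K])
    fix f assume f: "f \<in> L2_fun M"
    show "(\<lambda>x. kern_op_complex f x + - 1 * f x) \<in> L2_fun M" by (intro L2_fun_add kern_op_complex_L2_fun L2_fun_scale f)
    show "L2_shift M (operator_K \<alpha> \<beta> \<Theta>) 1 (L2_class M f) = L2_class M (\<lambda>x. kern_op_complex f x + - 1 * f x)"
      unfolding L2_shift_def operator_K_class[OF f] L2_scale_class[OF f]
      by (intro L2_add_class kern_op_complex_L2_fun L2_fun_scale f)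
    show "(\<integral>x. (norm (f x))\<^sup>2 \<partial>M) \<le> K * (\<integral>x. (norm (kern_op_complex f x + - 1 * f x))\<^sup>2 \<partial>M)"
      using K(2)[OF f] by simp
    show "kern_op_complex (\<lambda>x. c * f x) x + - 1 * (c * f x) = c * (kern_op_complex f x + - 1 * f x)" for c x
      unfolding kern_op_complex_def by (simp add: right_diff_distrib mult.left_commute[of _ c])
    show "kern_op_complex (\<lambda>x. f x + g x) x + - 1 * (f x + g x) = kern_op_complex f x + - 1 * f x + (kern_op_complex g x + - 1 * g x)"
      if g: "g \<in> L2_fun M" for g x
      using kern_op_linear(1)[OF L2_fun_parts(1)[OF f] L2_fun_parts(1)[OF g], of x]
        kern_op_linear(1)[OF L2_fun_parts(2)[OF f] L2_fun_parts(2)[OF g], of x]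
      by (simp add: kern_op_complex_eq f g L2_fun_add complex_eq_iff)
    show "\<exists>h\<in>L2_fun M. \<forall>x. kern_op_complex h x + - 1 * h x = f x"
    proof -
      obtain h where "h \<in> L2_fun M" "\<And>z. kern_op_complex h z - h z = f z" using kern_op_complex_solvable[OF f] by blast
      then show ?thesis by (intro bexI[of _ h]) auto
    qed
  qed (rule K(1))
  then show ?thesis by (simp add: L2_spectrum_def)
qed

end
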